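(* Let $M$ be a Riemannian manifold without conjugate points. Then for any submanifold $N$ of $M$ and any geodesic $\gamma$ orthogonal to $N$, there are at most $\dim(N)$ focal points of $N$ along $\gamma$, counted with multiplicity.
   Context: "Without conjugate points" means: for every non-constant geodesic $c:[a,b]\to M$ with $a<b$, there is no non-zero Jacobi field $J$ along $c$ with $J(a)=J(b)=0$. A geodesic orthogonal to $N$ is a non-constant geodesic $\gamma:I\to M$ defined on an interval $I\ni 0$ with $\gamma(0)\in N$ and $\gamma'(0)\perp T_{\gamma(0)}N$. Normal Jacobi fields along $\gamma$ are vector fields $J\perp\gamma'$ along $\gamma$ with $J''+\mathcal{R}(J,\gamma')\gamma'=0$, where $\mathcal{R}$ is the curvature tensor and $'$ is covariant differentiation along $\gamma$. $\Lambda^N$ denotes the space of normal $N$-Jacobi fields, i.e. normal Jacobi fields $J$ along $\gamma$ with $J(0)\in T_{\gamma(0)}N$ and $J'(0)+S_{\gamma'(0)}J(0)\perp T_{\gamma(0)}N$, where $S_\nu$ is the shape operator of $N$, $\langle S_\nu x,y\rangle=\langle \mathrm{II}(x,y),\nu\rangle$. A focal point of $N$ along $\gamma$ is a $t\in I$, $t\neq 0$, such that some non-zero $J\in\Lambda^N$ satisfies $J(t)=0$; its multiplicity is $\dim\{J\in\Lambda^N\mid J(t)=0\}$. (All focal points in $I\setminus\{0\}$, on both sides of $0$, are counted.) *)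

theory Defs
  imports "HOL-Analysis.Analysis" "HOL-Library.Function_Algebras"
begin

text \<open>Pointwise real vector space structure on functions, so that the library's \<^const>\<open>dim\<close>
  applies to spaces of vector fields along a curve.\<close>

instantiation "fun" :: (type, scaleR) scaleR
begin
definition scaleR_fun_def: "r *\<^sub>R f = (\<lambda>x. r *\<^sub>R f x)"
instance ..
end

instance "fun" :: (type, real_vector) real_vector
  by standard (simp_all add: scaleR_fun_def fun_eq_iff scaleR_add_right scaleR_add_left)

text \<open>The following is used only for open sets S and for S a relatively open subset of a
  nondegenerate interval of reals; for those, derivatives within S are unique.\<close>

fun Ck_on :: "nat \<Rightarrow> 'a::real_normed_vector set \<Rightarrow> ('a \<Rightarrow> 'b::real_normed_vector) \<Rightarrow> bool" where
  "Ck_on 0 S f \<longleftrightarrow> continuous_on S f"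
| "Ck_on (Suc k) S f \<longleftrightarrow>
     f differentiable_on S \<and> (\<forall>v. Ck_on k S (\<lambda>x. frechet_derivative f (at x within S) v))"

definition smooth_on :: "'a::real_normed_vector set \<Rightarrow> ('a \<Rightarrow> 'b::real_normed_vector) \<Rightarrow> bool" where
  "smooth_on S f \<longleftrightarrow> (\<forall>k. Ck_on k S f)"


section \<open>Smooth manifolds\<close>

text \<open>A chart is a domain together with a coordinate map into the model space, whose values
  outside the domain are irrelevant. A tangent vector at p is represented by the family of its
  components in all charts around p, extended by 0 to the other charts; ip M p v w is the metric
  at p. The dimension of the manifold is the dimension of the model space.\<close>

type_synonym ('a, 'e) chart = "'a set \<times> ('a \<Rightarrow> 'e)"
type_synonym ('a, 'e) tvec = "('a, 'e) chart \<Rightarrow> 'e"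

record ('a, 'e) riem =
  Top :: "'a topology"
  Atlas :: "('a, 'e) chart set"
  ip :: "'a \<Rightarrow> ('a, 'e) tvec \<Rightarrow> ('a, 'e) tvec \<Rightarrow> real"

definition is_chart :: "'a topology \<Rightarrow> ('a, 'e::euclidean_space) chart \<Rightarrow> bool" where
  "is_chart X \<phi> \<longleftrightarrow> openin X (fst \<phi>) \<and> open (snd \<phi> ` fst \<phi>) \<and>
     homeomorphic_map (subtopology X (fst \<phi>)) (top_of_set (snd \<phi> ` fst \<phi>)) (snd \<phi>)"

definition chart_inv :: "('a, 'e) chart \<Rightarrow> 'e \<Rightarrow> 'a" where
  "chart_inv \<phi> = inv_into (fst \<phi>) (snd \<phi>)"

definition transition :: "('a, 'e) chart \<Rightarrow> ('a, 'e) chart \<Rightarrow> 'e \<Rightarrow> 'e" where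
  "transition \<phi> \<psi> = snd \<psi> \<circ> chart_inv \<phi>"

definition compatible :: "('a, 'e::euclidean_space) chart \<Rightarrow> ('a, 'e) chart \<Rightarrow> bool" where
  "compatible \<phi> \<psi> \<longleftrightarrow>
     smooth_on (snd \<phi> ` (fst \<phi> \<inter> fst \<psi>)) (transition \<phi> \<psi>) \<and>
     smooth_on (snd \<psi> ` (fst \<phi> \<inter> fst \<psi>)) (transition \<psi> \<phi>)"

definition smooth_manifold :: "'a topology \<Rightarrow> ('a, 'e::euclidean_space) chart set \<Rightarrow> bool" where
  "smooth_manifold X A \<longleftrightarrow>
     Hausdorff_space X \<and> second_countable X \<and>
     (\<forall>\<phi>\<in>A. is_chart X \<phi>) \<and> (\<Union>\<phi>\<in>A. fst \<phi>) = topspace X \<and>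
     (\<forall>\<phi>\<in>A. \<forall>\<psi>\<in>A. compatible \<phi> \<psi>) \<and>
     (\<forall>\<phi>. is_chart X \<phi> \<and> (\<forall>\<psi>\<in>A. compatible \<phi> \<psi>) \<longrightarrow> \<phi> \<in> A)"

definition chart_at :: "('a, 'e) riem \<Rightarrow> 'a \<Rightarrow> ('a, 'e) chart \<Rightarrow> bool" where
  "chart_at M p \<phi> \<longleftrightarrow> \<phi> \<in> Atlas M \<and> p \<in> fst \<phi>"

definition tangent_space :: "('a, 'e::euclidean_space) riem \<Rightarrow> 'a \<Rightarrow> ('a, 'e) tvec set" where
  "tangent_space M p =
     {v. (\<forall>\<phi>. \<not> chart_at M p \<phi> \<longrightarrow> v \<phi> = 0) \<and>
         (\<forall>\<phi> \<psi>. chart_at M p \<phi> \<and> chart_at M p \<psi> \<longrightarrow>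
            v \<psi> = frechet_derivative (transition \<phi> \<psi>) (at (snd \<phi> p)) (v \<phi>))}"

text \<open>The tangent vector at p with component u in the chart \<open>\<phi>\<close>.\<close>

definition coord_vec ::
  "('a, 'e::euclidean_space) riem \<Rightarrow> ('a, 'e) chart \<Rightarrow> 'a \<Rightarrow> 'e \<Rightarrow> ('a, 'e) tvec" where
  "coord_vec M \<phi> p u = (\<lambda>\<psi>. if chart_at M p \<psi>
     then frechet_derivative (transition \<phi> \<psi>) (at (snd \<phi> p)) u else 0)"


section \<open>Riemannian metrics, Levi-Civita connection and curvature\<close>

definition coord_metric ::
  "('a, 'e::euclidean_space) riem \<Rightarrow> ('a, 'e) chart \<Rightarrow> 'e \<Rightarrow> 'e \<Rightarrow> 'e \<Rightarrow> real" where
  "coord_metric M \<phi> x u w =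
     ip M (chart_inv \<phi> x) (coord_vec M \<phi> (chart_inv \<phi> x) u) (coord_vec M \<phi> (chart_inv \<phi> x) w)"

definition riemannian_manifold :: "('a, 'e::euclidean_space) riem \<Rightarrow> bool" where
  "riemannian_manifold M \<longleftrightarrow>
     smooth_manifold (Top M) (Atlas M) \<and>
     (\<forall>p\<in>topspace (Top M). \<forall>v\<in>tangent_space M p. \<forall>w\<in>tangent_space M p.
        ip M p v w = ip M p w v \<and>
        (\<forall>v'\<in>tangent_space M p. ip M p (v + v') w = ip M p v w + ip M p v' w) \<and>
        (\<forall>r. ip M p (r *\<^sub>R v) w = r * ip M p v w) \<and>
        (v \<noteq> 0 \<longrightarrow> ip M p v v > 0)) \<and>
     (\<forall>\<phi>\<in>Atlas M. \<forall>u w. smooth_on (snd \<phi> ` fst \<phi>) (\<lambda>x. coord_metric M \<phi> x u w))"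

text \<open>The Christoffel symbols in the chart \<open>\<phi>\<close> as a bilinear map, in the form
  \<open>\<langle>\<Gamma>(u,w), v\<rangle> = (\<partial>\<^sub>u\<langle>w,v\<rangle> + \<partial>\<^sub>w\<langle>u,v\<rangle> - \<partial>\<^sub>v\<langle>u,w\<rangle>) / 2\<close> for constant u, v, w.\<close>

definition christoffel ::
  "('a, 'e::euclidean_space) riem \<Rightarrow> ('a, 'e) chart \<Rightarrow> 'e \<Rightarrow> 'e \<Rightarrow> 'e \<Rightarrow> 'e" where
  "christoffel M \<phi> x u w = (THE z. \<forall>v. coord_metric M \<phi> x z v =
     (frechet_derivative (\<lambda>y. coord_metric M \<phi> y w v) (at x) u
    + frechet_derivative (\<lambda>y. coord_metric M \<phi> y u v) (at x) w
    - frechet_derivative (\<lambda>y. coord_metric M \<phi> y u w) (at x) v) / 2)"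

text \<open>The sign convention is
  \<open>R(X,Y)Z = \<nabla>\<^sub>X\<nabla>\<^sub>Y Z - \<nabla>\<^sub>Y\<nabla>\<^sub>X Z - \<nabla>\<^bsub>[X,Y]\<^esub> Z\<close>.\<close>

definition coord_curvature ::
  "('a, 'e::euclidean_space) riem \<Rightarrow> ('a, 'e) chart \<Rightarrow> 'e \<Rightarrow> 'e \<Rightarrow> 'e \<Rightarrow> 'e \<Rightarrow> 'e" where
  "coord_curvature M \<phi> x u v w =
     frechet_derivative (\<lambda>y. christoffel M \<phi> y v w) (at x) u
   - frechet_derivative (\<lambda>y. christoffel M \<phi> y u w) (at x) v
   + christoffel M \<phi> x u (christoffel M \<phi> x v w)
   - christoffel M \<phi> x v (christoffel M \<phi> x u w)"

definition curvature ::
  "('a, 'e::euclidean_space) riem \<Rightarrow> 'a \<Rightarrow> ('a, 'e) tvec \<Rightarrow> ('a, 'e) tvec \<Rightarrow> ('a, 'e) tvec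
     \<Rightarrow> ('a, 'e) tvec" where
  "curvature M p u v w = (\<lambda>\<phi>. if chart_at M p \<phi>
     then coord_curvature M \<phi> (snd \<phi> p) (u \<phi>) (v \<phi>) (w \<phi>) else 0)"


section \<open>Curves and vector fields along curves\<close>

definition smooth_curve ::
  "('a, 'e::euclidean_space) riem \<Rightarrow> real set \<Rightarrow> (real \<Rightarrow> 'a) \<Rightarrow> bool" where
  "smooth_curve M I c \<longleftrightarrow> continuous_map (top_of_set I) (Top M) c \<and>
     (\<forall>\<phi>\<in>Atlas M. smooth_on {t\<in>I. c t \<in> fst \<phi>} (\<lambda>t. snd \<phi> (c t)))"

definition velocity ::
  "('a, 'e::euclidean_space) riem \<Rightarrow> real set \<Rightarrow> (real \<Rightarrow> 'a) \<Rightarrow> real \<Rightarrow> ('a, 'e) tvec" where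
  "velocity M I c t = (\<lambda>\<phi>. if t \<in> I \<and> chart_at M (c t) \<phi>
     then vector_derivative (\<lambda>s. snd \<phi> (c s)) (at t within I) else 0)"

text \<open>Fields are extended by 0 outside I, so that a field along \<open>c : I \<rightarrow> M\<close> is determined by its
  values on I. The components of the field V at t are \<open>V t \<phi>\<close>.\<close>

definition field_along ::
  "('a, 'e::euclidean_space) riem \<Rightarrow> real set \<Rightarrow> (real \<Rightarrow> 'a) \<Rightarrow> (real \<Rightarrow> ('a, 'e) tvec) \<Rightarrow> bool" where
  "field_along M I c V \<longleftrightarrow>
     (\<forall>t\<in>I. V t \<in> tangent_space M (c t)) \<and> (\<forall>t. t \<notin> I \<longrightarrow> V t = 0) \<and>
     (\<forall>\<phi>\<in>Atlas M. smooth_on {t\<in>I. c t \<in> fst \<phi>} (\<lambda>t. V t \<phi>))"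

definition cov_deriv ::
  "('a, 'e::euclidean_space) riem \<Rightarrow> real set \<Rightarrow> (real \<Rightarrow> 'a) \<Rightarrow> (real \<Rightarrow> ('a, 'e) tvec)
     \<Rightarrow> real \<Rightarrow> ('a, 'e) tvec" where
  "cov_deriv M I c V t = (\<lambda>\<phi>. if t \<in> I \<and> chart_at M (c t) \<phi>
     then vector_derivative (\<lambda>s. V s \<phi>) (at t within I)
          + christoffel M \<phi> (snd \<phi> (c t)) (velocity M I c t \<phi>) (V t \<phi>)
     else 0)"

definition geodesic ::
  "('a, 'e::euclidean_space) riem \<Rightarrow> real set \<Rightarrow> (real \<Rightarrow> 'a) \<Rightarrow> bool" where
  "geodesic M I c \<longleftrightarrow> is_interval I \<and> smooth_curve M I c \<and>
     (\<forall>t\<in>I. cov_deriv M I c (velocity M I c) t = 0)"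

definition jacobi_field ::
  "('a, 'e::euclidean_space) riem \<Rightarrow> real set \<Rightarrow> (real \<Rightarrow> 'a) \<Rightarrow> (real \<Rightarrow> ('a, 'e) tvec) \<Rightarrow> bool" where
  "jacobi_field M I c J \<longleftrightarrow> field_along M I c J \<and>
     (\<forall>t\<in>I. cov_deriv M I c (cov_deriv M I c J) t
        + curvature M (c t) (J t) (velocity M I c t) (velocity M I c t) = 0)"

definition without_conjugate_points :: "('a, 'e::euclidean_space) riem \<Rightarrow> bool" where
  "without_conjugate_points M \<longleftrightarrow>
     (\<forall>a b c. a < b \<and> geodesic M {a..b} c \<and> \<not> c constant_on {a..b} \<longrightarrow>
        \<not> (\<exists>J. jacobi_field M {a..b} c J \<and> J \<noteq> 0 \<and> J a = 0 \<and> J b = 0))"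


section \<open>Submanifolds\<close>

text \<open>A submanifold N of dimension k carries its own topology, which need not be the subspace
  topology: injectively immersed submanifolds are included. Every point of N has an
  N-open neighbourhood W that is a slice in some chart of M, in the sense that the chart
  restricts to a chart of N on W with values in a k-dimensional linear subspace L of the model
  space.\<close>

definition slice_chart ::
  "('a, 'e::euclidean_space) riem \<Rightarrow> nat \<Rightarrow> 'a topology \<Rightarrow> ('a, 'e) chart \<Rightarrow> 'a set \<Rightarrow> 'e set \<Rightarrow> bool" where
  "slice_chart M k N \<phi> W L \<longleftrightarrow>
     \<phi> \<in> Atlas M \<and> openin N W \<and> W \<subseteq> fst \<phi> \<and> subspace L \<and> dim L = k \<and>
     homeomorphic_map (subtopology N W) (top_of_set (snd \<phi> ` fst \<phi> \<inter> L)) (snd \<phi>)"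

definition submanifold :: "('a, 'e::euclidean_space) riem \<Rightarrow> nat \<Rightarrow> 'a topology \<Rightarrow> bool" where
  "submanifold M k N \<longleftrightarrow>
     Hausdorff_space N \<and> second_countable N \<and> topspace N \<subseteq> topspace (Top M) \<and>
     (\<forall>p\<in>topspace N. \<exists>\<phi> W L. p \<in> W \<and> slice_chart M k N \<phi> W L)"

definition tangent_sub ::
  "('a, 'e::euclidean_space) riem \<Rightarrow> nat \<Rightarrow> 'a topology \<Rightarrow> 'a \<Rightarrow> ('a, 'e) tvec set" where
  "tangent_sub M k N p =
     {v \<in> tangent_space M p. \<exists>\<phi> W L. p \<in> W \<and> slice_chart M k N \<phi> W L \<and> v \<phi> \<in> L}"

definition normal_space ::
  "('a, 'e::euclidean_space) riem \<Rightarrow> nat \<Rightarrow> 'a topology \<Rightarrow> 'a \<Rightarrow> ('a, 'e) tvec set" where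
  "normal_space M k N p = {v \<in> tangent_space M p. \<forall>w\<in>tangent_sub M k N p. ip M p v w = 0}"

text \<open>\<open>II(x,y)\<close> is the normal part of the covariant derivative at p of a field Y tangent
  to N with value y at p, taken along a curve in N through p with velocity x.\<close>

definition second_ff ::
  "('a, 'e::euclidean_space) riem \<Rightarrow> nat \<Rightarrow> 'a topology \<Rightarrow> 'a \<Rightarrow> ('a, 'e) tvec \<Rightarrow> ('a, 'e) tvec
     \<Rightarrow> ('a, 'e) tvec" where
  "second_ff M k N p x y = (THE z. z \<in> normal_space M k N p \<and>
     (\<exists>\<epsilon>>0. \<exists>c Y. let I = {-\<epsilon><..<\<epsilon>} in
        smooth_curve M I c \<and> continuous_map (top_of_set I) N c \<and>
        c 0 = p \<and> velocity M I c 0 = x \<and>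
        field_along M I c Y \<and> (\<forall>t\<in>I. Y t \<in> tangent_sub M k N (c t)) \<and> Y 0 = y \<and>
        cov_deriv M I c Y 0 - z \<in> tangent_sub M k N p))"

definition shape_op ::
  "('a, 'e::euclidean_space) riem \<Rightarrow> nat \<Rightarrow> 'a topology \<Rightarrow> 'a \<Rightarrow> ('a, 'e) tvec \<Rightarrow> ('a, 'e) tvec
     \<Rightarrow> ('a, 'e) tvec" where
  "shape_op M k N p \<nu> x = (THE s. s \<in> tangent_sub M k N p \<and>
     (\<forall>y\<in>tangent_sub M k N p. ip M p s y = ip M p (second_ff M k N p x y) \<nu>))"


section \<open>Focal points\<close>

definition orthogonal_geodesic ::
  "('a, 'e::euclidean_space) riem \<Rightarrow> nat \<Rightarrow> 'a topology \<Rightarrow> real set \<Rightarrow> (real \<Rightarrow> 'a) \<Rightarrow> bool" where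
  "orthogonal_geodesic M k N I \<gamma> \<longleftrightarrow>
     geodesic M I \<gamma> \<and> \<not> \<gamma> constant_on I \<and> 0 \<in> I \<and> \<gamma> 0 \<in> topspace N \<and>
     velocity M I \<gamma> 0 \<in> normal_space M k N (\<gamma> 0)"

definition normal_jacobi_field ::
  "('a, 'e::euclidean_space) riem \<Rightarrow> real set \<Rightarrow> (real \<Rightarrow> 'a) \<Rightarrow> (real \<Rightarrow> ('a, 'e) tvec) \<Rightarrow> bool" where
  "normal_jacobi_field M I \<gamma> J \<longleftrightarrow>
     jacobi_field M I \<gamma> J \<and> (\<forall>t\<in>I. ip M (\<gamma> t) (J t) (velocity M I \<gamma> t) = 0)"

definition N_jacobi ::
  "('a, 'e::euclidean_space) riem \<Rightarrow> nat \<Rightarrow> 'a topology \<Rightarrow> real set \<Rightarrow> (real \<Rightarrow> 'a)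
     \<Rightarrow> (real \<Rightarrow> ('a, 'e) tvec) set" where
  "N_jacobi M k N I \<gamma> = {J. normal_jacobi_field M I \<gamma> J \<and>
     J 0 \<in> tangent_sub M k N (\<gamma> 0) \<and>
     cov_deriv M I \<gamma> J 0 + shape_op M k N (\<gamma> 0) (velocity M I \<gamma> 0) (J 0)
       \<in> normal_space M k N (\<gamma> 0)}"

definition focal_points ::
  "('a, 'e::euclidean_space) riem \<Rightarrow> nat \<Rightarrow> 'a topology \<Rightarrow> real set \<Rightarrow> (real \<Rightarrow> 'a) \<Rightarrow> real set" where
  "focal_points M k N I \<gamma> = {t \<in> I. t \<noteq> 0 \<and> (\<exists>J\<in>N_jacobi M k N I \<gamma>. J \<noteq> 0 \<and> J t = 0)}"

definition focal_multiplicity ::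
  "('a, 'e::euclidean_space) riem \<Rightarrow> nat \<Rightarrow> 'a topology \<Rightarrow> real set \<Rightarrow> (real \<Rightarrow> 'a) \<Rightarrow> real \<Rightarrow> nat" where
  "focal_multiplicity M k N I \<gamma> t = dim {J \<in> N_jacobi M k N I \<gamma>. J t = 0}"

end

theory Submission
  imports Defs
begin

text \<open>Let \<open>\<Lambda>\<close> be a space of Jacobi fields along \<open>\<gamma>\<close> on which the Wronskian vanishes; \<open>\<Lambda>\<^sup>N\<close> is one,
  because the shape operator is symmetric. Without conjugate points, the subspaces
  \<open>\<Lambda>(t) = {J \<in> \<Lambda>. J(t) = 0}\<close> for different \<open>t\<close> are linearly independent. Indeed, let
  \<open>J\<^sub>1 + \<dots> + J\<^sub>m = 0\<close> with \<open>J\<^sub>i \<in> \<Lambda>(t\<^sub>i)\<close> and \<open>t\<^sub>1 < \<dots> < t\<^sub>m\<close>. The broken field that equals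
  \<open>J\<^sub>1 + \<dots> + J\<^sub>i\<close> on \<open>[t\<^sub>i, t\<^sub>i\<^sub>+\<^sub>1]\<close> is continuous, vanishes at both ends and has index form 0, since
  the jumps of its derivative are orthogonal to it. The index form is positive definite, so
  \<open>J\<^sub>m = 0\<close>, and one proceeds by induction. Definiteness takes the following form: if \<open>Y\<close> is the
  matrix solution with \<open>Y(t\<^sub>1) = 0\<close>, which is invertible on \<open>(t\<^sub>1, t\<^sub>m]\<close>, and \<open>V = Y f\<close> is the broken
  field, then \<open>\<langle>V' - Y' f, V\<rangle>\<close> is continuous, nondecreasing, and zero at both ends.
  Applied to the focal points together with \<open>t = 0\<close>, this says that \<open>J \<mapsto> J(0)\<close> is injective on the
  sum of the \<open>\<Lambda>\<^sup>N(t)\<close> with \<open>t \<noteq> 0\<close>; its values lie in the tangent space of \<open>N\<close>, whence the bound. Only existence and smoothness of Jacobi fields with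
  given initial values are needed, and a parallel frame reduces these to linear systems of
  ordinary differential equations.\<close>

text \<open>At t_i the broken field jumps by J_i'(t_i), and its value there is a sum of fields of
  the isotropic family. The vanishing Wronskian turns the pairing of J_i'(t_i) with J(t_i) into that
  of J_i(t_i) = 0 with J'(t_i). Monotonicity comes from <V' - Y' f, V>' = |Y f'|^2: the mixed terms
  cancel because <Y' u, Y v> is symmetric in u and v, all columns of Y vanishing at t_1. On the last
  piece the function is therefore 0, whence f'(t_m) = 0; as f(t_m) = 0 too, V'(t_m) = 0, and J_m has
  zero value and zero derivative at t_m. Since Y degenerates at t_1, the function lives on a
  half-open interval; on the first piece it is 0 because the field there is Y applied to a constant
  vector. Fields are families of components in charts, differentiated within intervals. The frame
  moves them to one fixed inner product space, and smoothness of a linear map depending on a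
  parameter is expressed through its values on single vectors.\<close>

section \<open>Differential calculus on sets with unique derivatives\<close>

text \<open>Sets with unique derivatives: each point is approached inside the set along every
  coordinate axis, so difference quotients determine a derivative on the basis. Open sets and
  relatively open parts of nondegenerate intervals both qualify, which are the two kinds of sets on
  which \<open>Ck_on\<close> is used.\<close>

definition uds :: "'a::euclidean_space set \<Rightarrow> bool" where
  "uds S \<longleftrightarrow> (\<forall>x\<in>S. \<forall>i\<in>Basis. \<forall>e>0. \<exists>d. 0 < \<bar>d\<bar> \<and> \<bar>d\<bar> < e \<and> x + d *\<^sub>R i \<in> S)"

lemma uds_has_derivative_unique:
  assumes "uds S" "x \<in> S" "(f has_derivative D) (at x within S)" "(f has_derivative D') (at x within S)"
  shows "D = D'"
  using frechet_derivative_unique_within[of f D x S D'] assms unfolding uds_def by blast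

lemma uds_frechet:
  assumes "uds S" "x \<in> S" "(f has_derivative D) (at x within S)"
  shows "frechet_derivative f (at x within S) = D"
  by (rule uds_has_derivative_unique[OF assms(1,2) _ assms(3)])
    (use assms(3) differentiableI frechet_derivative_works in blast)

lemma open_uds:
  assumes "open (S :: 'a::euclidean_space set)"
  shows "uds S"
  unfolding uds_def
proof (intro ballI allI impI)
  fix x i :: 'a and e :: real
  assume x: "x \<in> S" and i: "i \<in> Basis" and e: "e > 0"
  obtain r where r: "r > 0" "ball x r \<subseteq> S" using assms x openE by blast
  define d where "d = min r e / 2"
  have "d > 0" "d < r" "d < e" using r e by (auto simp: d_def)
  then have "x + d *\<^sub>R i \<in> ball x r" using i by (simp add: dist_norm)
  then have "x + d *\<^sub>R i \<in> S" using r(2) by (rule rev_subsetD)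
  then show "\<exists>d. 0 < \<bar>d\<bar> \<and> \<bar>d\<bar> < e \<and> x + d *\<^sub>R i \<in> S"
    using \<open>d > 0\<close> \<open>d < e\<close> by (intro exI[of _ d]) simp
qed

text \<open>From a point to the left of \<open>q\<close> one can step towards \<open>q\<close>; from
  any other point one can step towards \<open>p\<close>. Either step stays in the interval, so end
  points cause no trouble.\<close>

lemma uds_real_interval:
  fixes I :: "real set"
  assumes I: "is_interval I" and p: "p \<in> I" "q \<in> I" "p < q"
    and S: "openin (top_of_set I) S"
  shows "uds S"
  unfolding uds_def
proof (intro ballI allI impI)
  fix x i e :: real
  assume x: "x \<in> S" and i: "i \<in> Basis" and e: "e > 0"
  have i1: "i = 1" using i by (simp add: Basis_real_def)
  have "S \<subseteq> I" and "\<exists>e>0. ball x e \<inter> I \<subseteq> S" using S x unfolding openin_contains_ball by simp_all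
  then obtain r where r: "r > 0" "ball x r \<inter> I \<subseteq> S" and xI: "x \<in> I" using x by auto
  define h where "h = min r e / 2"
  have h: "h > 0" "h < r" "h < e" using r e by (auto simp: h_def)
  have inI: "y \<in> I" if "u \<in> I" "v \<in> I" "u \<le> y" "y \<le> v" for u v y
    using I that unfolding is_interval_1 by blast
  show "\<exists>d. 0 < \<bar>d\<bar> \<and> \<bar>d\<bar> < e \<and> x + d *\<^sub>R i \<in> S"
  proof (cases "x < q")
    case True
    define d where "d = min h (q - x)"
    have d: "d > 0" "d \<le> h" "x + d \<le> q" using h True by (auto simp: d_def)
    have "x + d \<in> I" using inI[of x q "x+d"] xI p d by auto
    moreover have "x + d \<in> ball x r" using d h by (simp add: dist_real_def)
    ultimately have "x + d *\<^sub>R i \<in> S" using r(2) i1 by (simp add: subset_iff)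
    then show ?thesis using d h by (intro exI[of _ d]) simp
  next
    case False
    define d where "d = min h (x - p)"
    have d: "d > 0" "d \<le> h" "x - d \<ge> p" using h False p by (auto simp: d_def)
    have "x - d \<in> I" using inI[of p x "x-d"] xI p d by auto
    moreover have "x - d \<in> ball x r" using d h by (simp add: dist_real_def)
    ultimately have "x + (-d) *\<^sub>R i \<in> S" using r(2) i1 by (simp add: subset_iff)
    then show ?thesis using d h by (intro exI[of _ "-d"]) simp
  qed
qed

lemma uds_trivial_limit:
  fixes S :: "real set"
  assumes "uds S" "x \<in> S"
  shows "at x within S \<noteq> bot"
proof -
  have "x islimpt S" unfolding islimpt_approachable
  proof (intro allI impI)
    fix e :: real assume "e > 0"
    then obtain d where "0 < \<bar>d\<bar> \<and> \<bar>d\<bar> < e \<and> x + d *\<^sub>R 1 \<in> S"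
      using assms(1)[unfolded uds_def, rule_format, OF assms(2), of 1 e] by (auto simp: Basis_real_def)
    then show "\<exists>x'\<in>S. x' \<noteq> x \<and> dist x' x < e" by (intro bexI[of _ "x+d"]) (simp_all add: dist_real_def)
  qed
  then show ?thesis by (simp add: trivial_limit_within)
qed

lemma uds_vector_derivative:
  fixes S :: "real set"
  assumes "uds S" "x \<in> S" "(f has_vector_derivative D) (at x within S)"
  shows "vector_derivative f (at x within S) = D"
  using assms uds_trivial_limit vector_derivative_within by blast

subsection \<open>Functions of class \<open>C\<^sup>k\<close>\<close>

text \<open>Replaces \<open>frechet_derivative\<close> by any known derivative \<open>D\<close>, so
  that the closure properties below follow from the differentiation rules by induction on the
  order.\<close>

lemma Ck_on_Suc_iff:
  assumes "uds S"
  shows "Ck_on (Suc k) S f \<longleftrightarrow>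
    (\<exists>D. (\<forall>x\<in>S. (f has_derivative D x) (at x within S)) \<and> (\<forall>v. Ck_on k S (\<lambda>x. D x v)))"
  (is "?L \<longleftrightarrow> ?R")
proof
  assume ?L
  then show ?R
    by (intro exI[of _ "\<lambda>x. frechet_derivative f (at x within S)"])
      (simp add: differentiable_on_def frechet_derivative_works)
next
  \<comment> \<open>\<open>D\<close> and \<open>frechet_derivative f\<close> agree only on
    \<open>S\<close>, so a congruence is required already here; \<open>Ck_on_cong\<close> below
    rests on this lemma.\<close>
  have cong: "Ck_on k S f \<longleftrightarrow> Ck_on k S g" if "\<And>x. x \<in> S \<Longrightarrow> f x = g x" for k and f g :: "'a \<Rightarrow> 'c::real_normed_vector"
    using that
  proof (induction k arbitrary: f g)
    case 0
    then show ?case by (simp cong: continuous_on_cong)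
  next
    case (Suc k)
    have hd: "(f has_derivative D) (at x within S) \<longleftrightarrow> (g has_derivative D) (at x within S)" if "x \<in> S" for x D
      using Suc.prems that by (metis has_derivative_transform)
    have "frechet_derivative f (at x within S) = frechet_derivative g (at x within S)" if "x \<in> S" for x
      using hd that unfolding frechet_derivative_def by simp
    moreover have "f differentiable_on S \<longleftrightarrow> g differentiable_on S"
      unfolding differentiable_on_def differentiable_def using hd by blast
    ultimately show ?case using Suc.IH[of "\<lambda>x. frechet_derivative f (at x within S) v"
        "\<lambda>x. frechet_derivative g (at x within S) v" for v] by simp
  qed
  assume ?R
  then obtain D where D: "\<And>x. x \<in> S \<Longrightarrow> (f has_derivative D x) (at x within S)"
    "\<And>v. Ck_on k S (\<lambda>x. D x v)" by blast
  have "frechet_derivative f (at x within S) = D x" if "x \<in> S" for x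
    using uds_frechet[OF assms that] D that by blast
  then have "Ck_on k S (\<lambda>x. frechet_derivative f (at x within S) v)" for v
    using D(2)[of v] cong[of "\<lambda>x. frechet_derivative f (at x within S) v" "\<lambda>x. D x v" k] by simp
  moreover have "f differentiable_on S" unfolding differentiable_on_def differentiable_def
    using D by blast
  ultimately show ?L by simp
qed

lemma Ck_on_cong:
  assumes "uds S" "\<And>x. x \<in> S \<Longrightarrow> f x = g x" "Ck_on k S f"
  shows "Ck_on k S g"
  using assms(2,3)
proof (induction k arbitrary: f g)
  case 0
  then show ?case by (simp cong: continuous_on_cong)
next
  case (Suc k)
  then obtain D where D: "\<And>x. x \<in> S \<Longrightarrow> (f has_derivative D x) (at x within S)"
    "\<And>v. Ck_on k S (\<lambda>x. D x v)" unfolding Ck_on_Suc_iff[OF assms(1)] by blast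
  have "(g has_derivative D x) (at x within S)" if "x \<in> S" for x
    using D(1)[OF that] Suc.prems that by (metis has_derivative_transform)
  then show ?case unfolding Ck_on_Suc_iff[OF assms(1)] using D(2) by blast
qed

lemma Ck_on_SucD:
  assumes "uds S" "Ck_on (Suc k) S f"
  shows "Ck_on k S f"
  using assms(2)
proof (induction k arbitrary: f)
  case 0
  then show ?case by (simp add: differentiable_imp_continuous_on)
next
  case (Suc k)
  from Suc.prems obtain D where D: "\<And>x. x \<in> S \<Longrightarrow> (f has_derivative D x) (at x within S)"
    "\<And>v. Ck_on (Suc k) S (\<lambda>x. D x v)" unfolding Ck_on_Suc_iff[OF assms(1), of "Suc k"] by blast
  have "Ck_on k S (\<lambda>x. D x v)" for v using D(2) by (rule Suc.IH)
  with D(1) show ?case unfolding Ck_on_Suc_iff[OF assms(1)] by blast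
qed

lemma Ck_on_const: "uds S \<Longrightarrow> Ck_on k S (\<lambda>x. c)"
proof (induction k arbitrary: c)
  case (Suc k)
  then show ?case unfolding Ck_on_Suc_iff[OF Suc.prems]
    by (intro exI[of _ "\<lambda>x v. 0"]) auto
qed simp

lemma Ck_on_bounded_linear:
  assumes "bounded_linear h" "uds S" "Ck_on k S f"
  shows "Ck_on k S (\<lambda>x. h (f x))"
  using assms(3)
proof (induction k arbitrary: f)
  case 0
  then show ?case using bounded_linear.continuous_on[OF assms(1)] by simp
next
  case (Suc k)
  from Suc.prems obtain D where D: "\<And>x. x \<in> S \<Longrightarrow> (f has_derivative D x) (at x within S)"
    "\<And>v. Ck_on k S (\<lambda>x. D x v)" unfolding Ck_on_Suc_iff[OF assms(2)] by blast
  then show ?case unfolding Ck_on_Suc_iff[OF assms(2)]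
    using bounded_linear.has_derivative[OF assms(1)] Suc.IH
    by (intro exI[of _ "\<lambda>x v. h (D x v)"]) blast
qed

lemma Ck_on_add:
  assumes "uds S" "Ck_on k S f" "Ck_on k S g"
  shows "Ck_on k S (\<lambda>x. f x + g x)"
  using assms(2,3)
proof (induction k arbitrary: f g)
  case 0
  then show ?case by (simp add: continuous_on_add)
next
  case (Suc k)
  from Suc.prems obtain D E where D: "\<And>x. x \<in> S \<Longrightarrow> (f has_derivative D x) (at x within S)"
    "\<And>v. Ck_on k S (\<lambda>x. D x v)" "\<And>x. x \<in> S \<Longrightarrow> (g has_derivative E x) (at x within S)"
    "\<And>v. Ck_on k S (\<lambda>x. E x v)" unfolding Ck_on_Suc_iff[OF assms(1)] by blast
  then show ?case unfolding Ck_on_Suc_iff[OF assms(1)]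
    using Suc.IH has_derivative_add by (intro exI[of _ "\<lambda>x v. D x v + E x v"]) blast
qed

lemma Ck_on_sum:
  assumes "uds S" "\<And>i. i \<in> A \<Longrightarrow> Ck_on k S (f i)"
  shows "Ck_on k S (\<lambda>x. \<Sum>i\<in>A. f i x)"
  using assms(2)
  by (induction A rule: infinite_finite_induct) (auto intro: Ck_on_const Ck_on_add assms(1))

lemma Ck_on_bilinear:
  assumes "bounded_bilinear h" "uds S" "Ck_on k S f" "Ck_on k S g"
  shows "Ck_on k S (\<lambda>x. h (f x) (g x))"
  using assms(3,4)
proof (induction k arbitrary: f g)
  case 0
  then show ?case using bounded_bilinear.continuous_on[OF assms(1)] by simp
next
  case (Suc k)
  from Suc.prems obtain D E where D: "\<And>x. x \<in> S \<Longrightarrow> (f has_derivative D x) (at x within S)"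
    "\<And>v. Ck_on k S (\<lambda>x. D x v)" "\<And>x. x \<in> S \<Longrightarrow> (g has_derivative E x) (at x within S)"
    "\<And>v. Ck_on k S (\<lambda>x. E x v)" unfolding Ck_on_Suc_iff[OF assms(2)] by blast
  have fg: "Ck_on k S f" "Ck_on k S g" using Suc.prems Ck_on_SucD assms by blast+
  show ?case unfolding Ck_on_Suc_iff[OF assms(2)]
  proof (intro exI[of _ "\<lambda>x v. h (f x) (E x v) + h (D x v) (g x)"] conjI ballI allI)
    show "((\<lambda>x. h (f x) (g x)) has_derivative (\<lambda>v. h (f x) (E x v) + h (D x v) (g x))) (at x within S)"
      if "x \<in> S" for x using bounded_bilinear.FDERIV[OF assms(1) D(1)[OF that] D(3)[OF that]] .
    show "Ck_on k S (\<lambda>x. h (f x) (E x v) + h (D x v) (g x))" for v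
      by (intro Ck_on_add assms(2) Suc.IH fg D)
  qed
qed

lemma Ck_on_subset:
  assumes "uds S" "uds T" "T \<subseteq> S" "Ck_on k S f"
  shows "Ck_on k T f"
  using assms(4)
proof (induction k arbitrary: f)
  case 0
  then show ?case using assms(3) by (auto intro: continuous_on_subset)
next
  case (Suc k)
  then obtain D where D: "\<And>x. x \<in> S \<Longrightarrow> (f has_derivative D x) (at x within S)"
    "\<And>v. Ck_on k S (\<lambda>x. D x v)" unfolding Ck_on_Suc_iff[OF assms(1)] by blast
  then show ?case unfolding Ck_on_Suc_iff[OF assms(2)] using Suc.IH assms(3)
    by (intro exI[of _ D]) (meson has_derivative_subset subsetD)
qed

lemma linear_sum_Basis:
  assumes "linear (h :: 'a::euclidean_space \<Rightarrow> 'b::real_vector)"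
  shows "h v = (\<Sum>i\<in>Basis. (v \<bullet> i) *\<^sub>R h i)"
  by (metis (no_types, lifting) assms euclidean_representation linear_scale linear_sum sum.cong)

lemma Ck_on_compose:
  fixes f :: "'a::euclidean_space \<Rightarrow> 'b::euclidean_space"
  assumes S: "uds S" and U: "uds U" and fU: "f ` S \<subseteq> U" and f: "Ck_on k S f" and g: "Ck_on k U g"
  shows "Ck_on k S (\<lambda>x. g (f x))"
  using f g
proof (induction k arbitrary: g)
  case 0
  then show ?case using fU continuous_on_compose2 by (metis Ck_on.simps(1))
next
  case (Suc k)
  from Suc.prems obtain D E where D: "\<And>x. x \<in> S \<Longrightarrow> (f has_derivative D x) (at x within S)"
    "\<And>v. Ck_on k S (\<lambda>x. D x v)" and E: "\<And>x. x \<in> U \<Longrightarrow> (g has_derivative E x) (at x within U)"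
    "\<And>v. Ck_on k U (\<lambda>x. E x v)" unfolding Ck_on_Suc_iff[OF S] Ck_on_Suc_iff[OF U] by blast
  have fk: "Ck_on k S f" using Suc.prems Ck_on_SucD S by blast
  show ?case unfolding Ck_on_Suc_iff[OF S]
  proof (intro exI[of _ "\<lambda>x v. E (f x) (D x v)"] conjI ballI allI)
    show "((\<lambda>x. g (f x)) has_derivative (\<lambda>v. E (f x) (D x v))) (at x within S)" if "x \<in> S" for x
      using has_derivative_in_compose2[of U g E f S x "D x"] E(1) fU that D(1) by blast
    \<comment> \<open>In \<open>E (f x) (D x v)\<close> both arguments vary with \<open>x\<close>.
      Expansion in the basis leaves scalar factors and the functions \<open>E (f x) i\<close>, to
      which the induction hypothesis applies.\<close>
    have sumE: "E (f x) (D x v) = (\<Sum>i\<in>Basis. (D x v \<bullet> i) *\<^sub>R E (f x) i)" if "x \<in> S" for x v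
      using E(1)[of "f x"] that fU by (intro linear_sum_Basis has_derivative_linear) auto
    have CkE: "Ck_on k S (\<lambda>x. \<Sum>i\<in>Basis. (D x v \<bullet> i) *\<^sub>R E (f x) i)" for v
      using Suc.IH[OF fk E(2)]
      by (intro Ck_on_sum[OF S] Ck_on_bilinear[OF bounded_bilinear_scaleR S]
          Ck_on_bounded_linear[OF bounded_linear_inner_left S] D)
    show "Ck_on k S (\<lambda>x. E (f x) (D x v))" for v
      by (rule Ck_on_cong[OF S _ CkE]) (rule sumE[symmetric])
  qed
qed

lemma smooth_on_iff:
  assumes "uds S"
  shows "smooth_on S f \<longleftrightarrow>
    (\<exists>D. (\<forall>x\<in>S. (f has_derivative D x) (at x within S)) \<and> (\<forall>v. smooth_on S (\<lambda>x. D x v)))"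
  (is "?L \<longleftrightarrow> ?R")
proof
  assume L: ?L
  define D where "D = (\<lambda>x. frechet_derivative f (at x within S))"
  have C: "Ck_on (Suc k) S f" for k using L smooth_on_def by blast
  then show ?R using C[of 0]
    by (intro exI[of _ D]) (auto simp: smooth_on_def differentiable_on_def frechet_derivative_works D_def)
next
  assume ?R
  then obtain D where "\<forall>x\<in>S. (f has_derivative D x) (at x within S)" "\<forall>v. smooth_on S (\<lambda>x. D x v)" by blast
  then have "Ck_on (Suc k) S f" for k unfolding Ck_on_Suc_iff[OF assms] smooth_on_def by blast
  then show ?L unfolding smooth_on_def using Ck_on_SucD[OF assms] by blast
qed

lemma smooth_on_cong: "uds S \<Longrightarrow> (\<And>x. x \<in> S \<Longrightarrow> f x = g x) \<Longrightarrow> smooth_on S f \<Longrightarrow> smooth_on S g"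
  using Ck_on_cong unfolding smooth_on_def by metis
lemma smooth_on_continuous: "smooth_on S f \<Longrightarrow> continuous_on S f"
  unfolding smooth_on_def by (metis Ck_on.simps(1))
lemma smooth_on_const: "uds S \<Longrightarrow> smooth_on S (\<lambda>x. c)"
  unfolding smooth_on_def by (simp add: Ck_on_const)
lemma smooth_on_bounded_linear: "bounded_linear h \<Longrightarrow> uds S \<Longrightarrow> smooth_on S f \<Longrightarrow> smooth_on S (\<lambda>x. h (f x))"
  unfolding smooth_on_def by (simp add: Ck_on_bounded_linear)
lemma smooth_on_add: "uds S \<Longrightarrow> smooth_on S f \<Longrightarrow> smooth_on S g \<Longrightarrow> smooth_on S (\<lambda>x. f x + g x)"
  unfolding smooth_on_def by (simp add: Ck_on_add)
lemma smooth_on_minus: "uds S \<Longrightarrow> smooth_on S f \<Longrightarrow> smooth_on S (\<lambda>x. - f x)"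
  by (rule smooth_on_bounded_linear[OF bounded_linear_minus[OF bounded_linear_ident]])
lemma smooth_on_diff: "uds S \<Longrightarrow> smooth_on S f \<Longrightarrow> smooth_on S g \<Longrightarrow> smooth_on S (\<lambda>x. f x - g x)"
  using smooth_on_add[OF _ _ smooth_on_minus] by force
lemma smooth_on_sum: "uds S \<Longrightarrow> (\<And>i. i \<in> A \<Longrightarrow> smooth_on S (f i)) \<Longrightarrow> smooth_on S (\<lambda>x. \<Sum>i\<in>A. f i x)"
  unfolding smooth_on_def by (simp add: Ck_on_sum)
lemma smooth_on_bilinear:
  "bounded_bilinear h \<Longrightarrow> uds S \<Longrightarrow> smooth_on S f \<Longrightarrow> smooth_on S g \<Longrightarrow> smooth_on S (\<lambda>x. h (f x) (g x))"
  unfolding smooth_on_def by (simp add: Ck_on_bilinear)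
lemma smooth_on_subset: "uds S \<Longrightarrow> uds T \<Longrightarrow> T \<subseteq> S \<Longrightarrow> smooth_on S f \<Longrightarrow> smooth_on T f"
  unfolding smooth_on_def by (intro allI, rule Ck_on_subset[of S T]) simp_all
lemma smooth_on_compose:
  fixes f :: "'a::euclidean_space \<Rightarrow> 'b::euclidean_space"
  shows "uds S \<Longrightarrow> uds U \<Longrightarrow> f ` S \<subseteq> U \<Longrightarrow> smooth_on S f \<Longrightarrow> smooth_on U g \<Longrightarrow> smooth_on S (\<lambda>x. g (f x))"
  unfolding smooth_on_def by (intro allI, rule Ck_on_compose[of S U]) simp_all

section \<open>Derivatives of smooth functions on open sets and on the line\<close>

lemma smooth_on_open_has_derivative:
  fixes U :: "'a::euclidean_space set"
  assumes "open U" "smooth_on U f" "x \<in> U"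
  shows "(f has_derivative frechet_derivative f (at x)) (at x)"
proof -
  obtain D where "\<forall>x\<in>U. (f has_derivative D x) (at x within U)"
    using smooth_on_iff[OF open_uds[OF assms(1)], THEN iffD1, OF assms(2)] by blast
  then have "(f has_derivative D x) (at x)" using assms at_within_open[of x U] by fastforce
  then show ?thesis using frechet_derivative_at by metis
qed

lemma smooth_on_open_derivative:
  fixes U :: "'a::euclidean_space set"
  assumes "open U" "smooth_on U f"
  shows "smooth_on U (\<lambda>x. frechet_derivative f (at x) v)"
proof -
  obtain D where D: "\<forall>x\<in>U. (f has_derivative D x) (at x within U)" "\<forall>v. smooth_on U (\<lambda>x. D x v)"
    using smooth_on_iff[OF open_uds[OF assms(1)], THEN iffD1, OF assms(2)] by blast
  have "frechet_derivative f (at x) = D x" if "x \<in> U" for x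
    using assms(1) that D(1) at_within_open[of x U] frechet_derivative_at[of f "D x" x] by fastforce
  then have "D x v = frechet_derivative f (at x) v" if "x \<in> U" for x using that by simp
  then show ?thesis
    using smooth_on_cong[OF open_uds[OF assms(1)], of "\<lambda>x. D x v" "\<lambda>x. frechet_derivative f (at x) v"]
      D(2) by blast
qed

lemma smooth_on_real_has_vector_derivative:
  fixes S :: "real set"
  assumes "uds S" "smooth_on S f" "t \<in> S"
  shows "(f has_vector_derivative vector_derivative f (at t within S)) (at t within S)"
proof -
  have "Ck_on (Suc 0) S f" using assms(2) unfolding smooth_on_def by blast
  then have "f differentiable (at t within S)"
    using assms(3) by (auto simp: differentiable_on_def)
  then show ?thesis by (simp add: vector_derivative_works)
qed

lemma smooth_on_real_iff:
  fixes S :: "real set"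
  assumes "uds S" and d: "\<And>t. t \<in> S \<Longrightarrow> (f has_vector_derivative D t) (at t within S)"
  shows "smooth_on S f \<longleftrightarrow> smooth_on S D"
proof
  assume "smooth_on S f"
  then obtain E where E: "\<And>x. x \<in> S \<Longrightarrow> (f has_derivative E x) (at x within S)"
      "\<And>v. smooth_on S (\<lambda>x. E x v)"
    using smooth_on_iff[OF assms(1), THEN iffD1] by blast
  have "E t 1 = D t" if "t \<in> S" for t
    using uds_has_derivative_unique[OF assms(1) that E(1)[OF that] d[OF that, unfolded has_vector_derivative_def]]
    by simp
  then show "smooth_on S D" using smooth_on_cong[OF assms(1) _ E(2)[of 1]] by blast
next
  assume D: "smooth_on S D"
  show "smooth_on S f"
  proof (rule smooth_on_iff[OF assms(1), THEN iffD2], intro exI[of _ "\<lambda>t v. v *\<^sub>R D t"] conjI ballI allI)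
    show "(f has_derivative (\<lambda>v. v *\<^sub>R D t)) (at t within S)" if "t \<in> S" for t
      using d[OF that] unfolding has_vector_derivative_def .
    show "smooth_on S (\<lambda>x. v *\<^sub>R D x)" for v
      using smooth_on_bounded_linear[OF bounded_linear_scaleR_right assms(1) D] .
  qed
qed

text \<open>Product rule for a map linear in its second argument, knowing only the derivative of
  \<open>B y u\<close> for each fixed \<open>u\<close>. The trick is to write
  \<open>B y (V y)\<close> as \<open>B y (V x)\<close> plus a finite sum whose scalar coefficients
  vanish at \<open>x\<close>; no operator norm or joint differentiability enters.\<close>

lemma has_derivative_param_linear:
  fixes B :: "'x::real_normed_vector \<Rightarrow> 'e::euclidean_space \<Rightarrow> 'f::real_normed_vector"
  assumes x: "x \<in> S" and lin: "\<And>y. y \<in> S \<Longrightarrow> linear (B y)"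
    and B: "\<And>u. ((\<lambda>y. B y u) has_derivative (\<lambda>h. B' h u)) (at x within S)"
    and V: "(V has_derivative V') (at x within S)"
  shows "((\<lambda>y. B y (V y)) has_derivative (\<lambda>h. B' h (V x) + B x (V' h))) (at x within S)"
proof -
  have eq: "B y (V x) + (\<Sum>i\<in>Basis. ((V y - V x) \<bullet> i) *\<^sub>R B y i) = B y (V y)" if "y \<in> S" for y
    using linear_sum_Basis[OF lin[OF that], of "V y - V x"] linear_diff[OF lin[OF that], of "V y" "V x"]
    by (simp add: algebra_simps)
  have "((\<lambda>y. B y (V x) + (\<Sum>i\<in>Basis. ((V y - V x) \<bullet> i) *\<^sub>R B y i)) has_derivative
     (\<lambda>h. B' h (V x) + (\<Sum>i\<in>Basis. ((V x - V x) \<bullet> i) *\<^sub>R B' h i + (V' h \<bullet> i) *\<^sub>R B x i))) (at x within S)"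
    by (intro has_derivative_add B has_derivative_sum has_derivative_scaleR has_derivative_inner_left)
      (rule derivative_eq_intros V | simp)+
  then have "((\<lambda>y. B y (V x) + (\<Sum>i\<in>Basis. ((V y - V x) \<bullet> i) *\<^sub>R B y i)) has_derivative
     (\<lambda>h. B' h (V x) + B x (V' h))) (at x within S)"
    using linear_sum_Basis[OF lin[OF x], symmetric] by simp
  then show ?thesis using eq x by (metis (no_types, lifting) has_derivative_transform)
qed

lemma has_vector_derivative_param_linear:
  fixes B :: "real \<Rightarrow> 'e::euclidean_space \<Rightarrow> 'f::real_normed_vector"
  assumes x: "t \<in> S" and lin: "\<And>s. s \<in> S \<Longrightarrow> linear (B s)"
    and B: "\<And>u. ((\<lambda>s. B s u) has_vector_derivative B' u) (at t within S)"
    and V: "(V has_vector_derivative V') (at t within S)"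
  shows "((\<lambda>s. B s (V s)) has_vector_derivative (B' (V t) + B t V')) (at t within S)"
  using has_derivative_param_linear[OF x, where B = B, OF lin, where B' = "\<lambda>h u. h *\<^sub>R B' u" and V = V and V' = "\<lambda>h. h *\<^sub>R V'"] B V
  by (simp add: has_vector_derivative_def scaleR_add_right linear_scale[OF lin[OF x]])

lemma smooth_on_param_linear:
  fixes B :: "'x::euclidean_space \<Rightarrow> 'e::euclidean_space \<Rightarrow> 'f::real_normed_vector"
  assumes S: "uds S" and lin: "\<And>y. y \<in> S \<Longrightarrow> linear (B y)"
    and B: "\<And>u. smooth_on S (\<lambda>y. B y u)" and V: "smooth_on S V"
  shows "smooth_on S (\<lambda>y. B y (V y))"
proof (rule smooth_on_cong[OF S])
  show "smooth_on S (\<lambda>y. \<Sum>i\<in>Basis. (V y \<bullet> i) *\<^sub>R B y i)"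
    by (intro smooth_on_sum S smooth_on_bilinear[OF bounded_bilinear_scaleR] B V
        smooth_on_bounded_linear[OF bounded_linear_inner_left])
  show "(\<Sum>i\<in>Basis. (V y \<bullet> i) *\<^sub>R B y i) = B y (V y)" if "y \<in> S" for y
    by (rule linear_sum_Basis[OF lin[OF that], symmetric])
qed

lemma Ck_on_param_linear:
  fixes B :: "'x::euclidean_space \<Rightarrow> 'e::euclidean_space \<Rightarrow> 'f::real_normed_vector"
  assumes S: "uds S" and lin: "\<And>y. y \<in> S \<Longrightarrow> linear (B y)"
    and B: "\<And>u. Ck_on k S (\<lambda>y. B y u)" and V: "Ck_on k S V"
  shows "Ck_on k S (\<lambda>y. B y (V y))"
proof (rule Ck_on_cong[OF S])
  show "Ck_on k S (\<lambda>y. \<Sum>i\<in>Basis. (V y \<bullet> i) *\<^sub>R B y i)"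
    by (intro Ck_on_sum S Ck_on_bilinear[OF bounded_bilinear_scaleR] B V
        Ck_on_bounded_linear[OF bounded_linear_inner_left])
  show "(\<Sum>i\<in>Basis. (V y \<bullet> i) *\<^sub>R B y i) = B y (V y)" if "y \<in> S" for y
    by (rule linear_sum_Basis[OF lin[OF that], symmetric])
qed

subsection \<open>Symmetry of second derivatives\<close>

text \<open>The offset \<open>c\<close> lets the same lemma treat two parallel sides of a
  parallelogram.\<close>

lemma line_derivative:
  fixes f :: "'a::euclidean_space \<Rightarrow> 'b::real_normed_vector"
  assumes "open U" "smooth_on U f" "x + s *\<^sub>R u + c \<in> U"
  shows "((\<lambda>s. f (x + s *\<^sub>R u + c)) has_vector_derivative
    frechet_derivative f (at (x + s *\<^sub>R u + c)) u) (at s within T)"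
proof -
  let ?D = "frechet_derivative f (at (x + s *\<^sub>R u + c))"
  have D: "(f has_derivative ?D) (at (x + s *\<^sub>R u + c))"
    using smooth_on_open_has_derivative assms by blast
  have "((\<lambda>s. x + s *\<^sub>R u + c) has_derivative (\<lambda>h. h *\<^sub>R u)) (at s within T)"
    by (auto intro!: derivative_eq_intros)
  from has_derivative_compose[OF this D] show ?thesis
    using linear_scale[OF has_derivative_linear[OF D]] by (simp add: has_vector_derivative_def)
qed

text \<open>Two applications of the mean value theorem: first along \<open>u\<close> to the
  difference \<open>p\<close> of the two sides parallel to \<open>u\<close>, then along
  \<open>v\<close> to the derivative found.\<close>

lemma second_difference:
  fixes f :: "'a::euclidean_space \<Rightarrow> real"
  assumes U: "open U" and f: "smooth_on U f" and h: "h > 0"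
    and sq: "\<And>s t. 0 \<le> s \<Longrightarrow> s \<le> h \<Longrightarrow> 0 \<le> t \<Longrightarrow> t \<le> h \<Longrightarrow> x + s *\<^sub>R u + t *\<^sub>R v \<in> U"
  shows "\<exists>\<xi> \<eta>. 0 < \<xi> \<and> \<xi> < h \<and> 0 < \<eta> \<and> \<eta> < h \<and>
    f (x + h *\<^sub>R u + h *\<^sub>R v) - f (x + h *\<^sub>R u) - f (x + h *\<^sub>R v) + f x =
    h * (h * frechet_derivative (\<lambda>y. frechet_derivative f (at y) u) (at (x + \<xi> *\<^sub>R u + \<eta> *\<^sub>R v)) v)"
proof -
  let ?f1 = "\<lambda>y. frechet_derivative f (at y) u"
  define p where "p s = f (x + s *\<^sub>R u + h *\<^sub>R v) - f (x + s *\<^sub>R u + 0 *\<^sub>R v)" for s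
  have p: "DERIV p s :> ?f1 (x + s *\<^sub>R u + h *\<^sub>R v) - ?f1 (x + s *\<^sub>R u + 0 *\<^sub>R v)" if "0 \<le> s" "s \<le> h" for s
    using line_derivative[OF U f, of x s u "h *\<^sub>R v" UNIV] line_derivative[OF U f, of x s u "0 *\<^sub>R v" UNIV]
      sq[of s h] sq[of s 0] that h
    unfolding p_def[abs_def] has_real_derivative_iff_has_vector_derivative
    by (intro has_vector_derivative_diff) auto
  obtain \<xi> where \<xi>: "0 < \<xi>" "\<xi> < h" "p h - p 0 = (h - 0) * (?f1 (x + \<xi> *\<^sub>R u + h *\<^sub>R v) - ?f1 (x + \<xi> *\<^sub>R u + 0 *\<^sub>R v))"
    using MVT2[OF h p] by blast
  define q where "q t = ?f1 ((x + \<xi> *\<^sub>R u) + t *\<^sub>R v + 0)" for t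
  have q: "DERIV q t :> frechet_derivative ?f1 (at (x + \<xi> *\<^sub>R u + t *\<^sub>R v)) v" if "0 \<le> t" "t \<le> h" for t
    using line_derivative[OF U smooth_on_open_derivative[OF U f, of u], of "x + \<xi> *\<^sub>R u" t v 0 UNIV] sq[of \<xi> t] \<xi> that
    unfolding q_def[abs_def] has_real_derivative_iff_has_vector_derivative by simp
  obtain \<eta> where \<eta>: "0 < \<eta>" "\<eta> < h" "q h - q 0 = (h - 0) * frechet_derivative ?f1 (at (x + \<xi> *\<^sub>R u + \<eta> *\<^sub>R v)) v"
    using MVT2[OF h q] by blast
  have "f (x + h *\<^sub>R u + h *\<^sub>R v) - f (x + h *\<^sub>R u) - f (x + h *\<^sub>R v) + f x = p h - p 0" by (simp add: p_def)
  also have "\<dots> = h * (q h - q 0)" using \<xi>(3) by (simp add: q_def)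
  also have "\<dots> = h * (h * frechet_derivative ?f1 (at (x + \<xi> *\<^sub>R u + \<eta> *\<^sub>R v)) v)" using \<eta>(3) by simp
  finally show ?thesis using \<xi> \<eta> by blast
qed

text \<open>The second difference is unchanged when \<open>u\<close> and \<open>v\<close> are
  exchanged. Hence the two iterated derivatives take equal values at two points close to
  \<open>x\<close>, and continuity makes them equal at \<open>x\<close>.\<close>

lemma frechet_derivative_symmetric_real:
  fixes f :: "'a::euclidean_space \<Rightarrow> real"
  assumes U: "open U" and f: "smooth_on U f" and x: "x \<in> U"
  shows "frechet_derivative (\<lambda>y. frechet_derivative f (at y) u) (at x) v =
         frechet_derivative (\<lambda>y. frechet_derivative f (at y) v) (at x) u"
proof -
  define F where "F y = frechet_derivative (\<lambda>y. frechet_derivative f (at y) u) (at y) v" for y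
  define G where "G y = frechet_derivative (\<lambda>y. frechet_derivative f (at y) v) (at y) u" for y
  have cont: "continuous (at x) F" "continuous (at x) G"
    using smooth_on_continuous[OF smooth_on_open_derivative[OF U smooth_on_open_derivative[OF U f]]]
      U x continuous_on_eq_continuous_at unfolding F_def[abs_def] G_def[abs_def] by blast+
  obtain r where r: "r > 0" "ball x r \<subseteq> U" using U x openE by blast
  have "\<bar>F x - G x\<bar> < e" if e: "e > 0" for e
  proof -
    obtain d1 where d1: "d1 > 0" "\<And>y. dist y x < d1 \<Longrightarrow> dist (F y) (F x) < e/2"
      using cont(1) e unfolding continuous_at_eps_delta by (meson half_gt_zero)
    obtain d2 where d2: "d2 > 0" "\<And>y. dist y x < d2 \<Longrightarrow> dist (G y) (G x) < e/2"
      using cont(2) e unfolding continuous_at_eps_delta by (meson half_gt_zero)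
    define d where "d = min r (min d1 d2)"
    have d: "d > 0" using r d1 d2 by (simp add: d_def)
    \<comment> \<open>This size keeps the whole parallelogram within distance \<open>d\<close> of
      \<open>x\<close>; the summand 1 avoids division by zero when \<open>u\<close> and
      \<open>v\<close> vanish.\<close>
    define h where "h = d / (2 * (1 + norm u + norm v))"
    have n0: "1 + norm u + norm v > 0" by (smt (verit) norm_ge_zero)
    have h: "h > 0" using d n0 by (simp add: h_def)
    have hd: "h * (norm u + norm v) < d"
    proof -
      have "h * (norm u + norm v) \<le> h * (1 + norm u + norm v)" using h by (intro mult_left_mono) auto
      also have "\<dots> = d / 2" using n0 unfolding h_def
        by (metis less_irrefl mult.commute nonzero_mult_divide_mult_cancel_right2 times_divide_eq_left)
      finally show ?thesis using d by simp
    qed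
    have close: "dist (x + s *\<^sub>R u + t *\<^sub>R v) x < d" if "0 \<le> s" "s \<le> h" "0 \<le> t" "t \<le> h" for s t
    proof -
      have "dist (x + s *\<^sub>R u + t *\<^sub>R v) x = norm (s *\<^sub>R u + t *\<^sub>R v)" by (simp add: dist_norm)
      also have "\<dots> \<le> s * norm u + t * norm v" using that norm_triangle_ineq[of "s *\<^sub>R u" "t *\<^sub>R v"] by simp
      also have "\<dots> \<le> h * norm u + h * norm v" using that by (intro add_mono mult_right_mono) auto
      finally show ?thesis using hd by (simp add: distrib_left)
    qed
    have inU: "x + s *\<^sub>R u + t *\<^sub>R v \<in> U" if "0 \<le> s" "s \<le> h" "0 \<le> t" "t \<le> h" for s t
      using close[OF that] r(2) d_def by (simp add: dist_commute subset_iff)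
    obtain a b where ab: "0 < a" "a < h" "0 < b" "b < h"
      "f (x + h *\<^sub>R u + h *\<^sub>R v) - f (x + h *\<^sub>R u) - f (x + h *\<^sub>R v) + f x = h * (h * F (x + a *\<^sub>R u + b *\<^sub>R v))"
      using second_difference[OF U f h inU] unfolding F_def by blast
    have inU': "x + t *\<^sub>R v + s *\<^sub>R u \<in> U" if "0 \<le> t" "t \<le> h" "0 \<le> s" "s \<le> h" for s t
      using inU[OF that(3,4,1,2)] by (simp add: add.commute add.left_commute)
    obtain a' b' where ab': "0 < a'" "a' < h" "0 < b'" "b' < h"
      "f (x + h *\<^sub>R v + h *\<^sub>R u) - f (x + h *\<^sub>R v) - f (x + h *\<^sub>R u) + f x = h * (h * G (x + a' *\<^sub>R v + b' *\<^sub>R u))"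
      using second_difference[OF U f h inU'] unfolding G_def by blast
    have "h * (h * F (x + a *\<^sub>R u + b *\<^sub>R v)) = h * (h * G (x + b' *\<^sub>R u + a' *\<^sub>R v))"
      using ab(5) ab'(5) by (simp add: add.commute add.left_commute algebra_simps)
    then have "F (x + a *\<^sub>R u + b *\<^sub>R v) = G (x + b' *\<^sub>R u + a' *\<^sub>R v)" using h by simp
    moreover have "dist (F (x + a *\<^sub>R u + b *\<^sub>R v)) (F x) < e/2"
      using close[of a b] ab d_def by (intro d1) simp
    moreover have "dist (G (x + b' *\<^sub>R u + a' *\<^sub>R v)) (G x) < e/2"
      using close[of b' a'] ab' d_def by (intro d2) simp
    ultimately show ?thesis unfolding dist_real_def by arith
  qed
  then have "F x = G x" by (metis less_irrefl right_minus_eq zero_less_abs_iff)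
  then show ?thesis by (simp add: F_def G_def)
qed

lemma frechet_derivative_bounded_linear:
  assumes "bounded_linear h" "f differentiable (at x)"
  shows "frechet_derivative (\<lambda>y. h (f y)) (at x) v = h (frechet_derivative f (at x) v)"
  using bounded_linear.has_derivative[OF assms(1) assms(2)[unfolded frechet_derivative_works]]
    frechet_derivative_at by metis

lemma smooth_on_differentiable:
  fixes U :: "'a::euclidean_space set"
  assumes "open U" "smooth_on U f" "x \<in> U"
  shows "f differentiable (at x)"
  using smooth_on_open_has_derivative[OF assms] differentiableI by blast

lemma frechet_derivative_cong_open:
  assumes "open U" "x \<in> U" "\<And>y. y \<in> U \<Longrightarrow> f y = g y"
  shows "frechet_derivative f (at x) = frechet_derivative g (at x)"
proof -
  have "(f has_derivative D) (at x) \<longleftrightarrow> (g has_derivative D) (at x)" for D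
    using assms by (metis has_derivative_transform_within_open)
  then show ?thesis unfolding frechet_derivative_def by simp
qed

text \<open>The mean value theorem is scalar, so the vector-valued case is obtained component by
  component.\<close>

lemma frechet_derivative_symmetric:
  fixes f :: "'a::euclidean_space \<Rightarrow> 'b::euclidean_space"
  assumes U: "open U" and f: "smooth_on U f" and x: "x \<in> U"
  shows "frechet_derivative (\<lambda>y. frechet_derivative f (at y) u) (at x) v =
         frechet_derivative (\<lambda>y. frechet_derivative f (at y) v) (at x) u"
proof (rule euclidean_eqI)
  fix i :: 'b assume "i \<in> Basis"
  let ?h = "\<lambda>z::'b. z \<bullet> i"
  have h: "bounded_linear ?h" by (rule bounded_linear_inner_left)
  have fi: "smooth_on U (\<lambda>y. f y \<bullet> i)" using smooth_on_bounded_linear[OF h open_uds[OF U] f] .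
  have *: "frechet_derivative (\<lambda>y. frechet_derivative f (at y) u) (at x) v \<bullet> i =
    frechet_derivative (\<lambda>y. frechet_derivative (\<lambda>y. f y \<bullet> i) (at y) u) (at x) v" for u v
  proof -
    have "frechet_derivative (\<lambda>y. frechet_derivative (\<lambda>y. f y \<bullet> i) (at y) u) (at x) =
      frechet_derivative (\<lambda>y. frechet_derivative f (at y) u \<bullet> i) (at x)"
      by (rule frechet_derivative_cong_open[OF U x])
        (simp add: frechet_derivative_bounded_linear[OF h] smooth_on_differentiable[OF U f])
    then show ?thesis
      using frechet_derivative_bounded_linear[OF h smooth_on_differentiable[OF U smooth_on_open_derivative[OF U f] x]]
      by simp
  qed
  show "frechet_derivative (\<lambda>y. frechet_derivative f (at y) u) (at x) v \<bullet> i =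
    frechet_derivative (\<lambda>y. frechet_derivative f (at y) v) (at x) u \<bullet> i"
    unfolding * by (rule frechet_derivative_symmetric_real[OF U fi x])
qed

subsection \<open>Linear systems with parameters\<close>

text \<open>The lower bound of \<open>A x\<close> survives near \<open>x\<close> with half the
  constant, because \<open>A y - A x\<close> is small on the basis vectors. It bounds
  \<open>h y - h x\<close> by \<open>F y - A y (h x)\<close>, which tends to 0. Here
  \<open>h\<close> is merely some solution of the system; no inverse is formed.\<close>

lemma linear_system_continuous:
  fixes A :: "'x::real_normed_vector \<Rightarrow> 'e::euclidean_space \<Rightarrow> 'e"
  assumes x: "x \<in> S" and lin: "\<And>y. y \<in> S \<Longrightarrow> linear (A y)" and inj: "inj (A x)"
    and A: "\<And>u. continuous (at x within S) (\<lambda>y. A y u)" and F: "continuous (at x within S) F"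
    and h: "\<And>y. y \<in> S \<Longrightarrow> A y (h y) = F y"
  shows "continuous (at x within S) h"
proof -
  let ?F = "at x within S"
  obtain c where c: "c > 0" "\<And>z. c * norm z \<le> norm (A x z)"
    using linear_inj_bounded_below_pos[OF lin[OF x] inj] by blast
  have "((\<lambda>y. norm (A y i - A x i)) \<longlongrightarrow> 0) ?F" for i
    using A[of i] unfolding continuous_within by (intro tendsto_norm_zero LIM_zero)
  then have A0: "((\<lambda>y. \<Sum>i\<in>Basis. norm (A y i - A x i)) \<longlongrightarrow> 0) ?F"
    by (intro tendsto_null_sum)
  have ev: "\<forall>\<^sub>F y in ?F. (\<Sum>i\<in>Basis. norm (A y i - A x i)) < c / 2"
    using order_tendstoD(2)[OF A0, of "c/2"] c by simp
  have bound: "norm (A y z - A x z) \<le> (\<Sum>i\<in>Basis. norm (A y i - A x i)) * norm z" if "y \<in> S" for y z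
  proof -
    have "A y z - A x z = (\<Sum>i\<in>Basis. (z \<bullet> i) *\<^sub>R (A y i - A x i))"
      using linear_sum_Basis[OF lin[OF that], of z] linear_sum_Basis[OF lin[OF x], of z]
      by (simp add: scaleR_diff_right sum_subtractf)
    also have "norm \<dots> \<le> (\<Sum>i\<in>Basis. norm z * norm (A y i - A x i))"
      by (rule sum_norm_le) (simp add: mult_right_mono Basis_le_norm)
    finally show ?thesis by (simp add: sum_distrib_left mult.commute)
  qed
  have R0: "((\<lambda>y. norm (F y - A y (h x)) * (2 / c)) \<longlongrightarrow> 0) ?F"
  proof -
    have "((\<lambda>y. F y - A y (h x)) \<longlongrightarrow> F x - A x (h x)) ?F"
      using A F unfolding continuous_within by (intro tendsto_diff)
    then have "((\<lambda>y. F y - A y (h x)) \<longlongrightarrow> 0) ?F" using h[OF x] by simp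
    then show ?thesis by (intro tendsto_mult_left_zero tendsto_norm_zero)
  qed
  have "\<forall>\<^sub>F y in ?F. y \<in> S" by (simp add: eventually_at_filter)
  with ev have "\<forall>\<^sub>F y in ?F. norm (h y - h x) \<le> norm (F y - A y (h x)) * (2 / c)"
  proof eventually_elim
    case (elim y)
    let ?z = "h y - h x"
    have "norm (A y ?z) = norm (F y - A y (h x))"
      using h[OF elim(2)] linear_diff[OF lin[OF elim(2)]] by simp
    moreover have "norm (A x ?z) \<le> norm (A y ?z) + norm (A y ?z - A x ?z)"
      using norm_triangle_ineq4[of "A y ?z" "A y ?z - A x ?z"] by simp
    moreover have "norm (A y ?z - A x ?z) \<le> c / 2 * norm ?z"
      using bound[OF elim(2), of ?z] elim(1) by (smt (verit) mult_right_mono norm_ge_zero)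
    ultimately have "c * norm ?z \<le> norm (F y - A y (h x)) + c / 2 * norm ?z"
      using c(2)[of ?z] by linarith
    then show ?case using c(1) by (simp add: field_simps)
  qed
  then have "((\<lambda>y. h y - h x) \<longlongrightarrow> 0) ?F"
    by (rule Lim_null_comparison[OF _ R0])
  then show ?thesis unfolding continuous_within by (simp add: LIM_zero_iff)
qed

text \<open>A product rule with one factor only continuous. It will be applied when that factor is a
  component of the unknown solution, whose differentiability is still to be shown.\<close>

lemma has_derivative_mult_vanishing:
  fixes k :: "'x::real_normed_vector \<Rightarrow> 'e::real_normed_vector"
  assumes x: "x \<in> S" and c: "continuous (at x within S) c" and k: "(k has_derivative k') (at x within S)" and k0: "k x = 0"
  shows "((\<lambda>y. c y *\<^sub>R k y) has_derivative (\<lambda>v. c x *\<^sub>R k' v)) (at x within S)"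
proof -
  interpret k': bounded_linear k' using k by (rule has_derivative_bounded_linear)
  obtain K where K: "\<And>v. norm (k' v) \<le> norm v * K" using k'.bounded by blast
  have q: "((\<lambda>y. norm (k y - k x - k' (y - x)) / norm (y - x)) \<longlongrightarrow> 0) (at x within S)"
    using k unfolding has_derivative_iff_norm by blast
  have c0: "((\<lambda>y. c y - c x) \<longlongrightarrow> 0) (at x within S)" using c unfolding continuous_within by (simp add: LIM_zero_iff)
  have lim: "((\<lambda>y. \<bar>c y\<bar> * (norm (k y - k x - k' (y - x)) / norm (y - x)) + \<bar>c y - c x\<bar> * K) \<longlongrightarrow> \<bar>c x\<bar> * 0 + 0 * K) (at x within S)"
    using c q c0 unfolding continuous_within by (intro tendsto_intros tendsto_rabs_zero)
  have le: "norm (norm (c y *\<^sub>R k y - c x *\<^sub>R k x - c x *\<^sub>R k' (y - x)) / norm (y - x))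
    \<le> \<bar>c y\<bar> * (norm (k y - k x - k' (y - x)) / norm (y - x)) + \<bar>c y - c x\<bar> * K" if "y \<noteq> x" for y
  proof -
    have "c y *\<^sub>R k y - c x *\<^sub>R k x - c x *\<^sub>R k' (y - x) = c y *\<^sub>R (k y - k x - k' (y - x)) + (c y - c x) *\<^sub>R k' (y - x)"
      using k0 by (simp add: algebra_simps)
    then have "norm (c y *\<^sub>R k y - c x *\<^sub>R k x - c x *\<^sub>R k' (y - x)) \<le>
      \<bar>c y\<bar> * norm (k y - k x - k' (y - x)) + \<bar>c y - c x\<bar> * (norm (y - x) * K)"
      using norm_triangle_ineq[of "c y *\<^sub>R (k y - k x - k' (y - x))" "(c y - c x) *\<^sub>R k' (y - x)"]
        mult_left_mono[OF K[of "y - x"], of "\<bar>c y - c x\<bar>"] by simp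
    then show ?thesis using that by (simp add: field_simps)
  qed
  show ?thesis unfolding has_derivative_iff_norm
  proof
    show "bounded_linear (\<lambda>v. c x *\<^sub>R k' v)" by (intro bounded_linear_const_scaleR k'.bounded_linear_axioms)
    show "((\<lambda>y. norm (c y *\<^sub>R k y - c x *\<^sub>R k x - c x *\<^sub>R k' (y - x)) / norm (y - x)) \<longlongrightarrow> 0) (at x within S)"
    proof (rule Lim_null_comparison)
      show "\<forall>\<^sub>F y in at x within S. norm (norm (c y *\<^sub>R k y - c x *\<^sub>R k x - c x *\<^sub>R k' (y - x)) / norm (y - x))
        \<le> \<bar>c y\<bar> * (norm (k y - k x - k' (y - x)) / norm (y - x)) + \<bar>c y - c x\<bar> * K"
        unfolding eventually_at_filter by (intro always_eventually allI impI le)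
      show "((\<lambda>y. \<bar>c y\<bar> * (norm (k y - k x - k' (y - x)) / norm (y - x)) + \<bar>c y - c x\<bar> * K) \<longlongrightarrow> 0) (at x within S)"
        using lim by simp
    qed
  qed
qed

text \<open>With a left inverse \<open>L\<close> of \<open>A x\<close>, the solution equals
  \<open>L (F y)\<close> minus terms \<open>(h y \<bullet> i) *\<^sub>R L (A y i - A x i)\<close>.
  In these the second factor vanishes at \<open>x\<close> and the first is continuous, so the
  preceding product rule applies.\<close>

lemma linear_system_differentiable:
  fixes A :: "'x::real_normed_vector \<Rightarrow> 'e::euclidean_space \<Rightarrow> 'e"
  assumes x: "x \<in> S" and lin: "\<And>y. y \<in> S \<Longrightarrow> linear (A y)" and inj: "inj (A x)"
    and A: "\<And>u. ((\<lambda>y. A y u) has_derivative (\<lambda>v. A' v u)) (at x within S)"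
    and F: "(F has_derivative F') (at x within S)"
    and h: "\<And>y. y \<in> S \<Longrightarrow> A y (h y) = F y"
  shows "\<exists>h'. (h has_derivative h') (at x within S) \<and> (\<forall>v. A x (h' v) = F' v - (\<Sum>i\<in>Basis. (h x \<bullet> i) *\<^sub>R A' v i))"
proof -
  obtain L where L: "linear L" "L \<circ> A x = id" using linear_injective_left_inverse[OF lin[OF x] inj] by blast
  have LA: "L (A x z) = z" for z using L(2) by (metis comp_apply id_apply)
  have bL: "bounded_linear L" using L(1) by (simp add: linear_conv_bounded_linear)
  have hc: "continuous (at x within S) h"
    by (rule linear_system_continuous[where A=A and F=F, OF x lin inj])
      (simp_all add: has_derivative_continuous[OF A] has_derivative_continuous[OF F] h)
  let ?k = "\<lambda>i y. L (A y i - A x i)"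
  have eq: "L (F y) - (\<Sum>i\<in>Basis. (h y \<bullet> i) *\<^sub>R ?k i y) = h y" if "y \<in> S" for y
  proof -
    have "(\<Sum>i\<in>Basis. (h y \<bullet> i) *\<^sub>R ?k i y) = L (\<Sum>i\<in>Basis. (h y \<bullet> i) *\<^sub>R (A y i - A x i))"
      using L(1) by (simp add: linear_sum linear_scale)
    also have "(\<Sum>i\<in>Basis. (h y \<bullet> i) *\<^sub>R (A y i - A x i)) = A y (h y) - A x (h y)"
      using linear_sum_Basis[OF lin[OF that], of "h y"] linear_sum_Basis[OF lin[OF x], of "h y"]
      by (simp add: scaleR_diff_right sum_subtractf)
    finally show ?thesis using h[OF that] LA linear_diff[OF L(1)] by simp
  qed
  let ?h' = "\<lambda>v. L (F' v) - (\<Sum>i\<in>Basis. (h x \<bullet> i) *\<^sub>R L (A' v i))"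
  have "((\<lambda>y. L (F y) - (\<Sum>i\<in>Basis. (h y \<bullet> i) *\<^sub>R ?k i y)) has_derivative ?h') (at x within S)"
  proof (intro has_derivative_diff has_derivative_sum bounded_linear.has_derivative[OF bL F]
      has_derivative_mult_vanishing[OF x])
    fix i :: 'e
    show "continuous (at x within S) (\<lambda>y. h y \<bullet> i)" using hc by (intro continuous_intros)
    show "L (A x i - A x i) = 0" using linear_0[OF L(1)] by simp
    show "(?k i has_derivative (\<lambda>v. L (A' v i))) (at x within S)"
      using bounded_linear.has_derivative[OF bL has_derivative_diff[OF A[of i] has_derivative_const[of "A x i"]]] by simp
  qed
  then have h': "(h has_derivative ?h') (at x within S)"
    using eq x by (metis (no_types, lifting) has_derivative_transform)
  have AA: "A x (L z) = z" for z
  proof -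
    obtain w where "z = A x w" using linear_injective_imp_surjective[OF lin[OF x] inj] by (metis surj_def)
    then show ?thesis using LA by simp
  qed
  have "A x (?h' v) = F' v - (\<Sum>i\<in>Basis. (h x \<bullet> i) *\<^sub>R A' v i)" for v
    using lin[OF x] by (simp add: linear_diff linear_sum linear_scale AA)
  with h' show ?thesis by blast
qed

text \<open>Bootstrapping: the derivative of the solution solves a system with the same matrix,
  whose right-hand side involves only \<open>h\<close>, \<open>F'\<close> and
  \<open>A'\<close>.\<close>

lemma Ck_on_linear_system:
  fixes A :: "'x::euclidean_space \<Rightarrow> 'e::euclidean_space \<Rightarrow> 'e"
  assumes S: "uds S" and lin: "\<And>y. y \<in> S \<Longrightarrow> linear (A y)" and inj: "\<And>y. y \<in> S \<Longrightarrow> inj (A y)"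
    and A: "\<And>u. smooth_on S (\<lambda>y. A y u)"
    and F: "Ck_on k S F" and h: "\<And>y. y \<in> S \<Longrightarrow> A y (h y) = F y"
  shows "Ck_on k S h"
  using F h
proof (induction k arbitrary: F h)
  case 0
  have "continuous (at x within S) h" if "x \<in> S" for x
    using smooth_on_continuous[OF A] 0 that lin inj
    by (intro linear_system_continuous[of x S A F h]) (auto simp: continuous_on_eq_continuous_within)
  then show ?case by (simp add: continuous_on_eq_continuous_within)
next
  case (Suc k)
  have "\<exists>D. (\<forall>x\<in>S. ((\<lambda>y. A y u) has_derivative D x) (at x within S)) \<and> (\<forall>v. smooth_on S (\<lambda>x. D x v))" for u
    using smooth_on_iff[OF S, THEN iffD1, OF A] .
  then obtain A' where A': "\<And>u x. x \<in> S \<Longrightarrow> ((\<lambda>y. A y u) has_derivative A' u x) (at x within S)"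
    "\<And>u v. smooth_on S (\<lambda>x. A' u x v)" by metis
  obtain F' where F': "\<And>x. x \<in> S \<Longrightarrow> (F has_derivative F' x) (at x within S)"
    "\<And>v. Ck_on k S (\<lambda>x. F' x v)" using Suc.prems(1) unfolding Ck_on_Suc_iff[OF S] by blast
  have "\<exists>h'. (h has_derivative h') (at x within S) \<and>
     (\<forall>v. A x (h' v) = F' x v - (\<Sum>i\<in>Basis. (h x \<bullet> i) *\<^sub>R A' i x v))" if "x \<in> S" for x
    by (rule linear_system_differentiable[where A=A and A'="\<lambda>v u. A' u x v" and F=F and F'="F' x",
          OF that lin inj[OF that] A'(1)[OF that] F'(1)[OF that] Suc.prems(2)])
  then obtain h' where h': "\<And>x. x \<in> S \<Longrightarrow> (h has_derivative h' x) (at x within S)"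
    "\<And>x v. x \<in> S \<Longrightarrow> A x (h' x v) = F' x v - (\<Sum>i\<in>Basis. (h x \<bullet> i) *\<^sub>R A' i x v)" by metis
  have hk: "Ck_on k S h" using Suc.IH[OF Ck_on_SucD[OF S Suc.prems(1)] Suc.prems(2)] .
  have A'k: "Ck_on k S (\<lambda>x. A' u x v)" for u v using A'(2) unfolding smooth_on_def by blast
  have "Ck_on k S (\<lambda>x. F' x v + - (\<Sum>i\<in>Basis. (h x \<bullet> i) *\<^sub>R A' i x v))" for v
    by (intro Ck_on_add[OF S] F' Ck_on_bounded_linear[OF bounded_linear_minus[OF bounded_linear_ident] S]
        Ck_on_sum[OF S] Ck_on_bilinear[OF bounded_bilinear_scaleR S]
        Ck_on_bounded_linear[OF bounded_linear_inner_left S] hk A'k)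
  then have "Ck_on k S (\<lambda>x. h' x v)" for v
    by (rule Suc.IH) (simp add: h'(2))
  then show ?case unfolding Ck_on_Suc_iff[OF S] using h'(1) by blast
qed

lemma smooth_on_linear_system:
  fixes A :: "'x::euclidean_space \<Rightarrow> 'e::euclidean_space \<Rightarrow> 'e"
  assumes "uds S" "\<And>y. y \<in> S \<Longrightarrow> linear (A y)" "\<And>y. y \<in> S \<Longrightarrow> inj (A y)"
    "\<And>u. smooth_on S (\<lambda>y. A y u)" "smooth_on S F" "\<And>y. y \<in> S \<Longrightarrow> A y (h y) = F y"
  shows "smooth_on S h"
  unfolding smooth_on_def
  by (intro allI, rule Ck_on_linear_system[of S A _ F h]) (use assms smooth_on_def in blast)+

text \<open>Bootstrapping again: if \<open>y\<close> is of class \<open>Ck_on k\<close>, then so is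
  the right-hand side \<open>B t (y t)\<close>, which is the derivative of \<open>y\<close>.\<close>

lemma smooth_on_linear_ode:
  fixes B :: "real \<Rightarrow> 'e::euclidean_space \<Rightarrow> 'e"
  assumes S: "uds S" and lin: "\<And>t. t \<in> S \<Longrightarrow> linear (B t)" and B: "\<And>u. smooth_on S (\<lambda>t. B t u)"
    and y: "\<And>t. t \<in> S \<Longrightarrow> (y has_vector_derivative B t (y t)) (at t within S)"
  shows "smooth_on S y"
proof -
  have "Ck_on k S y" for k
  proof (induction k)
    case 0
    show ?case unfolding Ck_on.simps continuous_on_eq_continuous_within
      using has_vector_derivative_continuous[OF y] by blast
  next
    case (Suc k)
    have Bk: "Ck_on k S (\<lambda>t. B t u)" for u using B[of u] unfolding smooth_on_def by (rule spec)
    have "Ck_on k S (\<lambda>t. B t (y t))"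
      by (rule Ck_on_param_linear[OF S lin Bk Suc])
    then have "Ck_on k S (\<lambda>t. v *\<^sub>R B t (y t))" for v
      by (rule Ck_on_bounded_linear[OF bounded_linear_scaleR_right S])
    then show ?case unfolding Ck_on_Suc_iff[OF S]
      using y by (intro exI[of _ "\<lambda>t v. v *\<^sub>R B t (y t)"]) (simp add: has_vector_derivative_def)
  qed
  then show ?thesis by (simp add: smooth_on_def)
qed

subsection \<open>Linear ordinary differential equations\<close>

lemma increasing_within:
  fixes f :: "real \<Rightarrow> real"
  assumes "a \<le> b" "\<And>t. a \<le> t \<Longrightarrow> t \<le> b \<Longrightarrow> (f has_real_derivative f' t) (at t within {a..b})"
    "\<And>t. a \<le> t \<Longrightarrow> t \<le> b \<Longrightarrow> f' t \<ge> 0"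
  shows "f a \<le> f b"
proof (cases "a < b")
  case True
  have "\<exists>x\<in>{a<..<b}. f b - f a = (\<lambda>t. (*) (f' t)) x (b - a)"
    by (rule mvt_simple[OF True]) (simp add: assms(2)[unfolded has_field_derivative_def])
  then obtain x where x: "a < x" "x < b" "f b - f a = f' x * (b - a)" by auto
  have "0 \<le> f' x * (b - a)" using assms(3)[of x] x True by simp
  then show ?thesis using x(3) by simp
qed (use assms in auto)

text \<open>Continuity is known for each fixed vector only; boundedness on the finitely many basis
  vectors gives a uniform bound on all vectors.\<close>

lemma linear_family_bound:
  fixes B :: "real \<Rightarrow> 'e::euclidean_space \<Rightarrow> 'f::real_normed_vector"
  assumes lin: "\<And>t. t \<in> {a..b} \<Longrightarrow> linear (B t)" and B: "\<And>u. continuous_on {a..b} (\<lambda>t. B t u)"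
  shows "\<exists>C\<ge>0. \<forall>t\<in>{a..b}. \<forall>u. norm (B t u) \<le> C * norm u"
proof -
  have "\<exists>k. \<forall>t\<in>{a..b}. norm (B t u) \<le> k" for u
    using compact_imp_bounded[OF compact_continuous_image[OF B[of u] compact_Icc]]
    unfolding bounded_iff by auto
  then obtain k where k: "\<And>u t. t \<in> {a..b} \<Longrightarrow> norm (B t u) \<le> k u" by metis
  let ?C = "\<Sum>i\<in>Basis. \<bar>k i\<bar>"
  have "norm (B t u) \<le> ?C * norm u" if "t \<in> {a..b}" for t u
  proof -
    have "norm (\<Sum>i\<in>Basis. (u \<bullet> i) *\<^sub>R B t i) \<le> (\<Sum>i\<in>Basis. norm u * \<bar>k i\<bar>)"
    proof (rule sum_norm_le)
      fix i :: 'e assume "i \<in> Basis"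
      then have "\<bar>u \<bullet> i\<bar> \<le> norm u" by (rule Basis_le_norm)
      then show "norm ((u \<bullet> i) *\<^sub>R B t i) \<le> norm u * \<bar>k i\<bar>"
        using k[OF that, of i] by (simp add: mult_mono)
    qed
    then show ?thesis using linear_sum_Basis[OF lin[OF that], of u]
      by (simp add: sum_distrib_left mult.commute)
  qed
  then show ?thesis by (intro exI[of _ ?C]) (auto intro: sum_nonneg)
qed

text \<open>Picard iteration organised as a series: linearity makes successive differences of the
  iterates into repeated integrals, which the exponential series dominates. The solution then exists
  on the whole interval at once.\<close>

lemma linear_ode_exists:
  fixes B :: "real \<Rightarrow> 'e::euclidean_space \<Rightarrow> 'e"
  assumes ab: "a \<le> b" and lin: "\<And>t. t \<in> {a..b} \<Longrightarrow> linear (B t)" and B: "\<And>u. continuous_on {a..b} (\<lambda>t. B t u)"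
  shows "\<exists>x. x a = x0 \<and> (\<forall>t\<in>{a..b}. (x has_vector_derivative B t (x t)) (at t within {a..b}))"
proof -
  obtain C where C: "C \<ge> 0" "\<And>t u. t \<in> {a..b} \<Longrightarrow> norm (B t u) \<le> C * norm u"
    using linear_family_bound[OF lin B] by blast
  \<comment> \<open>\<open>X n\<close> is the n-fold repeated integral; the partial sums of the
    \<open>X n\<close> are the Picard iterates.\<close>
  define X where "X = rec_nat (\<lambda>t. x0) (\<lambda>n Xn t. integral {a..t} (\<lambda>s. B s (Xn s)))"
  have X0: "X 0 = (\<lambda>t. x0)" and XS: "X (Suc n) = (\<lambda>t. integral {a..t} (\<lambda>s. B s (X n s)))" for n
    by (simp_all add: X_def)
  have contB: "continuous_on {a..b} (\<lambda>t. B t (x t))" if "continuous_on {a..b} x" for x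
  proof -
    have "continuous_on {a..b} (\<lambda>t. \<Sum>i\<in>Basis. (x t \<bullet> i) *\<^sub>R B t i)"
      by (intro continuous_intros that B)
    then show ?thesis
      by (rule continuous_on_eq) (rule linear_sum_Basis[OF lin, symmetric])
  qed
  have dX: "(X (Suc n) has_vector_derivative B t (X n t)) (at t within {a..b})"
    if "continuous_on {a..b} (X n)" "t \<in> {a..b}" for n t
    unfolding XS using integral_has_vector_derivative[OF contB[OF that(1)] that(2)] .
  have contX: "continuous_on {a..b} (X n)" for n
  proof (induction n)
    case 0 then show ?case by (simp add: X0)
  next
    case (Suc n)
    show ?case unfolding continuous_on_eq_continuous_within
      using has_vector_derivative_continuous[OF dX[OF Suc]] by blast
  qed
  have bX: "norm (X n t) \<le> norm x0 * (C * (t - a)) ^ n / fact n" if "t \<in> {a..b}" for n t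
    using that
  proof (induction n arbitrary: t)
    case 0 then show ?case by (simp add: X0)
  next
    case (Suc n)
    let ?g = "\<lambda>s. C * (norm x0 * (C * (s - a)) ^ n / fact n)"
    let ?G = "\<lambda>s. norm x0 * (C * (s - a)) ^ Suc n / fact (Suc n)"
    have sub: "{a..t} \<subseteq> {a..b}" using Suc.prems by auto
    have dG: "(?G has_vector_derivative ?g s) (at s within {a..t})" for s
    proof -
      have G: "(?G has_real_derivative (norm x0 * (real (Suc n) * (C * (s - a)) ^ n * C)) / fact (Suc n)) (at s within {a..t})"
        by (auto intro!: derivative_eq_intros simp del: power_Suc)
      have eq: "(norm x0 * (real (Suc n) * (C * (s - a)) ^ n * C)) / fact (Suc n) = ?g s"
        by (simp add: field_simps del: of_nat_Suc)
      show ?thesis using G unfolding eq has_real_derivative_iff_has_vector_derivative .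
    qed
    have ig: "(?g has_integral (?G t - ?G a)) {a..t}"
      using fundamental_theorem_of_calculus[of a t ?G ?g] dG Suc.prems by auto
    have "norm (X (Suc n) t) \<le> integral {a..t} ?g"
      unfolding XS
    proof (rule integral_norm_bound_integral)
      show "(\<lambda>s. B s (X n s)) integrable_on {a..t}"
        by (intro integrable_continuous_interval continuous_on_subset[OF contB[OF contX] sub])
      show "?g integrable_on {a..t}" using ig by blast
      show "norm (B s (X n s)) \<le> ?g s" if "s \<in> {a..t}" for s
        using C(2)[of s "X n s"] Suc.IH[of s] that sub C(1) by (smt (verit, best) mult_left_mono subsetD)
    qed
    also have "\<dots> = ?G t" using integral_unique[OF ig] by simp
    finally show ?case .
  qed
  define N where "N n = norm x0 * (C * (b - a)) ^ n / fact n" for n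
  have bN: "norm (X n t) \<le> N n" if "t \<in> {a..b}" for n t
  proof -
    have "norm x0 * (C * (t - a)) ^ n / fact n \<le> N n" unfolding N_def
      using that C(1) by (intro divide_right_mono mult_left_mono power_mono) auto
    then show ?thesis using bX[OF that, of n] by linarith
  qed
  have sN: "summable N"
    unfolding N_def using summable_mult[OF summable_exp[of "C * (b - a)"], of "norm x0"]
    by (simp add: divide_inverse mult.commute mult.left_commute)
  \<comment> \<open>\<open>D n\<close> is the derivative of \<open>X n\<close>: zero for the
    constant \<open>X 0\<close>, and shifted by one index afterwards.\<close>
  define D where "D n t = (case n of 0 \<Rightarrow> 0 | Suc m \<Rightarrow> B t (X m t))" for n t
  define MD where "MD n = (case n of 0 \<Rightarrow> 0 | Suc m \<Rightarrow> C * N m)" for n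
  have sMD: "summable MD"
    using summable_mult[OF sN, of C] summable_Suc_iff[of MD] by (simp add: MD_def)
  have bD: "norm (D n t) \<le> MD n" if "t \<in> {a..b}" for n t
    using order_trans[OF C(2)[OF that] mult_left_mono[OF bN[OF that] C(1)]]
    by (cases n) (simp_all add: D_def MD_def)
  have sumX: "summable (\<lambda>n. X n t)" if "t \<in> {a..b}" for t
    by (rule summable_comparison_test'[OF sN, of 0]) (rule bN[OF that])
  define x where "x t = (\<Sum>n. X n t)" for t
  have Dsum: "(\<lambda>n. D n t) sums B t (x t)" if "t \<in> {a..b}" for t
  proof -
    have "bounded_linear (B t)" using lin[OF that] by (simp add: linear_conv_bounded_linear)
    then have "(\<lambda>n. B t (X n t)) sums B t (x t)"
      unfolding x_def by (rule bounded_linear.sums[OF _ summable_sums[OF sumX[OF that]]])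
    then have "(\<lambda>n. D (Suc n) t) sums B t (x t)" by (simp add: D_def)
    from sums_Suc[OF this] show ?thesis by (simp add: D_def)
  qed
  have unif: "uniform_limit {a..b} (\<lambda>n t. \<Sum>i<n. D i t) (\<lambda>t. B t (x t)) sequentially"
  proof -
    have "uniform_limit {a..b} (\<lambda>n t. \<Sum>i<n. D i t) (\<lambda>t. \<Sum>n. D n t) sequentially"
      by (rule Weierstrass_m_test[OF bD sMD])
    then show ?thesis
      by (rule uniform_limit_cong'[THEN iffD1, rotated 2]) (simp_all add: sums_unique[OF Dsum])
  qed
  have "\<exists>g. \<forall>t\<in>{a..b}. (\<lambda>n. X n t) sums g t \<and> (g has_derivative (\<lambda>h. h *\<^sub>R B t (x t))) (at t within {a..b})"
  proof (rule has_derivative_series)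
    show "convex {a..b}" by simp
    show "(X n has_derivative (\<lambda>h. h *\<^sub>R D n t)) (at t within {a..b})" if "t \<in> {a..b}" for n t
      using dX[OF contX that] by (cases n) (auto simp: D_def X0 has_vector_derivative_def)
    show "a \<in> {a..b}" using ab by simp
    then show "(\<lambda>n. X n a) sums x a" unfolding x_def using summable_sums[OF sumX] by blast
    fix e :: real assume "e > 0"
    then have "\<forall>\<^sub>F n in sequentially. \<forall>t\<in>{a..b}. norm ((\<Sum>i<n. D i t) - B t (x t)) < e"
      using unif unfolding uniform_limit_iff dist_norm by blast
    then show "\<forall>\<^sub>F n in sequentially. \<forall>t\<in>{a..b}. \<forall>h. norm ((\<Sum>i<n. h *\<^sub>R D i t) - h *\<^sub>R B t (x t)) \<le> e * norm h"
    proof eventually_elim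
      case (elim n)
      have hn: "norm ((\<Sum>i<n. h *\<^sub>R D i t) - h *\<^sub>R B t (x t)) = norm h * norm ((\<Sum>i<n. D i t) - B t (x t))" for h t
        by (metis norm_scaleR real_norm_def scaleR_diff_right scaleR_sum_right)
      show ?case
      proof (intro ballI allI)
        fix t h :: real assume "t \<in> {a..b}"
        then have "norm ((\<Sum>i<n. D i t) - B t (x t)) \<le> e" using elim by (simp add: less_imp_le)
        from mult_left_mono[OF this norm_ge_zero[of h]]
        show "norm ((\<Sum>i<n. h *\<^sub>R D i t) - h *\<^sub>R B t (x t)) \<le> e * norm h"
          by (simp add: hn mult.commute)
      qed
    qed
  qed
  then obtain g where g: "\<And>t. t \<in> {a..b} \<Longrightarrow> (\<lambda>n. X n t) sums g t"
    "\<And>t. t \<in> {a..b} \<Longrightarrow> (g has_vector_derivative B t (x t)) (at t within {a..b})"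
    unfolding has_vector_derivative_def by blast
  have gx: "g t = x t" if "t \<in> {a..b}" for t
    using sums_unique[OF g(1)[OF that]] by (simp add: x_def)
  have "X n a = (if n = 0 then x0 else 0)" for n by (cases n) (simp_all add: X0 XS)
  then have "x a = x0" unfolding x_def using sums_single[of 0 "\<lambda>_. x0"] sums_unique by fastforce
  then have "g a = x0" using gx ab by simp
  moreover have "(g has_vector_derivative B t (g t)) (at t within {a..b})" if "t \<in> {a..b}" for t
    using g(2)[OF that] gx[OF that] by simp
  ultimately show ?thesis by blast
qed

text \<open>Gronwall's argument with an exponential weight. Since \<open>t0\<close> may lie inside
  the interval, it is run in both directions.\<close>

lemma linear_ode_unique:
  fixes B :: "real \<Rightarrow> 'e::euclidean_space \<Rightarrow> 'e"
  assumes lin: "\<And>t. t \<in> {a..b} \<Longrightarrow> linear (B t)" and B: "\<And>u. continuous_on {a..b} (\<lambda>t. B t u)"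
    and x: "\<And>t. t \<in> {a..b} \<Longrightarrow> (x has_vector_derivative B t (x t)) (at t within {a..b})"
    and t0: "t0 \<in> {a..b}" "x t0 = 0" and t: "t \<in> {a..b}"
  shows "x t = 0"
proof -
  obtain C where C: "\<And>t u. t \<in> {a..b} \<Longrightarrow> norm (B t u) \<le> C * norm u"
    using linear_family_bound[OF lin B] by blast
  \<comment> \<open>The norm squared has derivative at most \<open>2 * C\<close> times itself in
    absolute value. The weight with \<open>k = 2*C\<close> thus makes \<open>q\<close>
    nondecreasing, which serves to the left of \<open>t0\<close>; the weight with
    \<open>k = -2*C\<close> makes it nonincreasing, which serves to the right.\<close>
  define q where "q k t = exp (k * t) * (x t \<bullet> x t)" for k t :: real
  have q: "(q k has_real_derivative exp (k * t) * (k * (x t \<bullet> x t) + 2 * (x t \<bullet> B t (x t)))) (at t within T)"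
    if "t \<in> {a..b}" "T \<subseteq> {a..b}" for k t T
  proof -
    have "((\<lambda>t. x t \<bullet> x t) has_real_derivative 2 * (x t \<bullet> B t (x t))) (at t within T)"
      using has_vector_derivative_within_subset[OF x[OF that(1)] that(2)]
      unfolding has_real_derivative_iff_has_vector_derivative has_vector_derivative_def
      by (auto intro!: derivative_eq_intros simp: inner_commute algebra_simps)
    then show ?thesis unfolding q_def
      by (auto intro!: derivative_eq_intros simp: algebra_simps)
  qed
  have cs: "\<bar>x t \<bullet> B t (x t)\<bar> \<le> C * (x t \<bullet> x t)" if "t \<in> {a..b}" for t
    using Cauchy_Schwarz_ineq2[of "x t" "B t (x t)"] mult_left_mono[OF C[OF that, of "x t"], of "norm (x t)"]
    by (simp add: power2_norm_eq_inner[symmetric] power2_eq_square mult.left_commute)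
  have "x t \<bullet> x t \<le> 0"
  proof (cases "t \<le> t0")
    case True
    have "q (2*C) t \<le> q (2*C) t0"
    proof (rule increasing_within[OF True, where f' = "\<lambda>s. exp (2*C * s) * (2*C * (x s \<bullet> x s) + 2 * (x s \<bullet> B s (x s)))"])
      fix s assume s: "t \<le> s" "s \<le> t0"
      show "(q (2*C) has_real_derivative exp (2*C * s) * (2*C * (x s \<bullet> x s) + 2 * (x s \<bullet> B s (x s)))) (at s within {t..t0})"
        using s t t0 by (intro q) auto
      have "0 \<le> (2*C) * (x s \<bullet> x s) + 2 * (x s \<bullet> B s (x s))" using cs[of s] s t t0 by auto
      then show "0 \<le> exp (2*C * s) * (2*C * (x s \<bullet> x s) + 2 * (x s \<bullet> B s (x s)))" by simp
    qed
    then show ?thesis by (simp add: q_def t0 mult_le_0_iff)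
  next
    case False
    have "- q (-2*C) t0 \<le> - q (-2*C) t"
    proof (rule increasing_within[where f = "\<lambda>t. - q (-2*C) t" and a = t0 and b = t and f' = "\<lambda>s. - (exp (-2*C * s) * (-2*C * (x s \<bullet> x s) + 2 * (x s \<bullet> B s (x s))))"])
      show "t0 \<le> t" using False by simp
      fix s assume s: "t0 \<le> s" "s \<le> t"
      show "((\<lambda>t. - q (-2*C) t) has_real_derivative - (exp (-2*C * s) * (-2*C * (x s \<bullet> x s) + 2 * (x s \<bullet> B s (x s))))) (at s within {t0..t})"
        using s t t0 by (intro DERIV_minus q) auto
      have "-2*C * (x s \<bullet> x s) + 2 * (x s \<bullet> B s (x s)) \<le> 0" using cs[of s] s t t0 by auto
      then show "0 \<le> - (exp (-2*C * s) * (-2*C * (x s \<bullet> x s) + 2 * (x s \<bullet> B s (x s))))"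
        by (simp add: mult_nonneg_nonpos)
    qed
    then show ?thesis by (simp add: q_def t0 mult_le_0_iff)
  qed
  then show ?thesis using inner_ge_zero[of "x t"] by simp
qed

subsection \<open>Riesz representation on subspaces\<close>

lemma subspace_projection:
  fixes L :: "'e::euclidean_space set"
  assumes "subspace L"
  shows "\<exists>p. linear p \<and> (\<forall>x. p x \<in> L) \<and> (\<forall>x\<in>L. p x = x)"
  using linear_exists_left_inverse_on[of "\<lambda>x::'e. x" L] assms linear_ident
  by (auto simp: id_def image_subset_iff)

text \<open>Serves both to discharge definite descriptions and to take tangential parts.
  Representing a functional within \<open>L\<close> is reduced to the whole space, where an
  injective linear map is surjective.\<close>

lemma riesz_subspace:
  fixes g :: "'e::euclidean_space \<Rightarrow> 'e \<Rightarrow> real"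
  assumes g1: "\<And>y. linear (\<lambda>x. g x y)" and g2: "\<And>x. linear (g x)"
    and pos: "\<And>x. x \<noteq> 0 \<Longrightarrow> g x x > 0" and L: "subspace L" and f: "linear f"
  shows "\<exists>s\<in>L. \<forall>y\<in>L. g s y = f y"
proof -
  obtain p where p: "linear p" "\<And>x. p x \<in> L" "\<And>x. x \<in> L \<Longrightarrow> p x = x"
    using subspace_projection[OF L] by blast
  \<comment> \<open>An inner product on the whole space that equals \<open>g\<close> on
    \<open>L\<close> and makes the kernel of the projection \<open>p\<close> orthogonal to
    \<open>L\<close>. If \<open>s\<close> represents \<open>f\<close> composed with \<open>p\<close>
    with respect to \<open>h\<close>, then \<open>p s\<close> is the desired vector.\<close>
  define h where "h z y = g (p z) (p y) + (z - p z) \<bullet> (y - p y)" for z y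
  have h1: "linear (\<lambda>z. h z y)" for y
    unfolding h_def using linear_compose[OF p(1) g1[of "p y"]] linear_add[OF p(1)] linear_scale[OF p(1)]
    by (intro linear_compose_add) (auto simp: o_def inner_diff_left inner_add_left algebra_simps intro!: linearI)
  have h2: "linear (h z)" for z
    unfolding h_def[abs_def] using linear_compose[OF p(1) g2[of "p z"]] linear_add[OF p(1)] linear_scale[OF p(1)]
    by (intro linear_compose_add) (auto simp: o_def inner_diff_right inner_add_right algebra_simps intro!: linearI)
  have hpos: "z = 0" if "h z z = 0" for z
  proof -
    have "g (p z) (p z) \<ge> 0" using pos[of "p z"] linear_0[OF g2] by (cases "p z = 0") auto
    moreover have "(z - p z) \<bullet> (z - p z) \<ge> 0" by simp
    ultimately have "g (p z) (p z) = 0" "(z - p z) \<bullet> (z - p z) = 0" using that unfolding h_def by linarith+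
    then show ?thesis using pos[of "p z"] by fastforce
  qed
  define A where "A z = (\<Sum>i\<in>Basis. h z i *\<^sub>R i)" for z
  have Ay: "A z \<bullet> y = h z y" for z y
    using linear_sum_Basis[OF h2[of z], of y] unfolding A_def inner_sum_left inner_scaleR_left by (simp add: inner_commute[of _ y] mult.commute)
  have linA: "linear A"
    unfolding A_def using linear_add[OF h1] linear_scale[OF h1]
    by (intro linearI) (auto simp: scaleR_add_left sum.distrib scaleR_sum_right)
  have "inj A" unfolding linear_injective_0[OF linA] using hpos Ay by (metis inner_zero_left)
  then have "surj A" using linear_injective_imp_surjective[OF linA] by simp
  then obtain s where s: "A s = (\<Sum>i\<in>Basis. f (p i) *\<^sub>R i)" by (metis surj_def)
  have "h s y = f (p y)" for y
  proof -
    have "h s y = (\<Sum>i\<in>Basis. f (p i) *\<^sub>R i) \<bullet> y" using Ay s by metis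
    also have "\<dots> = f (p y)" using linear_sum_Basis[OF linear_compose[OF p(1) f], of y]
      unfolding inner_sum_left inner_scaleR_left by (simp add: inner_commute[of _ y] mult.commute)
    finally show ?thesis .
  qed
  then have "g (p s) y = f y" if "y \<in> L" for y using p(3)[OF that] by (metis h_def add.right_neutral diff_self inner_zero_right)
  then show ?thesis using p(2) by blast
qed

section \<open>Bilinear maps depending on a parameter, and the algebra of curvature
  symmetries\<close>

lemma has_derivative_param_bilinear:
  fixes B :: "'x::real_normed_vector \<Rightarrow> 'e::euclidean_space \<Rightarrow> 'e2::euclidean_space \<Rightarrow> 'f::real_normed_vector"
  assumes x: "x \<in> S" and lin1: "\<And>y b. y \<in> S \<Longrightarrow> linear (\<lambda>a. B y a b)" and lin2: "\<And>y a. y \<in> S \<Longrightarrow> linear (B y a)"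
    and B: "\<And>a b. ((\<lambda>y. B y a b) has_derivative (\<lambda>h. B' h a b)) (at x within S)"
    and V: "(V has_derivative V') (at x within S)" and W: "(W has_derivative W') (at x within S)"
  shows "((\<lambda>y. B y (V y) (W y)) has_derivative
    (\<lambda>h. B' h (V x) (W x) + B x (V x) (W' h) + B x (V' h) (W x))) (at x within S)"
proof -
  have 1: "((\<lambda>y. B y a (W y)) has_derivative (\<lambda>h. B' h a (W x) + B x a (W' h))) (at x within S)" for a
    by (rule has_derivative_param_linear[where B = "\<lambda>y. B y a" and B' = "\<lambda>h. B' h a", OF x lin2 B W])
  show ?thesis
    by (rule has_derivative_param_linear[where B = "\<lambda>y a. B y a (W y)" and B' = "\<lambda>h a. B' h a (W x) + B x a (W' h)",
          OF x lin1 1 V])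
qed

lemma has_vector_derivative_param_bilinear:
  fixes B :: "real \<Rightarrow> 'e::euclidean_space \<Rightarrow> 'e2::euclidean_space \<Rightarrow> 'f::real_normed_vector"
  assumes x: "x \<in> S" and lin1: "\<And>y b. y \<in> S \<Longrightarrow> linear (\<lambda>a. B y a b)" and lin2: "\<And>y a. y \<in> S \<Longrightarrow> linear (B y a)"
    and B: "\<And>a b. ((\<lambda>y. B y a b) has_vector_derivative B' a b) (at x within S)"
    and V: "(V has_vector_derivative V') (at x within S)" and W: "(W has_vector_derivative W') (at x within S)"
  shows "((\<lambda>y. B y (V y) (W y)) has_vector_derivative
    (B' (V x) (W x) + B x (V x) W' + B x V' (W x))) (at x within S)"
  using has_derivative_param_bilinear[where B = B and B' = "\<lambda>h a b. h *\<^sub>R B' a b", OF x lin1 lin2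
      B[unfolded has_vector_derivative_def] V[unfolded has_vector_derivative_def] W[unfolded has_vector_derivative_def]]
  by (simp add: has_vector_derivative_def scaleR_add_right linear_scale[OF lin1[OF x]] linear_scale[OF lin2[OF x]])

lemma linear_of_derivative:
  fixes B :: "'x::real_normed_vector \<Rightarrow> 'b::real_vector \<Rightarrow> 'c::real_normed_vector"
  assumes S: "open S" "x \<in> S" and lin: "\<And>y. y \<in> S \<Longrightarrow> linear (B y)"
    and B: "\<And>u. ((\<lambda>y. B y u) has_derivative (\<lambda>h. B' h u)) (at x)"
  shows "linear (B' h)"
proof (rule linearI)
  fix u w :: 'b and r :: real
  have "frechet_derivative (\<lambda>y. B y (u + w)) (at x) = frechet_derivative (\<lambda>y. B y u + B y w) (at x)"
    by (rule frechet_derivative_cong_open[OF S]) (simp add: linear_add[OF lin])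
  then show "B' h (u + w) = B' h u + B' h w"
    using frechet_derivative_at[OF B[of "u + w"]] frechet_derivative_at[OF has_derivative_add[OF B[of u] B[of w]]]
    by (metis (no_types, lifting))
  have "frechet_derivative (\<lambda>y. B y (r *\<^sub>R u)) (at x) = frechet_derivative (\<lambda>y. r *\<^sub>R B y u) (at x)"
    by (rule frechet_derivative_cong_open[OF S]) (simp add: linear_scale[OF lin])
  then show "B' h (r *\<^sub>R u) = r *\<^sub>R B' h u"
    using frechet_derivative_at[OF B[of "r *\<^sub>R u"]] frechet_derivative_at[OF has_derivative_scaleR_right[OF B[of u], of r]]
    by (metis (no_types, lifting))
qed

text \<open>The classical argument: combine the Bianchi identities for the four cyclic shifts of the
  arguments and reduce by the two antisymmetries.\<close>

lemma curvature_pair_symmetry: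
  fixes r :: "'a \<Rightarrow> 'a \<Rightarrow> 'a \<Rightarrow> 'a \<Rightarrow> real"
  assumes "\<And>a b c d. r a b c d = - r b a c d" "\<And>a b c d. r a b c d = - r a b d c"
    "\<And>a b c d. r a b c d + r b c a d + r c a b d = 0"
  shows "r a b c d = r c d a b"
  using assms(3)[of a b c d] assms(3)[of b c d a] assms(3)[of c d a b] assms(3)[of d a b c]
    assms(1)[of a b c d] assms(1)[of b c a d] assms(1)[of c a b d] assms(1)[of b c d a] assms(1)[of c d b a] assms(1)[of d b c a]
    assms(1)[of c d a b] assms(1)[of d a c b] assms(1)[of a c d b] assms(1)[of d a b c] assms(1)[of a b d c] assms(1)[of b d a c]
    assms(2)[of a b c d] assms(2)[of b c a d] assms(2)[of c a b d] assms(2)[of c d a b] assms(2)[of d a b c]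
    assms(2)[of b d a c] assms(2)[of d b a c] assms(2)[of a c b d]
  by linarith

section \<open>Riemannian manifolds in coordinates\<close>

text \<open>Charts are pairs, but quantifiers over charts are not to be split.\<close>

declare split_paired_All [simp del] split_paired_Ex [simp del]

locale riem_mfd =
  fixes M :: "('a, 'e::euclidean_space) riem"
  assumes riem: "riemannian_manifold M"
begin

abbreviation U :: "('a, 'e) chart \<Rightarrow> 'e set" where "U \<phi> \<equiv> snd \<phi> ` fst \<phi>"
abbreviation overlap :: "('a, 'e) chart \<Rightarrow> ('a, 'e) chart \<Rightarrow> 'e set" where
  "overlap \<phi> \<psi> \<equiv> snd \<phi> ` (fst \<phi> \<inter> fst \<psi>)"
abbreviation tr :: "('a, 'e) chart \<Rightarrow> ('a, 'e) chart \<Rightarrow> 'e \<Rightarrow> 'e \<Rightarrow> 'e" where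
  "tr \<phi> \<psi> x \<equiv> frechet_derivative (transition \<phi> \<psi>) (at x)"
text \<open>The Hessian of a transition map, differentiated in the direction of the first vector. It
  is the inhomogeneous term in the transformation law of the Christoffel symbols. In
  \<open>dg\<close> and \<open>d\<Gamma>\<close> the direction of differentiation likewise comes
  first.\<close>

definition dtr :: "('a, 'e) chart \<Rightarrow> ('a, 'e) chart \<Rightarrow> 'e \<Rightarrow> 'e \<Rightarrow> 'e \<Rightarrow> 'e" where
  "dtr \<phi> \<psi> x u w = frechet_derivative (\<lambda>y. tr \<phi> \<psi> y w) (at x) u"
abbreviation g :: "('a, 'e) chart \<Rightarrow> 'e \<Rightarrow> 'e \<Rightarrow> 'e \<Rightarrow> real" where "g \<equiv> coord_metric M"
definition dg :: "('a, 'e) chart \<Rightarrow> 'e \<Rightarrow> 'e \<Rightarrow> 'e \<Rightarrow> 'e \<Rightarrow> real" where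
  "dg \<phi> x h u w = frechet_derivative (\<lambda>y. g \<phi> y u w) (at x) h"
abbreviation \<Gamma> :: "('a, 'e) chart \<Rightarrow> 'e \<Rightarrow> 'e \<Rightarrow> 'e \<Rightarrow> 'e" where "\<Gamma> \<equiv> christoffel M"
definition d\<Gamma> :: "('a, 'e) chart \<Rightarrow> 'e \<Rightarrow> 'e \<Rightarrow> 'e \<Rightarrow> 'e \<Rightarrow> 'e" where
  "d\<Gamma> \<phi> x h u w = frechet_derivative (\<lambda>y. \<Gamma> \<phi> y u w) (at x) h"

section \<open>Charts and transition maps\<close>

lemma manifold: "smooth_manifold (Top M) (Atlas M)"
  using riem by (simp add: riemannian_manifold_def)

lemma chart: "\<phi> \<in> Atlas M \<Longrightarrow> is_chart (Top M) \<phi>"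
  using manifold unfolding smooth_manifold_def by blast

lemma chart_openin: "\<phi> \<in> Atlas M \<Longrightarrow> openin (Top M) (fst \<phi>)"
  using chart by (simp add: is_chart_def)

lemma open_U: "\<phi> \<in> Atlas M \<Longrightarrow> open (U \<phi>)"
  using chart by (simp add: is_chart_def)

lemma uds_U: "\<phi> \<in> Atlas M \<Longrightarrow> uds (U \<phi>)"
  by (intro open_uds open_U)

lemma chart_homeo:
  "\<phi> \<in> Atlas M \<Longrightarrow> homeomorphic_map (subtopology (Top M) (fst \<phi>)) (top_of_set (U \<phi>)) (snd \<phi>)"
  using chart by (simp add: is_chart_def)

lemma chart_inj: assumes "\<phi> \<in> Atlas M" shows "inj_on (snd \<phi>) (fst \<phi>)"
proof -
  have "topspace (subtopology (Top M) (fst \<phi>)) = fst \<phi>"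
    using openin_subset[OF chart_openin[OF assms]] by auto
  then show ?thesis using homeomorphic_imp_injective_map[OF chart_homeo[OF assms]] by simp
qed

lemma chart_inv_snd: "\<phi> \<in> Atlas M \<Longrightarrow> p \<in> fst \<phi> \<Longrightarrow> chart_inv \<phi> (snd \<phi> p) = p"
  unfolding chart_inv_def by (rule inv_into_f_f[OF chart_inj])

lemma open_overlap: assumes "\<phi> \<in> Atlas M" "\<psi> \<in> Atlas M" shows "open (overlap \<phi> \<psi>)"
proof -
  have "openin (subtopology (Top M) (fst \<phi>)) (fst \<phi> \<inter> fst \<psi>)"
    using chart_openin[OF assms(2)] by (simp add: openin_subtopology_Int2)
  then have "openin (top_of_set (U \<phi>)) (overlap \<phi> \<psi>)"
    using homeomorphic_imp_open_map[OF chart_homeo[OF assms(1)]] unfolding open_map_def by blast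
  then show ?thesis using open_U[OF assms(1)] openin_open_eq by blast
qed

lemma transition_snd: "\<phi> \<in> Atlas M \<Longrightarrow> p \<in> fst \<phi> \<Longrightarrow> transition \<phi> \<psi> (snd \<phi> p) = snd \<psi> p"
  by (simp add: transition_def chart_inv_snd)

lemma smooth_transition: "\<phi> \<in> Atlas M \<Longrightarrow> \<psi> \<in> Atlas M \<Longrightarrow> smooth_on (overlap \<phi> \<psi>) (transition \<phi> \<psi>)"
  using manifold unfolding smooth_manifold_def compatible_def by blast

lemma transition_has_derivative:
  assumes "\<phi> \<in> Atlas M" "\<psi> \<in> Atlas M" "x \<in> overlap \<phi> \<psi>"
  shows "(transition \<phi> \<psi> has_derivative tr \<phi> \<psi> x) (at x)"
  by (rule smooth_on_open_has_derivative[OF open_overlap smooth_transition]) (use assms in auto)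

lemma linear_tr:
  assumes "\<phi> \<in> Atlas M" "\<psi> \<in> Atlas M" "x \<in> overlap \<phi> \<psi>"
  shows "linear (tr \<phi> \<psi> x)"
  using transition_has_derivative[OF assms] by (rule has_derivative_linear)

lemma tr_self:
  assumes "\<phi> \<in> Atlas M" "p \<in> fst \<phi>"
  shows "tr \<phi> \<phi> (snd \<phi> p) v = v"
proof -
  have "tr \<phi> \<phi> (snd \<phi> p) = frechet_derivative (\<lambda>x. x) (at (snd \<phi> p))"
    by (rule frechet_derivative_cong_open[OF open_U[OF assms(1)]])
      (use assms in \<open>auto simp: transition_snd[OF assms(1)]\<close>)
  then show ?thesis by simp
qed

lemma tr_tr:
  assumes c: "\<phi> \<in> Atlas M" "\<psi> \<in> Atlas M" "\<zeta> \<in> Atlas M" and p: "p \<in> fst \<phi>" "p \<in> fst \<psi>" "p \<in> fst \<zeta>"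
  shows "tr \<psi> \<zeta> (snd \<psi> p) (tr \<phi> \<psi> (snd \<phi> p) v) = tr \<phi> \<zeta> (snd \<phi> p) v"
proof -
  let ?O = "overlap \<phi> \<psi> \<inter> overlap \<phi> \<zeta>"
  have "(transition \<phi> \<psi> has_derivative tr \<phi> \<psi> (snd \<phi> p)) (at (snd \<phi> p))"
    "(transition \<psi> \<zeta> has_derivative tr \<psi> \<zeta> (snd \<psi> p)) (at (transition \<phi> \<psi> (snd \<phi> p)))"
    using c p by (auto intro!: transition_has_derivative simp: transition_snd)
  from has_derivative_compose[OF this]
  have 1: "((\<lambda>x. transition \<psi> \<zeta> (transition \<phi> \<psi> x)) has_derivative (\<lambda>v. tr \<psi> \<zeta> (snd \<psi> p) (tr \<phi> \<psi> (snd \<phi> p) v)))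
    (at (snd \<phi> p))" .
  have eq: "transition \<psi> \<zeta> (transition \<phi> \<psi> x) = transition \<phi> \<zeta> x" if xO: "x \<in> ?O" for x
  proof -
    obtain q where q: "q \<in> fst \<phi>" "q \<in> fst \<psi>" "x = snd \<phi> q" using xO by blast
    then show ?thesis using c by (simp add: transition_snd)
  qed
  have "frechet_derivative (\<lambda>x. transition \<psi> \<zeta> (transition \<phi> \<psi> x)) (at (snd \<phi> p)) = tr \<phi> \<zeta> (snd \<phi> p)"
    by (rule frechet_derivative_cong_open[of ?O, OF open_Int[OF open_overlap[OF c(1,2)] open_overlap[OF c(1,3)]] _ eq])
      (use p in auto)
  then show ?thesis using frechet_derivative_at[OF 1] by metis
qed

lemma tr_inverse:
  assumes "\<phi> \<in> Atlas M" "\<psi> \<in> Atlas M" "p \<in> fst \<phi>" "p \<in> fst \<psi>"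
  shows "tr \<psi> \<phi> (snd \<psi> p) (tr \<phi> \<psi> (snd \<phi> p) v) = v"
  using tr_tr[of \<phi> \<psi> \<phi> p v] tr_self assms by simp

lemma tr_has_derivative:
  assumes "\<phi> \<in> Atlas M" "\<psi> \<in> Atlas M" "x \<in> overlap \<phi> \<psi>"
  shows "((\<lambda>y. tr \<phi> \<psi> y w) has_derivative (\<lambda>h. dtr \<phi> \<psi> x h w)) (at x)"
  unfolding dtr_def
  by (rule smooth_on_open_has_derivative[OF open_overlap smooth_on_open_derivative[OF open_overlap smooth_transition]])
    (use assms in auto)

lemma smooth_tr:
  assumes "\<phi> \<in> Atlas M" "\<psi> \<in> Atlas M"
  shows "smooth_on (overlap \<phi> \<psi>) (\<lambda>y. tr \<phi> \<psi> y w)"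
  using smooth_on_open_derivative[OF open_overlap smooth_transition] assms by blast

lemma dtr_commute:
  assumes "\<phi> \<in> Atlas M" "\<psi> \<in> Atlas M" "x \<in> overlap \<phi> \<psi>"
  shows "dtr \<phi> \<psi> x u w = dtr \<phi> \<psi> x w u"
  unfolding dtr_def by (rule frechet_derivative_symmetric[OF open_overlap smooth_transition]) (use assms in auto)

subsection \<open>Tangent spaces\<close>

lemma tangent_transform:
  assumes "v \<in> tangent_space M p" "\<phi> \<in> Atlas M" "p \<in> fst \<phi>" "\<psi> \<in> Atlas M" "p \<in> fst \<psi>"
  shows "v \<psi> = tr \<phi> \<psi> (snd \<phi> p) (v \<phi>)"
  using assms unfolding tangent_space_def chart_at_def by blast

lemma coord_vec_chart:
  assumes "\<phi> \<in> Atlas M" "p \<in> fst \<phi>"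
  shows "coord_vec M \<phi> p u \<phi> = u"
  using assms by (simp add: coord_vec_def chart_at_def tr_self)

lemma coord_vec_tangent:
  assumes "\<phi> \<in> Atlas M" "p \<in> fst \<phi>"
  shows "coord_vec M \<phi> p u \<in> tangent_space M p"
  unfolding tangent_space_def mem_Collect_eq
proof (intro conjI allI impI)
  fix \<psi> \<zeta> assume "chart_at M p \<psi> \<and> chart_at M p \<zeta>"
  then show "coord_vec M \<phi> p u \<zeta> = tr \<psi> \<zeta> (snd \<psi> p) (coord_vec M \<phi> p u \<psi>)"
    using assms tr_tr[of \<phi> \<psi> \<zeta> p u] by (simp add: coord_vec_def chart_at_def)
qed (simp add: coord_vec_def)

lemma tangent_eq_coord_vec:
  assumes "v \<in> tangent_space M p" "\<phi> \<in> Atlas M" "p \<in> fst \<phi>"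
  shows "v = coord_vec M \<phi> p (v \<phi>)"
proof
  fix \<psi>
  show "v \<psi> = coord_vec M \<phi> p (v \<phi>) \<psi>"
  proof (cases "chart_at M p \<psi>")
    case True
    then show ?thesis using tangent_transform[OF assms] by (simp add: coord_vec_def chart_at_def)
  next
    case False
    then show ?thesis using assms(1) by (simp add: coord_vec_def tangent_space_def)
  qed
qed

lemma tangent_eqI:
  assumes "v \<in> tangent_space M p" "w \<in> tangent_space M p" "\<phi> \<in> Atlas M" "p \<in> fst \<phi>" "v \<phi> = w \<phi>"
  shows "v = w"
  using assms tangent_eq_coord_vec by metis

lemma tangentI:
  assumes "\<And>\<phi>. \<not> chart_at M p \<phi> \<Longrightarrow> v \<phi> = 0"
    "\<And>\<phi> \<psi>. \<phi> \<in> Atlas M \<Longrightarrow> p \<in> fst \<phi> \<Longrightarrow> \<psi> \<in> Atlas M \<Longrightarrow> p \<in> fst \<psi> \<Longrightarrow> v \<psi> = tr \<phi> \<psi> (snd \<phi> p) (v \<phi>)"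
  shows "v \<in> tangent_space M p"
  unfolding tangent_space_def mem_Collect_eq
proof (intro conjI allI impI)
  show "v \<psi> = tr \<phi> \<psi> (snd \<phi> p) (v \<phi>)" if "chart_at M p \<phi> \<and> chart_at M p \<psi>" for \<phi> \<psi>
    using that by (intro assms(2)) (simp_all add: chart_at_def)
qed (rule assms(1))

lemma tangent_outside: "v \<in> tangent_space M p \<Longrightarrow> \<not> chart_at M p \<phi> \<Longrightarrow> v \<phi> = 0"
  unfolding tangent_space_def by blast

lemma linear_tr_at:
  "\<phi> \<in> Atlas M \<Longrightarrow> p \<in> fst \<phi> \<Longrightarrow> \<psi> \<in> Atlas M \<Longrightarrow> p \<in> fst \<psi> \<Longrightarrow> linear (tr \<phi> \<psi> (snd \<phi> p))"
  by (rule linear_tr) simp_all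

lemma tangent_add: assumes "v \<in> tangent_space M p" "w \<in> tangent_space M p" shows "v + w \<in> tangent_space M p"
proof (rule tangentI)
  fix \<phi> \<psi> assume c: "\<phi> \<in> Atlas M" "p \<in> fst \<phi>" "\<psi> \<in> Atlas M" "p \<in> fst \<psi>"
  show "(v + w) \<psi> = tr \<phi> \<psi> (snd \<phi> p) ((v + w) \<phi>)"
    using tangent_transform[OF assms(1) c] tangent_transform[OF assms(2) c] linear_add[OF linear_tr_at[OF c]] by simp
qed (simp add: tangent_outside[OF assms(1)] tangent_outside[OF assms(2)])

lemma tangent_scale: assumes "v \<in> tangent_space M p" shows "r *\<^sub>R v \<in> tangent_space M p"
proof (rule tangentI)
  fix \<phi> \<psi> assume c: "\<phi> \<in> Atlas M" "p \<in> fst \<phi>" "\<psi> \<in> Atlas M" "p \<in> fst \<psi>"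
  show "(r *\<^sub>R v) \<psi> = tr \<phi> \<psi> (snd \<phi> p) ((r *\<^sub>R v) \<phi>)"
    using tangent_transform[OF assms c] linear_scale[OF linear_tr_at[OF c]] by (simp add: scaleR_fun_def)
qed (simp add: tangent_outside[OF assms] scaleR_fun_def)

lemma tangent_zero: "0 \<in> tangent_space M p"
  by (rule tangentI) (simp_all add: linear_0[OF linear_tr_at])

lemma tangent_minus: "v \<in> tangent_space M p \<Longrightarrow> - v \<in> tangent_space M p"
  using tangent_scale[of v p "-1"] by simp

lemma chart_topspace: "\<phi> \<in> Atlas M \<Longrightarrow> p \<in> fst \<phi> \<Longrightarrow> p \<in> topspace (Top M)"
  using openin_subset[OF chart_openin] by blast

lemma chart_exists: assumes "p \<in> topspace (Top M)" obtains \<phi> where "\<phi> \<in> Atlas M" "p \<in> fst \<phi>"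
  using assms manifold unfolding smooth_manifold_def by blast

lemma ip_coord:
  assumes "v \<in> tangent_space M p" "w \<in> tangent_space M p" "\<phi> \<in> Atlas M" "p \<in> fst \<phi>"
  shows "ip M p v w = g \<phi> (snd \<phi> p) (v \<phi>) (w \<phi>)"
  using assms tangent_eq_coord_vec by (simp add: coord_metric_def chart_inv_snd)

lemma ip_props:
  assumes "p \<in> topspace (Top M)" "v \<in> tangent_space M p" "w \<in> tangent_space M p"
  shows "ip M p v w = ip M p w v" "v' \<in> tangent_space M p \<Longrightarrow> ip M p (v + v') w = ip M p v w + ip M p v' w"
    "ip M p (r *\<^sub>R v) w = r * ip M p v w" "v \<noteq> 0 \<Longrightarrow> ip M p v v > 0"
  using riem assms unfolding riemannian_manifold_def by blast+

lemma g_commute: assumes "\<phi> \<in> Atlas M" "x \<in> U \<phi>" shows "g \<phi> x u w = g \<phi> x w u"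
proof -
  obtain p where p: "p \<in> fst \<phi>" "x = snd \<phi> p" using assms by blast
  show ?thesis
    using ip_props(1)[OF chart_topspace[OF assms(1) p(1)] coord_vec_tangent[OF assms(1) p(1)] coord_vec_tangent[OF assms(1) p(1)]]
    unfolding p(2) coord_metric_def chart_inv_snd[OF assms(1) p(1)] .
qed

lemma coord_vec_linear:
  assumes "\<phi> \<in> Atlas M" "p \<in> fst \<phi>"
  shows "coord_vec M \<phi> p (u + w) = coord_vec M \<phi> p u + coord_vec M \<phi> p w"
    "coord_vec M \<phi> p (r *\<^sub>R u) = r *\<^sub>R coord_vec M \<phi> p u"
  by (rule tangent_eqI[OF _ _ assms]; use assms in
    \<open>simp add: coord_vec_tangent coord_vec_chart tangent_add tangent_scale scaleR_fun_def\<close>;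
    use assms in \<open>simp add: coord_vec_tangent tangent_scale[unfolded scaleR_fun_def]\<close>)+

lemma g_linear1: assumes "\<phi> \<in> Atlas M" "x \<in> U \<phi>" shows "linear (\<lambda>u. g \<phi> x u w)"
proof -
  obtain p where p: "p \<in> fst \<phi>" "x = snd \<phi> p" using assms by blast
  note T = chart_topspace[OF assms(1) p(1)] coord_vec_tangent[OF assms(1) p(1)] coord_vec_tangent[OF assms(1) p(1)]
  show ?thesis unfolding p(2) coord_metric_def chart_inv_snd[OF assms(1) p(1)]
    by (rule linearI)
      (simp_all add: coord_vec_linear[OF assms(1) p(1)] ip_props(2,3)[OF T] coord_vec_tangent[OF assms(1) p(1)])
qed

lemma g_linear2: assumes "\<phi> \<in> Atlas M" "x \<in> U \<phi>" shows "linear (g \<phi> x u)"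
  using g_linear1[OF assms, of u] g_commute[OF assms] by (metis (no_types, lifting) ext)

lemma g_pos: assumes "\<phi> \<in> Atlas M" "x \<in> U \<phi>" "u \<noteq> 0" shows "g \<phi> x u u > 0"
proof -
  obtain p where p: "p \<in> fst \<phi>" "x = snd \<phi> p" using assms by blast
  have "coord_vec M \<phi> p u \<noteq> 0" using coord_vec_chart[OF assms(1) p(1), of u] assms(3) by auto
  then show ?thesis unfolding p(2) coord_metric_def chart_inv_snd[OF assms(1) p(1)]
    by (intro ip_props(4)[OF chart_topspace coord_vec_tangent coord_vec_tangent]) (use assms p in auto)
qed

lemma g_cancel: assumes "\<phi> \<in> Atlas M" "x \<in> U \<phi>" "\<And>v. g \<phi> x u v = g \<phi> x w v" shows "u = w"
proof -
  have "g \<phi> x (u - w) (u - w) = 0" using assms(3) linear_diff[OF g_linear1[OF assms(1,2)]] by simp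
  then show ?thesis using g_pos[OF assms(1,2), of "u - w"] by fastforce
qed

lemma g_transform:
  assumes c: "\<phi> \<in> Atlas M" "\<psi> \<in> Atlas M" and p: "p \<in> fst \<phi>" "p \<in> fst \<psi>"
  shows "g \<psi> (snd \<psi> p) (tr \<phi> \<psi> (snd \<phi> p) u) (tr \<phi> \<psi> (snd \<phi> p) w) = g \<phi> (snd \<phi> p) u w"
proof -
  have e: "coord_vec M \<phi> p u \<psi> = tr \<phi> \<psi> (snd \<phi> p) u" for u
    using c p by (simp add: coord_vec_def chart_at_def)
  show ?thesis
    using ip_coord[OF coord_vec_tangent[OF c(1) p(1)] coord_vec_tangent[OF c(1) p(1)] c(1) p(1), of u w]
      ip_coord[OF coord_vec_tangent[OF c(1) p(1)] coord_vec_tangent[OF c(1) p(1)] c(2) p(2), of u w]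
    by (simp add: e coord_vec_chart[OF c(1) p(1)])
qed

lemma smooth_g: "\<phi> \<in> Atlas M \<Longrightarrow> smooth_on (U \<phi>) (\<lambda>x. g \<phi> x u w)"
  using riem by (simp add: riemannian_manifold_def del: split_paired_All)

lemma g_has_derivative:
  assumes "\<phi> \<in> Atlas M" "x \<in> U \<phi>"
  shows "((\<lambda>y. g \<phi> y u w) has_derivative (\<lambda>h. dg \<phi> x h u w)) (at x)"
  unfolding dg_def by (rule smooth_on_open_has_derivative[OF open_U smooth_g]) (use assms in auto)

lemma smooth_dg: "\<phi> \<in> Atlas M \<Longrightarrow> smooth_on (U \<phi>) (\<lambda>x. dg \<phi> x h u w)"
  unfolding dg_def by (rule smooth_on_open_derivative[OF open_U smooth_g])

lemma dg_linear:
  assumes "\<phi> \<in> Atlas M" "x \<in> U \<phi>"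
  shows "linear (\<lambda>h. dg \<phi> x h u w)" "linear (\<lambda>u. dg \<phi> x h u w)" "linear (\<lambda>w. dg \<phi> x h u w)"
proof -
  show "linear (\<lambda>h. dg \<phi> x h u w)" using g_has_derivative[OF assms] by (rule has_derivative_linear)
  show "linear (\<lambda>u. dg \<phi> x h u w)"
    by (rule linear_of_derivative[where B = "\<lambda>y u. g \<phi> y u w" and B' = "\<lambda>h u. dg \<phi> x h u w", OF open_U[OF assms(1)] assms(2)
      g_linear1[OF assms(1)] g_has_derivative[OF assms]])
  show "linear (\<lambda>w. dg \<phi> x h u w)"
    by (rule linear_of_derivative[where B = "\<lambda>y w. g \<phi> y u w" and B' = "\<lambda>h w. dg \<phi> x h u w", OF open_U[OF assms(1)] assms(2)
      g_linear2[OF assms(1)] g_has_derivative[OF assms]])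
qed

lemma dg_commute: assumes "\<phi> \<in> Atlas M" "x \<in> U \<phi>" shows "dg \<phi> x h u w = dg \<phi> x h w u"
  unfolding dg_def
  using frechet_derivative_cong_open[OF open_U[OF assms(1)] assms(2) g_commute[OF assms(1), of _ u w]] by simp

subsection \<open>Christoffel symbols\<close>

text \<open>Discharges the definite description in \<open>christoffel\<close>: existence is Riesz
  representation, uniqueness is nondegeneracy of the metric.\<close>

lemma christoffel_spec:
  assumes "\<phi> \<in> Atlas M" "x \<in> U \<phi>"
  shows "g \<phi> x (\<Gamma> \<phi> x u w) v = (dg \<phi> x u w v + dg \<phi> x w u v - dg \<phi> x v u w) / 2"
proof -
  let ?f = "\<lambda>v. (dg \<phi> x u w v + dg \<phi> x w u v - dg \<phi> x v u w) / 2"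
  have "linear ?f"
    using linear_add[OF dg_linear(1)[OF assms]] linear_scale[OF dg_linear(1)[OF assms]]
      linear_add[OF dg_linear(3)[OF assms]] linear_scale[OF dg_linear(3)[OF assms]]
    by (intro linearI) (simp_all add: field_simps)
  from riesz_subspace[OF g_linear1[OF assms] g_linear2[OF assms] g_pos[OF assms] subspace_UNIV this]
  obtain z where z: "\<forall>v. g \<phi> x z v = ?f v" by auto
  have "\<exists>!z. \<forall>v. g \<phi> x z v = ?f v"
    using z g_cancel[OF assms] by (metis (no_types, lifting))
  from theI'[OF this] show ?thesis
    unfolding christoffel_def dg_def by (rule spec)
qed

lemma christoffel_unique:
  assumes "\<phi> \<in> Atlas M" "x \<in> U \<phi>"
    "\<And>v. g \<phi> x z v = (dg \<phi> x u w v + dg \<phi> x w u v - dg \<phi> x v u w) / 2"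
  shows "z = \<Gamma> \<phi> x u w"
  by (rule g_cancel[OF assms(1,2)]) (simp add: assms christoffel_spec)

lemma christoffel_commute:
  assumes "\<phi> \<in> Atlas M" "x \<in> U \<phi>" shows "\<Gamma> \<phi> x u w = \<Gamma> \<phi> x w u"
  by (rule christoffel_unique[OF assms]) (simp add: christoffel_spec[OF assms] dg_commute[OF assms, of _ u w])

lemma christoffel_linear2: assumes "\<phi> \<in> Atlas M" "x \<in> U \<phi>" shows "linear (\<Gamma> \<phi> x u)"
proof (rule linearI)
  note L = linear_add[OF g_linear1[OF assms]] linear_scale[OF g_linear1[OF assms]]
    linear_add[OF dg_linear(1)[OF assms]] linear_scale[OF dg_linear(1)[OF assms]]
    linear_add[OF dg_linear(2)[OF assms]] linear_scale[OF dg_linear(2)[OF assms]]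
    linear_add[OF dg_linear(3)[OF assms]] linear_scale[OF dg_linear(3)[OF assms]]
  show "\<Gamma> \<phi> x u (v + w) = \<Gamma> \<phi> x u v + \<Gamma> \<phi> x u w" for v w
    by (rule sym, rule christoffel_unique[OF assms]) (simp add: L christoffel_spec[OF assms] field_simps)
  show "\<Gamma> \<phi> x u (r *\<^sub>R w) = r *\<^sub>R \<Gamma> \<phi> x u w" for r w
    by (rule sym, rule christoffel_unique[OF assms]) (simp add: L christoffel_spec[OF assms] field_simps)
qed

lemma christoffel_linear1: assumes "\<phi> \<in> Atlas M" "x \<in> U \<phi>" shows "linear (\<lambda>u. \<Gamma> \<phi> x u w)"
proof -
  have "(\<lambda>u. \<Gamma> \<phi> x u w) = \<Gamma> \<phi> x w" by (rule ext) (rule christoffel_commute[OF assms])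
  then show ?thesis using christoffel_linear2[OF assms] by simp
qed

text \<open>Sum of two instances of the Koszul formula, in which all derivatives except the one
  along \<open>h\<close> cancel.\<close>

lemma metric_compatible:
  assumes "\<phi> \<in> Atlas M" "x \<in> U \<phi>"
  shows "dg \<phi> x h u w = g \<phi> x (\<Gamma> \<phi> x h u) w + g \<phi> x u (\<Gamma> \<phi> x h w)"
proof -
  have "g \<phi> x (\<Gamma> \<phi> x h u) w + g \<phi> x u (\<Gamma> \<phi> x h w) =
    (dg \<phi> x h u w + dg \<phi> x u h w - dg \<phi> x w h u) / 2 + (dg \<phi> x h w u + dg \<phi> x w h u - dg \<phi> x u h w) / 2"
    unfolding g_commute[OF assms, of u] christoffel_spec[OF assms] ..
  also have "\<dots> = dg \<phi> x h u w" unfolding dg_commute[OF assms, of h w u] by (simp add: field_simps)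
  finally show ?thesis ..
qed

text \<open>The Christoffel symbols solve a linear system with the metric as matrix and derivatives
  of the metric on the right, so their smoothness needs no inverse metric.\<close>

lemma smooth_christoffel:
  assumes "\<phi> \<in> Atlas M"
  shows "smooth_on (U \<phi>) (\<lambda>x. \<Gamma> \<phi> x u w)"
proof (rule smooth_on_linear_system[OF uds_U[OF assms]])
  let ?A = "\<lambda>x z. \<Sum>i\<in>Basis. g \<phi> x z i *\<^sub>R i"
  have A: "?A x z \<bullet> y = g \<phi> x z y" if "x \<in> U \<phi>" for x z y
    using linear_sum_Basis[OF g_linear2[OF assms that], of z y]
    unfolding inner_sum_left inner_scaleR_left by (simp add: inner_commute[of _ y] mult.commute)
  show lin: "linear (?A x)" if "x \<in> U \<phi>" for x
    using linear_add[OF g_linear1[OF assms that]] linear_scale[OF g_linear1[OF assms that]]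
    by (intro linearI) (simp_all add: scaleR_add_left sum.distrib scaleR_sum_right)
  show "inj (?A x)" if "x \<in> U \<phi>" for x
    unfolding linear_injective_0[OF lin[OF that]]
  proof (intro allI impI)
    fix z assume "?A x z = 0"
    then have "g \<phi> x z z = 0" using A[OF that, of z z] by simp
    then show "z = 0" using g_pos[OF assms that, of z] by fastforce
  qed
  show "smooth_on (U \<phi>) (\<lambda>x. ?A x z)" for z
    by (intro smooth_on_sum uds_U assms smooth_on_bounded_linear[OF bounded_linear_scaleR_left] smooth_g)
  show "smooth_on (U \<phi>) (\<lambda>x. \<Sum>i\<in>Basis. ((dg \<phi> x u w i + dg \<phi> x w u i - dg \<phi> x i u w) / 2) *\<^sub>R i)"
    by (intro smooth_on_sum uds_U assms smooth_on_bounded_linear[OF bounded_linear_scaleR_left]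
        smooth_on_bounded_linear[OF bounded_linear_divide] smooth_on_diff smooth_on_add smooth_dg)
  show "?A x (\<Gamma> \<phi> x u w) = (\<Sum>i\<in>Basis. ((dg \<phi> x u w i + dg \<phi> x w u i - dg \<phi> x i u w) / 2) *\<^sub>R i)"
    if "x \<in> U \<phi>" for x by (simp only: christoffel_spec[OF assms that])
qed

lemma christoffel_has_derivative:
  assumes "\<phi> \<in> Atlas M" "x \<in> U \<phi>"
  shows "((\<lambda>y. \<Gamma> \<phi> y u w) has_derivative (\<lambda>h. d\<Gamma> \<phi> x h u w)) (at x)"
  unfolding d\<Gamma>_def by (rule smooth_on_open_has_derivative[OF open_U smooth_christoffel]) (use assms in auto)

lemma smooth_d\<Gamma>: "\<phi> \<in> Atlas M \<Longrightarrow> smooth_on (U \<phi>) (\<lambda>x. d\<Gamma> \<phi> x h u w)"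
  unfolding d\<Gamma>_def by (rule smooth_on_open_derivative[OF open_U smooth_christoffel])

lemma d\<Gamma>_linear:
  assumes "\<phi> \<in> Atlas M" "x \<in> U \<phi>"
  shows "linear (\<lambda>h. d\<Gamma> \<phi> x h u w)" "linear (\<lambda>u. d\<Gamma> \<phi> x h u w)" "linear (\<lambda>w. d\<Gamma> \<phi> x h u w)"
proof -
  show "linear (\<lambda>h. d\<Gamma> \<phi> x h u w)" using christoffel_has_derivative[OF assms] by (rule has_derivative_linear)
  show "linear (\<lambda>u. d\<Gamma> \<phi> x h u w)"
    by (rule linear_of_derivative[where B = "\<lambda>y u. \<Gamma> \<phi> y u w" and B' = "\<lambda>h u. d\<Gamma> \<phi> x h u w", OF open_U[OF assms(1)] assms(2)
      christoffel_linear1[OF assms(1)] christoffel_has_derivative[OF assms]])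
  show "linear (\<lambda>w. d\<Gamma> \<phi> x h u w)"
    by (rule linear_of_derivative[where B = "\<lambda>y w. \<Gamma> \<phi> y u w" and B' = "\<lambda>h w. d\<Gamma> \<phi> x h u w", OF open_U[OF assms(1)] assms(2)
      christoffel_linear2[OF assms(1)] christoffel_has_derivative[OF assms]])
qed

lemma d\<Gamma>_commute: assumes "\<phi> \<in> Atlas M" "x \<in> U \<phi>" shows "d\<Gamma> \<phi> x h u w = d\<Gamma> \<phi> x h w u"
  unfolding d\<Gamma>_def
  using frechet_derivative_cong_open[OF open_U[OF assms(1)] assms(2) christoffel_commute[OF assms(1), of _ u w]] by simp

lemma transition_in_U: "\<phi> \<in> Atlas M \<Longrightarrow> x \<in> overlap \<phi> \<psi> \<Longrightarrow> transition \<phi> \<psi> x \<in> U \<psi>"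
  using transition_snd by fastforce

text \<open>Differentiating the invariance of the metric gives \<open>der\<close>. Inserted into the
  Koszul formula, the Hessian terms cancel by symmetry of \<open>dtr\<close> except for the one with
  \<open>dtr \<phi> \<psi> x u w\<close>; uniqueness of the Christoffel symbols does the
  rest.\<close>

lemma christoffel_transform:
  assumes c: "\<phi> \<in> Atlas M" "\<psi> \<in> Atlas M" and x: "x \<in> overlap \<phi> \<psi>"
  shows "tr \<phi> \<psi> x (\<Gamma> \<phi> x u w) = \<Gamma> \<psi> (transition \<phi> \<psi> x) (tr \<phi> \<psi> x u) (tr \<phi> \<psi> x w) + dtr \<phi> \<psi> x u w"
proof -
  let ?x = "transition \<phi> \<psi> x" and ?A = "tr \<phi> \<psi> x" and ?D = "dtr \<phi> \<psi> x"
  have xU: "x \<in> U \<phi>" using x by auto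
  have x': "?x \<in> U \<psi>" by (rule transition_in_U[OF c(1) x])
  note G' = linear_add[OF g_linear1[OF c(2) x']] linear_diff[OF g_linear1[OF c(2) x']]
  have der: "dg \<phi> x h u w = dg \<psi> ?x (?A h) (?A u) (?A w) + g \<psi> ?x (?A u) (?D h w) + g \<psi> ?x (?D h u) (?A w)" for h u w
  proof -
    have 1: "((\<lambda>y. g \<psi> (transition \<phi> \<psi> y) (tr \<phi> \<psi> y u) (tr \<phi> \<psi> y w)) has_derivative
      (\<lambda>h. dg \<psi> ?x (?A h) (?A u) (?A w) + g \<psi> ?x (?A u) (?D h w) + g \<psi> ?x (?D h u) (?A w))) (at x within overlap \<phi> \<psi>)"
    proof (rule has_derivative_param_bilinear[where B = "\<lambda>y. g \<psi> (transition \<phi> \<psi> y)" and B' = "\<lambda>h. dg \<psi> ?x (?A h)", OF x])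
      show "linear (\<lambda>a. g \<psi> (transition \<phi> \<psi> y) a b)" "linear (g \<psi> (transition \<phi> \<psi> y) b)" if "y \<in> overlap \<phi> \<psi>" for y b
        by (rule g_linear1[OF c(2) transition_in_U[OF c(1) that]], rule g_linear2[OF c(2) transition_in_U[OF c(1) that]])
      show "((\<lambda>y. g \<psi> (transition \<phi> \<psi> y) a b) has_derivative (\<lambda>h. dg \<psi> ?x (?A h) a b)) (at x within overlap \<phi> \<psi>)" for a b
        by (rule has_derivative_compose[OF has_derivative_at_withinI[OF transition_has_derivative[OF c x]] g_has_derivative[OF c(2) x']])
    qed (rule has_derivative_at_withinI[OF tr_has_derivative[OF c x]])+
    have 2: "((\<lambda>y. g \<phi> y u w) has_derivative
      (\<lambda>h. dg \<psi> ?x (?A h) (?A u) (?A w) + g \<psi> ?x (?A u) (?D h w) + g \<psi> ?x (?D h u) (?A w))) (at x within overlap \<phi> \<psi>)"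
    proof (rule has_derivative_transform[OF x _ 1])
      fix y assume "y \<in> overlap \<phi> \<psi>"
      then obtain q where "q \<in> fst \<phi>" "q \<in> fst \<psi>" "y = snd \<phi> q" by auto
      then show "g \<phi> y u w = g \<psi> (transition \<phi> \<psi> y) (tr \<phi> \<psi> y u) (tr \<phi> \<psi> y w)"
        using g_transform[OF c] transition_snd[OF c(1)] by simp
    qed
    then have "((\<lambda>y. g \<phi> y u w) has_derivative
      (\<lambda>h. dg \<psi> ?x (?A h) (?A u) (?A w) + g \<psi> ?x (?A u) (?D h w) + g \<psi> ?x (?D h u) (?A w))) (at x)"
      using at_within_open[OF x open_overlap[OF c]] by simp
    from has_derivative_unique[OF g_has_derivative[OF c(1) xU] this] show ?thesis by metis
  qed
  have surj: "\<exists>v. ?A v = v'" for v'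
  proof -
    obtain p where "p \<in> fst \<phi>" "p \<in> fst \<psi>" "x = snd \<phi> p" using x by auto
    then show ?thesis using tr_inverse[OF c(2,1), of p v'] by blast
  qed
  have "?A (\<Gamma> \<phi> x u w) - ?D u w = \<Gamma> \<psi> ?x (?A u) (?A w)"
  proof (rule christoffel_unique[OF c(2) x'])
    fix v'
    obtain v where v: "v' = ?A v" using surj by metis
    obtain p where p: "p \<in> fst \<phi>" "p \<in> fst \<psi>" "x = snd \<phi> p" using x by auto
    have "g \<psi> ?x (?A (\<Gamma> \<phi> x u w)) (?A v) = g \<phi> x (\<Gamma> \<phi> x u w) v"
      using g_transform[OF c p(1,2)] p by (simp add: transition_snd[OF c(1)])
    then have "g \<psi> ?x (?A (\<Gamma> \<phi> x u w) - ?D u w) v' = (dg \<phi> x u w v + dg \<phi> x w u v - dg \<phi> x v u w) / 2 - g \<psi> ?x (?D u w) (?A v)"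
      by (simp add: v G' christoffel_spec[OF c(1) xU])
    also have "\<dots> = (dg \<psi> ?x (?A u) (?A w) v' + dg \<psi> ?x (?A w) (?A u) v' - dg \<psi> ?x v' (?A u) (?A w)) / 2"
      using der[of u w v] der[of w u v] der[of v u w] dtr_commute[OF c x]
        g_commute[OF c(2) x', of "?A u"] g_commute[OF c(2) x', of "?A w"] g_commute[OF c(2) x', of "?A v"]
      by (simp add: v add_divide_distrib diff_divide_distrib)
    finally show "g \<psi> ?x (?A (\<Gamma> \<phi> x u w) - ?D u w) v' =
      (dg \<psi> ?x (?A u) (?A w) v' + dg \<psi> ?x (?A w) (?A u) v' - dg \<psi> ?x v' (?A u) (?A w)) / 2" .
  qed
  then show ?thesis by (simp add: algebra_simps)
qed

subsection \<open>The curvature tensor\<close>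

abbreviation R :: "('a, 'e) chart \<Rightarrow> 'e \<Rightarrow> 'e \<Rightarrow> 'e \<Rightarrow> 'e \<Rightarrow> 'e" where "R \<equiv> coord_curvature M"

lemma R_def: "R \<phi> x u v w = d\<Gamma> \<phi> x u v w - d\<Gamma> \<phi> x v u w + \<Gamma> \<phi> x u (\<Gamma> \<phi> x v w) - \<Gamma> \<phi> x v (\<Gamma> \<phi> x u w)"
  by (simp add: coord_curvature_def d\<Gamma>_def)

lemma R_linear:
  assumes "\<phi> \<in> Atlas M" "x \<in> U \<phi>"
  shows "linear (\<lambda>u. R \<phi> x u v w)" "linear (\<lambda>v. R \<phi> x u v w)" "linear (\<lambda>w. R \<phi> x u v w)"
proof -
  note L = linear_add[OF christoffel_linear1[OF assms]] linear_scale[OF christoffel_linear1[OF assms]]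
    linear_add[OF christoffel_linear2[OF assms]] linear_scale[OF christoffel_linear2[OF assms]]
    linear_add[OF d\<Gamma>_linear(1)[OF assms]] linear_scale[OF d\<Gamma>_linear(1)[OF assms]]
    linear_add[OF d\<Gamma>_linear(2)[OF assms]] linear_scale[OF d\<Gamma>_linear(2)[OF assms]]
    linear_add[OF d\<Gamma>_linear(3)[OF assms]] linear_scale[OF d\<Gamma>_linear(3)[OF assms]]
  show "linear (\<lambda>u. R \<phi> x u v w)" "linear (\<lambda>v. R \<phi> x u v w)" "linear (\<lambda>w. R \<phi> x u v w)"
    by (intro linearI; simp add: R_def L scaleR_diff_right scaleR_add_right)+
qed

lemma smooth_R: assumes "\<phi> \<in> Atlas M" shows "smooth_on (U \<phi>) (\<lambda>x. R \<phi> x u v w)"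
proof -
  have "smooth_on (U \<phi>) (\<lambda>x. \<Gamma> \<phi> x u (\<Gamma> \<phi> x v w))" for u v w
    by (rule smooth_on_param_linear[where B = "\<lambda>x. \<Gamma> \<phi> x u", OF uds_U[OF assms] christoffel_linear2[OF assms]
          smooth_christoffel[OF assms] smooth_christoffel[OF assms]])
  note S = this
  show ?thesis unfolding R_def
    by (intro smooth_on_diff[OF uds_U[OF assms]] smooth_on_add[OF uds_U[OF assms]] smooth_d\<Gamma>[OF assms] S)
qed

text \<open>For a constant \<open>w\<close>, the second derivatives of the function
  \<open>g \<phi> y w w\<close> commute. Expressed by metric compatibility, they differ by twice the
  left-hand side, because the term pairing two Christoffel symbols is symmetric in \<open>u\<close>
  and \<open>v\<close>.\<close>

lemma g_R_self:
  assumes c: "\<phi> \<in> Atlas M" and x: "x \<in> U \<phi>"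
  shows "g \<phi> x (R \<phi> x u v w) w = 0"
proof -
  have second: "frechet_derivative (\<lambda>y. frechet_derivative (\<lambda>y. g \<phi> y w w) (at y) v) (at x) u =
    2 * (g \<phi> x (\<Gamma> \<phi> x u (\<Gamma> \<phi> x v w)) w + g \<phi> x (\<Gamma> \<phi> x v w) (\<Gamma> \<phi> x u w) + g \<phi> x (d\<Gamma> \<phi> x u v w) w)" for u v
  proof -
    have first: "frechet_derivative (\<lambda>y. g \<phi> y w w) (at y) v = 2 * g \<phi> y (\<Gamma> \<phi> y v w) w" if "y \<in> U \<phi>" for y
      using metric_compatible[OF c that, of v w w] g_commute[OF c that, of w] by (simp add: dg_def)
    have "((\<lambda>y. g \<phi> y (\<Gamma> \<phi> y v w) w) has_derivative
      (\<lambda>h. dg \<phi> x h (\<Gamma> \<phi> x v w) w + g \<phi> x (d\<Gamma> \<phi> x h v w) w)) (at x within U \<phi>)"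
      by (rule has_derivative_param_linear[where B = "\<lambda>y a. g \<phi> y a w" and B' = "\<lambda>h a. dg \<phi> x h a w", OF x g_linear1[OF c]
            has_derivative_at_withinI[OF g_has_derivative[OF c x]] has_derivative_at_withinI[OF christoffel_has_derivative[OF c x]]])
    then have "((\<lambda>y. 2 * g \<phi> y (\<Gamma> \<phi> y v w) w) has_derivative
      (\<lambda>h. 2 * (dg \<phi> x h (\<Gamma> \<phi> x v w) w + g \<phi> x (d\<Gamma> \<phi> x h v w) w))) (at x)"
      using at_within_open[OF x open_U[OF c]] by (intro has_derivative_mult_right) simp
    from fun_cong[OF frechet_derivative_at[OF this, symmetric], of u]
    have "frechet_derivative (\<lambda>y. 2 * g \<phi> y (\<Gamma> \<phi> y v w) w) (at x) u =
      2 * (dg \<phi> x u (\<Gamma> \<phi> x v w) w + g \<phi> x (d\<Gamma> \<phi> x u v w) w)" .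
    moreover have "frechet_derivative (\<lambda>y. frechet_derivative (\<lambda>y. g \<phi> y w w) (at y) v) (at x) u =
      frechet_derivative (\<lambda>y. 2 * g \<phi> y (\<Gamma> \<phi> y v w) w) (at x) u"
      by (rule fun_cong[OF frechet_derivative_cong_open[OF open_U[OF c] x first]])
    ultimately show ?thesis unfolding metric_compatible[OF c x, of u "\<Gamma> \<phi> x v w"] by (simp add: add_ac)
  qed
  have "frechet_derivative (\<lambda>y. frechet_derivative (\<lambda>y. g \<phi> y w w) (at y) v) (at x) u =
    frechet_derivative (\<lambda>y. frechet_derivative (\<lambda>y. g \<phi> y w w) (at y) u) (at x) v"
    by (rule frechet_derivative_symmetric_real[OF open_U[OF c] smooth_g[OF c] x])
  then show ?thesis unfolding second R_def
    using g_commute[OF c x, of "\<Gamma> \<phi> x v w" "\<Gamma> \<phi> x u w"]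
    by (simp add: linear_add[OF g_linear1[OF c x]] linear_diff[OF g_linear1[OF c x]])
qed

text \<open>Self-adjointness of the Jacobi operator, by pair symmetry of the curvature. Antisymmetry
  in the last two arguments is the polarisation of \<open>g_R_self\<close>, and the Bianchi identity
  comes from symmetry of the Christoffel symbols.\<close>

lemma g_R_symmetric:
  assumes c: "\<phi> \<in> Atlas M" and x: "x \<in> U \<phi>"
  shows "g \<phi> x (R \<phi> x u v v) z = g \<phi> x u (R \<phi> x z v v)"
proof -
  define r where "r a b c d = g \<phi> x (R \<phi> x a b c) d" for a b c d
  note gl = linear_add[OF g_linear1[OF c x]] linear_diff[OF g_linear1[OF c x]] linear_neg[OF g_linear1[OF c x]] linear_0[OF g_linear1[OF c x]]
  have 1: "r a b c d = - r b a c d" for a b c d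
  proof -
    have "R \<phi> x a b c = - R \<phi> x b a c" by (simp add: R_def)
    then show ?thesis by (simp add: r_def gl)
  qed
  have 2: "r a b e d = - r a b d e" for a b e d
  proof -
    have "r a b (e + d) (e + d) = 0" "r a b e e = 0" "r a b d d = 0" using g_R_self[OF c x] by (simp_all add: r_def)
    then show ?thesis by (simp add: r_def linear_add[OF R_linear(3)[OF c x]] gl linear_add[OF g_linear2[OF c x]])
  qed
  have 3: "r a b e d + r b e a d + r e a b d = 0" for a b e d
  proof -
    have "R \<phi> x a b e + R \<phi> x b e a + R \<phi> x e a b = 0"
      unfolding R_def using d\<Gamma>_commute[OF c x, of _ a b] d\<Gamma>_commute[OF c x, of _ b e] d\<Gamma>_commute[OF c x, of _ a e]
        christoffel_commute[OF c x, of a b] christoffel_commute[OF c x, of b e] christoffel_commute[OF c x, of a e] by simp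
    then have "g \<phi> x (R \<phi> x a b e + R \<phi> x b e a + R \<phi> x e a b) d = 0" by (simp add: gl)
    then show ?thesis by (simp add: r_def gl)
  qed
  have "r u v v z = r v z u v" by (rule curvature_pair_symmetry[OF 1 2 3])
  also have "\<dots> = r z v v u" using 1[of v z u v] 2[of z v u v] by simp
  finally show ?thesis using g_commute[OF c x, of u] by (simp add: r_def)
qed

text \<open>Obtained by differentiating \<open>christoffel_transform\<close> once more. The third
  derivative \<open>E\<close> of the transition map is symmetric in the first two directions and
  drops out on antisymmetrising; so do the remaining Hessian terms.\<close>

lemma R_transform:
  assumes c: "\<phi> \<in> Atlas M" "\<psi> \<in> Atlas M" and x: "x \<in> overlap \<phi> \<psi>"
  shows "tr \<phi> \<psi> x (R \<phi> x u v w) = R \<psi> (transition \<phi> \<psi> x) (tr \<phi> \<psi> x u) (tr \<phi> \<psi> x v) (tr \<phi> \<psi> x w)"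
proof -
  let ?x = "transition \<phi> \<psi> x" and ?A = "tr \<phi> \<psi> x" and ?D = "dtr \<phi> \<psi> x"
  let ?S = "overlap \<phi> \<psi>"
  have xU: "x \<in> U \<phi>" using x by auto
  have x': "?x \<in> U \<psi>" by (rule transition_in_U[OF c(1) x])
  note L = linear_add[OF linear_tr[OF c x]] linear_diff[OF linear_tr[OF c x]]
    linear_add[OF christoffel_linear2[OF c(2) x']]
  define E where "E h v w = frechet_derivative (\<lambda>y. dtr \<phi> \<psi> y v w) (at x) h" for h v w
  have Esym: "E h v w = E v h w" for h v w
    unfolding E_def dtr_def
    by (rule frechet_derivative_symmetric[OF open_overlap smooth_tr]) (use c x in auto)
  have der: "?D h (\<Gamma> \<phi> x v w) + ?A (d\<Gamma> \<phi> x h v w) =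
    d\<Gamma> \<psi> ?x (?A h) (?A v) (?A w) + \<Gamma> \<psi> ?x (?A v) (?D h w) + \<Gamma> \<psi> ?x (?D h v) (?A w) + E h v w" for h v w
  proof -
    have 1: "((\<lambda>y. tr \<phi> \<psi> y (\<Gamma> \<phi> y v w)) has_derivative (\<lambda>h. ?D h (\<Gamma> \<phi> x v w) + ?A (d\<Gamma> \<phi> x h v w))) (at x within ?S)"
      by (rule has_derivative_param_linear[where B = "tr \<phi> \<psi>" and B' = ?D, OF x linear_tr[OF c]
            has_derivative_at_withinI[OF tr_has_derivative[OF c x]] has_derivative_at_withinI[OF christoffel_has_derivative[OF c(1) xU]]])
    have 2: "((\<lambda>y. \<Gamma> \<psi> (transition \<phi> \<psi> y) (tr \<phi> \<psi> y v) (tr \<phi> \<psi> y w)) has_derivative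
      (\<lambda>h. d\<Gamma> \<psi> ?x (?A h) (?A v) (?A w) + \<Gamma> \<psi> ?x (?A v) (?D h w) + \<Gamma> \<psi> ?x (?D h v) (?A w))) (at x within ?S)"
    proof (rule has_derivative_param_bilinear[where B = "\<lambda>y. \<Gamma> \<psi> (transition \<phi> \<psi> y)" and B' = "\<lambda>h. d\<Gamma> \<psi> ?x (?A h)", OF x])
      show "linear (\<lambda>a. \<Gamma> \<psi> (transition \<phi> \<psi> y) a b)" "linear (\<Gamma> \<psi> (transition \<phi> \<psi> y) b)" if "y \<in> overlap \<phi> \<psi>" for y b
        by (rule christoffel_linear1[OF c(2) transition_in_U[OF c(1) that]],
            rule christoffel_linear2[OF c(2) transition_in_U[OF c(1) that]])
      show "((\<lambda>y. \<Gamma> \<psi> (transition \<phi> \<psi> y) a b) has_derivative (\<lambda>h. d\<Gamma> \<psi> ?x (?A h) a b)) (at x within ?S)" for a b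
        by (rule has_derivative_compose[OF has_derivative_at_withinI[OF transition_has_derivative[OF c x]] christoffel_has_derivative[OF c(2) x']])
    qed (rule has_derivative_at_withinI[OF tr_has_derivative[OF c x]])+
    have "((\<lambda>y. dtr \<phi> \<psi> y v w) has_derivative (\<lambda>h. E h v w)) (at x)"
      unfolding E_def dtr_def
      by (rule smooth_on_open_has_derivative[OF open_overlap smooth_on_open_derivative[OF open_overlap smooth_tr]])
        (use c x in auto)
    from has_derivative_add[OF 2 has_derivative_at_withinI[OF this]]
    have "((\<lambda>y. tr \<phi> \<psi> y (\<Gamma> \<phi> y v w)) has_derivative (\<lambda>h. d\<Gamma> \<psi> ?x (?A h) (?A v) (?A w) +
        \<Gamma> \<psi> ?x (?A v) (?D h w) + \<Gamma> \<psi> ?x (?D h v) (?A w) + E h v w)) (at x within ?S)"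
      by (rule has_derivative_transform[OF x, rotated]) (rule christoffel_transform[OF c])
    from fun_cong[OF uds_has_derivative_unique[OF open_uds[OF open_overlap[OF c]] x 1 this], of h]
    show ?thesis .
  qed
  have G: "?A (\<Gamma> \<phi> x u (\<Gamma> \<phi> x v w)) = \<Gamma> \<psi> ?x (?A u) (\<Gamma> \<psi> ?x (?A v) (?A w)) + \<Gamma> \<psi> ?x (?A u) (?D v w) + ?D u (\<Gamma> \<phi> x v w)" for u v w
    using christoffel_transform[OF c x, of u "\<Gamma> \<phi> x v w"] christoffel_transform[OF c x, of v w] by (simp add: L)
  have dA: "?A (d\<Gamma> \<phi> x h v w) = d\<Gamma> \<psi> ?x (?A h) (?A v) (?A w) + \<Gamma> \<psi> ?x (?A v) (?D h w) + \<Gamma> \<psi> ?x (?D h v) (?A w) + E h v w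
    - ?D h (\<Gamma> \<phi> x v w)" for h v w
    using der[of h v w] by (simp add: algebra_simps)
  show ?thesis
    unfolding R_def L dA G using Esym[of u v w] dtr_commute[OF c x, of u v] by simp
qed

end

section \<open>Fields along a curve\<close>

text \<open>Two distinct parameters ensure that derivatives within \<open>I\<close> are unique,
  including one-sided derivatives at end points of \<open>I\<close>.\<close>

locale riem_curve = riem_mfd M for M :: "('a, 'e::euclidean_space) riem" +
  fixes I :: "real set" and \<gamma> :: "real \<Rightarrow> 'a"
  assumes interval: "is_interval I" and nondegenerate: "\<exists>p\<in>I. \<exists>q\<in>I. p < q"
    and curve: "smooth_curve M I \<gamma>"
begin

definition w :: "real \<Rightarrow> ('a, 'e) tvec" where "w = velocity M I \<gamma>"
abbreviation x :: "('a, 'e) chart \<Rightarrow> real \<Rightarrow> 'e" where "x \<phi> t \<equiv> snd \<phi> (\<gamma> t)"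
abbreviation dom :: "('a, 'e) chart \<Rightarrow> real set" where "dom \<phi> \<equiv> {t\<in>I. \<gamma> t \<in> fst \<phi>}"

section \<open>The curve and its velocity in charts\<close>

lemma dom_openin: assumes "\<phi> \<in> Atlas M" shows "openin (top_of_set I) (dom \<phi>)"
proof -
  have "continuous_map (top_of_set I) (Top M) \<gamma>" using curve by (simp add: smooth_curve_def)
  from openin_continuous_map_preimage[OF this chart_openin[OF assms]] show ?thesis by simp
qed

lemma dom_open: assumes "\<phi> \<in> Atlas M" obtains Q where "open Q" "dom \<phi> = I \<inter> Q"
  using dom_openin[OF assms] unfolding openin_open by blast

lemma uds_I: "uds I"
proof -
  obtain p q where "p \<in> I" "q \<in> I" "p < q" using nondegenerate by blast
  then show ?thesis by (rule uds_real_interval[OF interval]) simp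
qed

lemma uds_dom: assumes "\<phi> \<in> Atlas M" shows "uds (dom \<phi>)"
  using nondegenerate uds_real_interval[OF interval _ _ _ dom_openin[OF assms]] by blast

text \<open>Components in a chart are meaningful only while the curve stays in that chart. This set
  of parameters is relatively open, so passing to it leaves derivatives unchanged.\<close>

lemma at_within_dom:
  assumes "\<phi> \<in> Atlas M" "T \<subseteq> I" "t \<in> T" "\<gamma> t \<in> fst \<phi>"
  shows "at t within (T \<inter> dom \<phi>) = at t within T"
proof -
  obtain Q where Q: "open Q" "dom \<phi> = I \<inter> Q" using dom_open[OF assms(1)] .
  have "t \<in> Q" using assms Q by blast
  then show ?thesis by (rule at_within_nhd[OF _ Q(1)]) (use assms(2) Q(2) in blast)
qed

lemma has_vector_derivative_dom_cong:
  assumes "\<phi> \<in> Atlas M" "\<psi> \<in> Atlas M" "T \<subseteq> I" "t \<in> T" "\<gamma> t \<in> fst \<phi>" "\<gamma> t \<in> fst \<psi>"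
    and eq: "\<And>s. s \<in> T \<Longrightarrow> \<gamma> s \<in> fst \<phi> \<Longrightarrow> \<gamma> s \<in> fst \<psi> \<Longrightarrow> f s = h s"
    and f: "(f has_vector_derivative D) (at t within (T \<inter> dom \<phi> \<inter> dom \<psi>))"
  shows "(h has_vector_derivative D) (at t within T)"
proof -
  have "at t within (T \<inter> dom \<phi> \<inter> dom \<psi>) = at t within (T \<inter> dom \<phi>)"
    by (rule at_within_dom) (use assms in auto)
  then have at: "at t within (T \<inter> dom \<phi> \<inter> dom \<psi>) = at t within T" using at_within_dom assms by simp
  have "(h has_vector_derivative D) (at t within (T \<inter> dom \<phi> \<inter> dom \<psi>))"
    by (rule has_vector_derivative_transform[OF _ _ f]) (use assms in auto)
  then show ?thesis using at by simp
qed

lemma smooth_x: "\<phi> \<in> Atlas M \<Longrightarrow> smooth_on (dom \<phi>) (x \<phi>)"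
  using curve by (simp add: smooth_curve_def)

lemma x_has_vector_derivative:
  assumes "\<phi> \<in> Atlas M" "t \<in> I" "\<gamma> t \<in> fst \<phi>" "T \<subseteq> I"
  shows "(x \<phi> has_vector_derivative w t \<phi>) (at t within T)"
proof -
  have at: "at t within dom \<phi> = at t within I" using at_within_dom[of \<phi> I t] assms by (simp add: Int_absorb1)
  have "(x \<phi> has_vector_derivative vector_derivative (x \<phi>) (at t within dom \<phi>)) (at t within dom \<phi>)"
    by (rule smooth_on_real_has_vector_derivative[OF uds_dom smooth_x]) (use assms in auto)
  then have "(x \<phi> has_vector_derivative w t \<phi>) (at t within I)"
    using at assms by (simp add: w_def velocity_def chart_at_def)
  then show ?thesis using assms(4) by (rule has_vector_derivative_within_subset)
qed

lemma smooth_w: assumes "\<phi> \<in> Atlas M" shows "smooth_on (dom \<phi>) (\<lambda>t. w t \<phi>)"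
proof -
  have "(x \<phi> has_vector_derivative w t \<phi>) (at t within dom \<phi>)" if "t \<in> dom \<phi>" for t
    by (rule x_has_vector_derivative) (use that assms in auto)
  from smooth_on_real_iff[OF uds_dom[OF assms] this] show ?thesis using smooth_x[OF assms] by blast
qed

lemma along_curve:
  assumes "\<phi> \<in> Atlas M" "t \<in> I" "\<gamma> t \<in> fst \<phi>" "T \<subseteq> I" and F: "(F has_derivative F') (at (x \<phi> t))"
  shows "((\<lambda>s. F (x \<phi> s)) has_vector_derivative F' (w t \<phi>)) (at t within T)"
  using has_derivative_compose[OF x_has_vector_derivative[OF assms(1-4), unfolded has_vector_derivative_def] F]
  by (simp add: has_vector_derivative_def linear_scale[OF has_derivative_linear[OF F]])

lemma x_in_U: "t \<in> dom \<phi> \<Longrightarrow> x \<phi> t \<in> U \<phi>" by auto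

lemma smooth_along:
  assumes "\<phi> \<in> Atlas M" "smooth_on (U \<phi>) F"
  shows "smooth_on (dom \<phi>) (\<lambda>s. F (x \<phi> s))"
  by (rule smooth_on_compose[OF uds_dom uds_U _ smooth_x]) (use assms in auto)

lemma w_outside: "\<not> (t \<in> I \<and> chart_at M (\<gamma> t) \<phi>) \<Longrightarrow> w t \<phi> = 0"
  unfolding w_def velocity_def by (rule if_not_P)

lemma w_tangent: assumes t: "t \<in> I" shows "w t \<in> tangent_space M (\<gamma> t)"
proof (rule tangentI)
  fix \<phi> \<psi> assume c: "\<phi> \<in> Atlas M" "\<gamma> t \<in> fst \<phi>" "\<psi> \<in> Atlas M" "\<gamma> t \<in> fst \<psi>"
  have "((\<lambda>s. transition \<phi> \<psi> (x \<phi> s)) has_vector_derivative tr \<phi> \<psi> (x \<phi> t) (w t \<phi>)) (at t within (I \<inter> dom \<phi> \<inter> dom \<psi>))"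
    by (rule along_curve[OF c(1) t c(2) _ transition_has_derivative]) (use c in auto)
  then have d1: "(x \<psi> has_vector_derivative tr \<phi> \<psi> (x \<phi> t) (w t \<phi>)) (at t within I)"
    by (rule has_vector_derivative_dom_cong[OF c(1,3) subset_refl t c(2,4), rotated]) (simp add: transition_snd[OF c(1)])
  have d2: "(x \<psi> has_vector_derivative w t \<psi>) (at t within I)"
    using x_has_vector_derivative[OF c(3) t c(4) subset_refl] .
  show "w t \<psi> = tr \<phi> \<psi> (x \<phi> t) (w t \<phi>)"
    using uds_vector_derivative[OF uds_I t d1] uds_vector_derivative[OF uds_I t d2] by simp
qed (simp add: w_outside)

subsection \<open>Covariant derivatives\<close>

text \<open>\<open>V'\<close> is the covariant derivative of \<open>V\<close> over \<open>T\<close>.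
  As a relation it passes to subsets, gluing and linear combinations without separate
  differentiability conditions. The velocity \<open>w\<close> is always that of the full interval
  \<open>I\<close>, whatever \<open>T\<close> is.\<close>

definition covd :: "real set \<Rightarrow> (real \<Rightarrow> ('a, 'e) tvec) \<Rightarrow> (real \<Rightarrow> ('a, 'e) tvec) \<Rightarrow> bool" where
  "covd T V V' \<longleftrightarrow> (\<forall>t\<in>T. V t \<in> tangent_space M (\<gamma> t) \<and> V' t \<in> tangent_space M (\<gamma> t)) \<and>
    (\<forall>\<phi>\<in>Atlas M. \<forall>t\<in>T. \<gamma> t \<in> fst \<phi> \<longrightarrow>
      ((\<lambda>s. V s \<phi>) has_vector_derivative (V' t \<phi> - \<Gamma> \<phi> (x \<phi> t) (w t \<phi>) (V t \<phi>))) (at t within T))"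

lemma covdD:
  assumes "covd T V V'" "t \<in> T"
  shows "V t \<in> tangent_space M (\<gamma> t)" "V' t \<in> tangent_space M (\<gamma> t)"
    "\<phi> \<in> Atlas M \<Longrightarrow> \<gamma> t \<in> fst \<phi> \<Longrightarrow>
      ((\<lambda>s. V s \<phi>) has_vector_derivative (V' t \<phi> - \<Gamma> \<phi> (x \<phi> t) (w t \<phi>) (V t \<phi>))) (at t within T)"
  using assms unfolding covd_def by simp_all

text \<open>Chart independence of covariant differentiation: the Hessian term from differentiating
  the transition is the one by which the Christoffel symbols fail to be tensorial.\<close>

lemma component_transform:
  assumes V: "\<And>s. s \<in> T \<Longrightarrow> V s \<in> tangent_space M (\<gamma> s)" and T: "T \<subseteq> I" "t \<in> T"
    and c: "\<phi> \<in> Atlas M" "\<gamma> t \<in> fst \<phi>" "\<psi> \<in> Atlas M" "\<gamma> t \<in> fst \<psi>"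
    and D: "((\<lambda>s. V s \<phi>) has_vector_derivative D) (at t within T)"
  shows "((\<lambda>s. V s \<psi>) has_vector_derivative (tr \<phi> \<psi> (x \<phi> t) (D + \<Gamma> \<phi> (x \<phi> t) (w t \<phi>) (V t \<phi>))
    - \<Gamma> \<psi> (x \<psi> t) (w t \<psi>) (V t \<psi>))) (at t within T)"
proof -
  have tI: "t \<in> I" using T by blast
  have ov: "x \<phi> t \<in> overlap \<phi> \<psi>" using c by auto
  let ?S = "T \<inter> dom \<phi> \<inter> dom \<psi>"
  have tS: "t \<in> ?S" using T tI c by auto
  have "((\<lambda>s. tr \<phi> \<psi> (x \<phi> s) (V s \<phi>)) has_vector_derivative
    dtr \<phi> \<psi> (x \<phi> t) (w t \<phi>) (V t \<phi>) + tr \<phi> \<psi> (x \<phi> t) D) (at t within ?S)"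
  proof (rule has_vector_derivative_param_linear[where B = "\<lambda>s. tr \<phi> \<psi> (x \<phi> s)", OF tS])
    show "linear (tr \<phi> \<psi> (x \<phi> s))" if "s \<in> ?S" for s using that c by (intro linear_tr) auto
    show "((\<lambda>s. tr \<phi> \<psi> (x \<phi> s) u) has_vector_derivative dtr \<phi> \<psi> (x \<phi> t) (w t \<phi>) u) (at t within ?S)" for u
      by (rule along_curve[OF c(1) tI c(2) _ tr_has_derivative[OF c(1,3) ov]]) auto
    show "((\<lambda>s. V s \<phi>) has_vector_derivative D) (at t within ?S)"
      by (rule has_vector_derivative_within_subset[OF D]) auto
  qed
  then have "((\<lambda>s. V s \<psi>) has_vector_derivative
    dtr \<phi> \<psi> (x \<phi> t) (w t \<phi>) (V t \<phi>) + tr \<phi> \<psi> (x \<phi> t) D) (at t within T)"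
  proof (rule has_vector_derivative_dom_cong[OF c(1,3) T c(2,4), rotated])
    fix s assume "s \<in> T" "\<gamma> s \<in> fst \<phi>" "\<gamma> s \<in> fst \<psi>"
    then show "tr \<phi> \<psi> (x \<phi> s) (V s \<phi>) = V s \<psi>" using tangent_transform[OF V c(1) _ c(3)] by simp
  qed
  moreover have "tr \<phi> \<psi> (x \<phi> t) (\<Gamma> \<phi> (x \<phi> t) (w t \<phi>) (V t \<phi>)) =
    \<Gamma> \<psi> (x \<psi> t) (w t \<psi>) (V t \<psi>) + dtr \<phi> \<psi> (x \<phi> t) (w t \<phi>) (V t \<phi>)"
    using christoffel_transform[OF c(1,3) ov, of "w t \<phi>" "V t \<phi>"] transition_snd[OF c(1,2)]
      tangent_transform[OF V[OF T(2)] c] tangent_transform[OF w_tangent[OF tI] c] by simp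
  ultimately show ?thesis by (simp add: linear_add[OF linear_tr[OF c(1,3) ov]] algebra_simps)
qed

lemma covdI:
  assumes T: "T \<subseteq> I" and V: "\<And>t. t \<in> T \<Longrightarrow> V t \<in> tangent_space M (\<gamma> t)"
    and V': "\<And>t. t \<in> T \<Longrightarrow> V' t \<in> tangent_space M (\<gamma> t)"
    and D: "\<And>t. t \<in> T \<Longrightarrow> \<exists>\<phi>\<in>Atlas M. \<gamma> t \<in> fst \<phi> \<and>
      ((\<lambda>s. V s \<phi>) has_vector_derivative (V' t \<phi> - \<Gamma> \<phi> (x \<phi> t) (w t \<phi>) (V t \<phi>))) (at t within T)"
  shows "covd T V V'"
  unfolding covd_def
proof (intro conjI ballI impI V V')
  fix \<psi> t assume c2: "\<psi> \<in> Atlas M" and t: "t \<in> T" and p2: "\<gamma> t \<in> fst \<psi>"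
  obtain \<phi> where c: "\<phi> \<in> Atlas M" "\<gamma> t \<in> fst \<phi>" and
    d: "((\<lambda>s. V s \<phi>) has_vector_derivative (V' t \<phi> - \<Gamma> \<phi> (x \<phi> t) (w t \<phi>) (V t \<phi>))) (at t within T)"
    using D[OF t] by blast
  from component_transform[OF V T t c c2 p2 d]
  show "((\<lambda>s. V s \<psi>) has_vector_derivative (V' t \<psi> - \<Gamma> \<psi> (x \<psi> t) (w t \<psi>) (V t \<psi>))) (at t within T)"
    using tangent_transform[OF V'[OF t] c c2 p2] by simp
qed

lemma covd_subset: assumes "covd T V V'" "S \<subseteq> T" shows "covd S V V'"
  unfolding covd_def
proof (intro conjI ballI impI)
  fix t assume "t \<in> S"
  then have t: "t \<in> T" using assms(2) by blast
  show "V t \<in> tangent_space M (\<gamma> t)" "V' t \<in> tangent_space M (\<gamma> t)" using covdD(1,2)[OF assms(1) t] .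
  fix \<phi> assume "\<phi> \<in> Atlas M" "\<gamma> t \<in> fst \<phi>"
  from has_vector_derivative_within_subset[OF covdD(3)[OF assms(1) t this] assms(2)]
  show "((\<lambda>s. V s \<phi>) has_vector_derivative (V' t \<phi> - \<Gamma> \<phi> (x \<phi> t) (w t \<phi>) (V t \<phi>))) (at t within S)" .
qed

lemma covd_cong:
  assumes "covd T V V'" "\<And>t. t \<in> T \<Longrightarrow> V t = W t" "\<And>t. t \<in> T \<Longrightarrow> V' t = W' t"
  shows "covd T W W'"
  unfolding covd_def
proof (intro conjI ballI impI)
  fix t assume t: "t \<in> T"
  show "W t \<in> tangent_space M (\<gamma> t)" "W' t \<in> tangent_space M (\<gamma> t)" using covdD(1,2)[OF assms(1) t] assms(2,3)[OF t] by simp_all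
  fix \<phi> assume c: "\<phi> \<in> Atlas M" "\<gamma> t \<in> fst \<phi>"
  have "((\<lambda>s. W s \<phi>) has_vector_derivative (V' t \<phi> - \<Gamma> \<phi> (x \<phi> t) (w t \<phi>) (V t \<phi>))) (at t within T)"
    by (rule has_vector_derivative_transform[OF t _ covdD(3)[OF assms(1) t c]]) (simp add: assms(2))
  then show "((\<lambda>s. W s \<phi>) has_vector_derivative (W' t \<phi> - \<Gamma> \<phi> (x \<phi> t) (w t \<phi>) (W t \<phi>))) (at t within T)"
    using assms(2,3)[OF t] by simp
qed

lemma \<gamma>_topspace: assumes "t \<in> I" shows "\<gamma> t \<in> topspace (Top M)"
  using curve assms unfolding smooth_curve_def continuous_map_def by auto

lemma chart_at_\<gamma>: assumes "t \<in> I" obtains \<phi> where "\<phi> \<in> Atlas M" "\<gamma> t \<in> fst \<phi>"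
  using chart_exists[OF \<gamma>_topspace[OF assms]] .

lemma ip_has_derivative:
  assumes V: "covd T V V'" and W: "covd T W W'" and T: "T \<subseteq> I" "t \<in> T"
  shows "((\<lambda>t. ip M (\<gamma> t) (V t) (W t)) has_vector_derivative
    (ip M (\<gamma> t) (V' t) (W t) + ip M (\<gamma> t) (V t) (W' t))) (at t within T)"
proof -
  have tI: "t \<in> I" using T by blast
  obtain \<phi> where c: "\<phi> \<in> Atlas M" "\<gamma> t \<in> fst \<phi>" using chart_at_\<gamma>[OF tI] .
  have xU: "x \<phi> t \<in> U \<phi>" using c by auto
  \<comment> \<open>The chart occurs twice in order to fit
    \<open>has_vector_derivative_dom_cong\<close>, which speaks of two charts.\<close>
  let ?S = "T \<inter> dom \<phi> \<inter> dom \<phi>"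
  have tS: "t \<in> ?S" using T tI c by auto
  have "((\<lambda>s. g \<phi> (x \<phi> s) (V s \<phi>) (W s \<phi>)) has_vector_derivative
    (dg \<phi> (x \<phi> t) (w t \<phi>) (V t \<phi>) (W t \<phi>) +
     g \<phi> (x \<phi> t) (V t \<phi>) (W' t \<phi> - \<Gamma> \<phi> (x \<phi> t) (w t \<phi>) (W t \<phi>)) +
     g \<phi> (x \<phi> t) (V' t \<phi> - \<Gamma> \<phi> (x \<phi> t) (w t \<phi>) (V t \<phi>)) (W t \<phi>))) (at t within ?S)"
  proof (rule has_vector_derivative_param_bilinear[where B = "\<lambda>s. g \<phi> (x \<phi> s)", OF tS])
    show "linear (\<lambda>a. g \<phi> (x \<phi> s) a b)" "linear (g \<phi> (x \<phi> s) b)" if "s \<in> ?S" for s b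
      using that by (auto intro!: g_linear1 g_linear2 c)
    show "((\<lambda>s. g \<phi> (x \<phi> s) a b) has_vector_derivative dg \<phi> (x \<phi> t) (w t \<phi>) a b) (at t within ?S)" for a b
      by (rule along_curve[OF c(1) tI c(2) _ g_has_derivative[OF c(1) xU]]) auto
  qed (rule has_vector_derivative_within_subset[OF covdD(3)[OF V T(2) c]], blast,
       rule has_vector_derivative_within_subset[OF covdD(3)[OF W T(2) c]], blast)
  then have "((\<lambda>s. ip M (\<gamma> s) (V s) (W s)) has_vector_derivative
    (dg \<phi> (x \<phi> t) (w t \<phi>) (V t \<phi>) (W t \<phi>) +
     g \<phi> (x \<phi> t) (V t \<phi>) (W' t \<phi> - \<Gamma> \<phi> (x \<phi> t) (w t \<phi>) (W t \<phi>)) +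
     g \<phi> (x \<phi> t) (V' t \<phi> - \<Gamma> \<phi> (x \<phi> t) (w t \<phi>) (V t \<phi>)) (W t \<phi>))) (at t within T)"
    by (rule has_vector_derivative_dom_cong[OF c(1) c(1) T c(2) c(2), rotated])
      (rule ip_coord[OF covdD(1)[OF V] covdD(1)[OF W] c(1), symmetric])
  then show ?thesis
    using ip_coord[OF covdD(2)[OF V T(2)] covdD(1)[OF W T(2)] c] ip_coord[OF covdD(1)[OF V T(2)] covdD(2)[OF W T(2)] c]
    by (simp add: metric_compatible[OF c(1) xU] linear_diff[OF g_linear1[OF c(1) xU]] linear_diff[OF g_linear2[OF c(1) xU]] algebra_simps)
qed

subsection \<open>Parallel frames\<close>

lemma smooth_christoffel_along:
  assumes "\<phi> \<in> Atlas M"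
  shows "smooth_on (dom \<phi>) (\<lambda>t. \<Gamma> \<phi> (x \<phi> t) (w t \<phi>) u)"
proof (rule smooth_on_param_linear[where B = "\<lambda>t a. \<Gamma> \<phi> (x \<phi> t) a u", OF uds_dom[OF assms]])
  show "linear (\<lambda>a. \<Gamma> \<phi> (x \<phi> t) a u)" if "t \<in> dom \<phi>" for t
    using that by (intro christoffel_linear1 assms) auto
qed (rule smooth_along[OF assms smooth_christoffel[OF assms]], rule smooth_w[OF assms])

lemma parallel_local:
  assumes st: "s \<le> t" and sub: "{s..t} \<subseteq> dom \<phi>" and c: "\<phi> \<in> Atlas M" and v: "v \<in> tangent_space M (\<gamma> s)"
  shows "\<exists>V. covd {s..t} V (\<lambda>_. 0) \<and> V s = v"
proof -
  let ?B = "\<lambda>r u. - \<Gamma> \<phi> (x \<phi> r) (w r \<phi>) u"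
  have lin: "linear (?B r)" if "r \<in> {s..t}" for r
    using christoffel_linear2[OF c, of "x \<phi> r" "w r \<phi>"] sub that by (intro linear_compose_neg) auto
  have cont: "continuous_on {s..t} (\<lambda>r. ?B r u)" for u
    by (intro continuous_on_minus continuous_on_subset[OF smooth_on_continuous[OF smooth_christoffel_along[OF c]] sub])
  obtain y where y: "y s = v \<phi>" "\<And>r. r \<in> {s..t} \<Longrightarrow> (y has_vector_derivative ?B r (y r)) (at r within {s..t})"
    using linear_ode_exists[OF st lin cont, of "v \<phi>"] by blast
  let ?V = "\<lambda>r. coord_vec M \<phi> (\<gamma> r) (y r)"
  have inp: "\<gamma> r \<in> fst \<phi>" if "r \<in> {s..t}" for r using sub that by auto
  have "covd {s..t} ?V (\<lambda>_. 0)"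
  proof (rule covdI)
    show "{s..t} \<subseteq> I" using sub by blast
    show "?V r \<in> tangent_space M (\<gamma> r)" if "r \<in> {s..t}" for r using coord_vec_tangent[OF c inp[OF that]] .
    show "0 \<in> tangent_space M (\<gamma> r)" for r by (rule tangent_zero)
    fix r assume r: "r \<in> {s..t}"
    have "((\<lambda>r. ?V r \<phi>) has_vector_derivative ?B r (y r)) (at r within {s..t})"
      by (rule has_vector_derivative_transform[OF r _ y(2)[OF r]]) (simp add: coord_vec_chart[OF c inp])
    then show "\<exists>\<phi>'\<in>Atlas M. \<gamma> r \<in> fst \<phi>' \<and> ((\<lambda>r. ?V r \<phi>') has_vector_derivative
        0 \<phi>' - \<Gamma> \<phi>' (x \<phi>' r) (w r \<phi>') (?V r \<phi>')) (at r within {s..t})"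
      using c inp[OF r] by (intro bexI[of _ \<phi>]) (simp_all add: coord_vec_chart)
  qed
  moreover have "?V s = v" using tangent_eq_coord_vec[OF v c] inp[of s] y(1) st by simp
  ultimately show ?thesis by blast
qed

text \<open>For parallel fields the derivative is a function of the value, so equal values at
  \<open>m\<close> make the one-sided derivatives agree there.\<close>

lemma parallel_glue:
  assumes 1: "covd {s..m} V1 (\<lambda>_. 0)" and 2: "covd {m..t} V2 (\<lambda>_. 0)" and eq: "V1 m = V2 m" and le: "s \<le> m" "m \<le> t"
  shows "covd {s..t} (\<lambda>r. if r \<in> {s..m} then V1 r else V2 r) (\<lambda>_. 0)"
  unfolding covd_def
proof (intro conjI ballI impI)
  let ?V = "\<lambda>r. if r \<in> {s..m} then V1 r else V2 r"
  fix r assume r: "r \<in> {s..t}"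
  show "?V r \<in> tangent_space M (\<gamma> r)" using covdD(1)[OF 1, of r] covdD(1)[OF 2, of r] r by auto
  show "0 \<in> tangent_space M (\<gamma> r)" by (rule tangent_zero)
  fix \<phi> assume c: "\<phi> \<in> Atlas M" "\<gamma> r \<in> fst \<phi>"
  let ?D = "\<lambda>V r. 0 \<phi> - \<Gamma> \<phi> (x \<phi> r) (w r \<phi>) (V r \<phi>)"
  have cl: "closure {s..m} = {s..m}" "closure {m..t} = {m..t}" by simp_all
  have un: "{s..m} \<union> {m..t} = {s..t}" "{s..m} \<union> {m} = {s..m}" "{m..t} \<union> {m} = {m..t}" "{s..m} \<inter> {m..t} = {m}" using le by auto
  have "((\<lambda>r. if r \<in> {s..m} then V1 r \<phi> else V2 r \<phi>) has_vector_derivative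
    (if r \<in> {s..m} then ?D V1 r else ?D V2 r)) (at r within {s..t})"
  proof (rule has_vector_derivative_If_within_closures[where S = "{s..m}" and T = "{m..t}"], unfold cl un)
    show "((\<lambda>r. V1 r \<phi>) has_vector_derivative ?D V1 r) (at r within {s..m})" if "r \<in> {s..m}"
      using covdD(3)[OF 1 that c] .
    show "((\<lambda>r. V2 r \<phi>) has_vector_derivative ?D V2 r) (at r within {m..t})" if "r \<in> {m..t}"
      using covdD(3)[OF 2 that c] .
    show "V1 r \<phi> = V2 r \<phi>" "?D V1 r = ?D V2 r" if "r \<in> {s..m}" "r \<in> {m..t}"
    proof -
      have "r = m" using that by simp
      then show "V1 r \<phi> = V2 r \<phi>" "?D V1 r = ?D V2 r" using eq by simp_all
    qed
  qed (use r in auto)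
  moreover have e1: "(\<lambda>s. ?V s \<phi>) = (\<lambda>r. if r \<in> {s..m} then V1 r \<phi> else V2 r \<phi>)" by (rule ext) (rule if_distrib[of "\<lambda>f. f \<phi>"])
  moreover have e2: "?D ?V r = (if r \<in> {s..m} then ?D V1 r else ?D V2 r)" by (rule if_distrib[of "\<lambda>v. 0 \<phi> - \<Gamma> \<phi> (x \<phi> r) (w r \<phi>) (v \<phi>)"])
  ultimately show "((\<lambda>s. ?V s \<phi>) has_vector_derivative ?D ?V r) (at r within {s..t})"
    unfolding e1 e2 by (simp only:)
qed

text \<open>Within one chart parallel transport is a linear equation. Bisection by
  \<open>Bolzano\<close> replaces a compactness argument: the assertion holds on all short intervals
  around a point and is additive under concatenation.\<close>

lemma parallel_exists:
  assumes ab: "a \<le> b" "{a..b} \<subseteq> I" and v: "v \<in> tangent_space M (\<gamma> a)"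
  shows "\<exists>V. covd {a..b} V (\<lambda>_. 0) \<and> V a = v"
proof -
  \<comment> \<open>The bounds stand inside the implication because \<open>Bolzano\<close> also asks
    for intervals around a point that stick out of the given one.\<close>
  define P where "P s t \<longleftrightarrow> (a \<le> s \<and> s \<le> t \<and> t \<le> b \<longrightarrow> (\<forall>v\<in>tangent_space M (\<gamma> s). \<exists>V. covd {s..t} V (\<lambda>_. 0) \<and> V s = v))" for s t
  have "P a b" using ab(1)
  proof (induction rule: Bolzano)
    case (trans s m t)
    show ?case unfolding P_def
    proof (intro impI ballI)
      fix v assume st: "a \<le> s \<and> s \<le> t \<and> t \<le> b" and v: "v \<in> tangent_space M (\<gamma> s)"
      obtain V1 where V1: "covd {s..m} V1 (\<lambda>_. 0)" "V1 s = v" using trans st v unfolding P_def by auto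
      have "V1 m \<in> tangent_space M (\<gamma> m)" using covdD(1)[OF V1(1)] trans by auto
      then obtain V2 where V2: "covd {m..t} V2 (\<lambda>_. 0)" "V2 m = V1 m" using trans st unfolding P_def by auto
      from parallel_glue[OF V1(1) V2(1) V2(2)[symmetric] trans(3,4)] V1(2) trans(3)
      show "\<exists>V. covd {s..t} V (\<lambda>_. 0) \<and> V s = v" by (intro exI[of _ "\<lambda>r. if r \<in> {s..m} then V1 r else V2 r"]) auto
    qed
  next
    case (local r)
    then have rI: "r \<in> I" using ab by auto
    obtain \<phi> where c: "\<phi> \<in> Atlas M" "\<gamma> r \<in> fst \<phi>" using chart_at_\<gamma>[OF rI] .
    obtain Q where Q: "open Q" "dom \<phi> = I \<inter> Q" using dom_open[OF c(1)] .
    have "r \<in> Q" using Q c rI by auto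
    then obtain d where d: "d > 0" "ball r d \<subseteq> Q" using Q(1) openE by blast
    show ?case
    proof (intro exI[of _ d] conjI d allI impI)
      fix s t assume st: "s \<le> r \<and> r \<le> t \<and> t - s < d"
      show "P s t" unfolding P_def
      proof (intro impI ballI)
        fix v assume le: "a \<le> s \<and> s \<le> t \<and> t \<le> b" and v: "v \<in> tangent_space M (\<gamma> s)"
        have "{s..t} \<subseteq> I \<inter> ball r d" using le ab st by (auto simp: dist_real_def)
        then have "{s..t} \<subseteq> dom \<phi>" using Q d by blast
        then show "\<exists>V. covd {s..t} V (\<lambda>_. 0) \<and> V s = v" using parallel_local le v c by blast
      qed
    qed
  qed
  then show ?thesis using ab v unfolding P_def by auto
qed

lemma covd_zero_sum:
  assumes "T \<subseteq> I" "\<And>i. i \<in> B \<Longrightarrow> covd T (V i) (\<lambda>_. 0)"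
  shows "covd T (\<lambda>t \<phi>. \<Sum>i\<in>B. c i *\<^sub>R V i t \<phi>) (\<lambda>_. 0)"
proof -
  have sum_eq: "(\<lambda>\<phi>. \<Sum>i\<in>B. c i *\<^sub>R V i t \<phi>) = (\<Sum>i\<in>B. c i *\<^sub>R V i t)" for t
    by (induction B rule: infinite_finite_induct) (auto simp: scaleR_fun_def fun_eq_iff)
  have tan: "(\<lambda>\<phi>. \<Sum>i\<in>B. c i *\<^sub>R V i t \<phi>) \<in> tangent_space M (\<gamma> t)" if "t \<in> T" for t
    unfolding sum_eq using assms(2) 
  proof (induction B rule: infinite_finite_induct)
    case (insert i B)
    show ?case unfolding sum.insert[OF insert.hyps(1,2)]
      by (intro tangent_add tangent_scale insert.IH covdD(1)[OF insert.prems that]) (use insert.prems in auto)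
  qed (simp_all add: tangent_zero)
  show ?thesis unfolding covd_def
  proof (intro conjI ballI impI tan tangent_zero)
    fix \<phi> t assume c: "\<phi> \<in> Atlas M" and t: "t \<in> T" and p: "\<gamma> t \<in> fst \<phi>"
    have lin: "linear (\<Gamma> \<phi> (x \<phi> t) (w t \<phi>))" using p by (intro christoffel_linear2 c) auto
    have "((\<lambda>s. \<Sum>i\<in>B. c i *\<^sub>R V i s \<phi>) has_vector_derivative
      (\<Sum>i\<in>B. c i *\<^sub>R (0 \<phi> - \<Gamma> \<phi> (x \<phi> t) (w t \<phi>) (V i t \<phi>)))) (at t within T)"
      by (intro has_vector_derivative_sum bounded_linear.has_vector_derivative[OF bounded_linear_scaleR_right] covdD(3)[OF assms(2) t c p])
    then show "((\<lambda>s. \<Sum>i\<in>B. c i *\<^sub>R V i s \<phi>) has_vector_derivative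
      0 \<phi> - \<Gamma> \<phi> (x \<phi> t) (w t \<phi>) (\<Sum>i\<in>B. c i *\<^sub>R V i t \<phi>)) (at t within T)"
      by (simp add: linear_sum[OF lin] linear_scale[OF lin] sum_negf)
  qed
qed

end

context riem_curve
begin

lemma ip_zero: assumes "t \<in> I" "v \<in> tangent_space M (\<gamma> t)" shows "ip M (\<gamma> t) 0 v = 0" "ip M (\<gamma> t) v 0 = 0"
  using ip_props(3)[OF \<gamma>_topspace[OF assms(1)] tangent_zero assms(2), of 0]
    ip_props(1)[OF \<gamma>_topspace[OF assms(1)] tangent_zero assms(2)]
  by (simp_all add: scaleR_fun_def zero_fun_def)

text \<open>\<open>P t\<close> identifies the model space with the tangent space at the curve point,
  the image of each fixed vector being parallel; \<open>q\<close> is the metric seen through this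
  identification and does not depend on \<open>t\<close>. The last clause records that
  \<open>q\<close> is the metric at some point of a chart, and so an inner product.\<close>

definition frame :: "real \<Rightarrow> real \<Rightarrow> (real \<Rightarrow> 'e \<Rightarrow> ('a, 'e) tvec) \<Rightarrow> ('e \<Rightarrow> 'e \<Rightarrow> real) \<Rightarrow> bool" where
  "frame a b P q \<longleftrightarrow> a < b \<and> {a..b} \<subseteq> I \<and> (\<forall>u. covd {a..b} (\<lambda>t. P t u) (\<lambda>_. 0)) \<and>
    (\<forall>t \<phi>. linear (\<lambda>u. P t u \<phi>)) \<and>
    (\<forall>t\<in>{a..b}. \<forall>u v. ip M (\<gamma> t) (P t u) (P t v) = q u v) \<and>
    (\<exists>\<phi> y. \<phi> \<in> Atlas M \<and> y \<in> U \<phi> \<and> q = g \<phi> y)"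

text \<open>Basis vectors at the left end are transported in parallel. Inner products of parallel
  fields are constant, so \<open>q\<close> can be read off at \<open>a\<close>.\<close>

lemma frame_exists:
  assumes ab: "a < b" "{a..b} \<subseteq> I"
  shows "\<exists>P q. frame a b P q"
proof -
  have aI: "a \<in> I" using ab by auto
  obtain \<phi> where c: "\<phi> \<in> Atlas M" "\<gamma> a \<in> fst \<phi>" using chart_at_\<gamma>[OF aI] .
  have "\<exists>V. covd {a..b} V (\<lambda>_. 0) \<and> V a = coord_vec M \<phi> (\<gamma> a) i" for i
    by (rule parallel_exists) (use ab coord_vec_tangent[OF c] in auto)
  then obtain V where V: "\<And>i. covd {a..b} (V i) (\<lambda>_. 0)" "\<And>i. V i a = coord_vec M \<phi> (\<gamma> a) i" by metis
  define P where "P t u = (\<lambda>\<psi>. \<Sum>i\<in>Basis. (u \<bullet> i) *\<^sub>R V i t \<psi>)" for t u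
  have P: "covd {a..b} (\<lambda>t. P t u) (\<lambda>_. 0)" for u
    unfolding P_def by (rule covd_zero_sum[OF ab(2) V(1)])
  have lin: "linear (\<lambda>u. P t u \<psi>)" for t \<psi>
    unfolding P_def by (intro linearI) (simp_all add: inner_add_left scaleR_add_left sum.distrib scaleR_sum_right)
  have aab: "a \<in> {a..b}" using ab by simp
  have const: "ip M (\<gamma> t) (P t u) (P t v) = g \<phi> (x \<phi> a) u v" if t: "t \<in> {a..b}" for t u v
  proof -
    have tI: "s \<in> I" if "s \<in> {a..b}" for s using that ab by blast
    have "((\<lambda>t. ip M (\<gamma> t) (P t u) (P t v)) has_vector_derivative 0) (at s within {a..b})" if s: "s \<in> {a..b}" for s
    proof -
      show ?thesis using ip_has_derivative[OF P P ab(2) s, of u v] ip_zero[OF tI[OF s] covdD(1)[OF P s]] by simp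
    qed
    then obtain k where k: "\<And>s. s \<in> {a..b} \<Longrightarrow> ip M (\<gamma> s) (P s u) (P s v) = k"
      using has_vector_derivative_zero_constant[of "{a..b}" "\<lambda>t. ip M (\<gamma> t) (P t u) (P t v)"] by auto
    have Pa: "P a u \<phi> = u" for u
      unfolding P_def V(2) coord_vec_chart[OF c] by (rule euclidean_representation)
    have "ip M (\<gamma> a) (P a u) (P a v) = g \<phi> (x \<phi> a) u v"
      using ip_coord[OF covdD(1)[OF P aab] covdD(1)[OF P aab] c] by (simp add: Pa)
    then show ?thesis using k[OF t] k[OF aab] by simp
  qed
  have "x \<phi> a \<in> U \<phi>" using c by auto
  then have "frame a b P (g \<phi> (x \<phi> a))" unfolding frame_def using ab P lin const c by blast
  then show ?thesis by blast
qed

lemma frameD: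
  assumes "frame a b P q"
  shows "a < b" "{a..b} \<subseteq> I" "\<And>u. covd {a..b} (\<lambda>t. P t u) (\<lambda>_. 0)" "\<And>t \<phi>. linear (\<lambda>u. P t u \<phi>)"
    "\<And>t u v. t \<in> {a..b} \<Longrightarrow> ip M (\<gamma> t) (P t u) (P t v) = q u v"
    "\<And>t. t \<in> {a..b} \<Longrightarrow> t \<in> I"
  using assms unfolding frame_def by auto

lemma frame_inner:
  assumes "frame a b P q"
  shows "\<And>v. linear (\<lambda>u. q u v)" "\<And>u. linear (q u)" "\<And>u. u \<noteq> 0 \<Longrightarrow> q u u > 0"
proof -
  obtain \<phi> y where c: "\<phi> \<in> Atlas M" "y \<in> U \<phi>" and q: "q = g \<phi> y" using assms unfolding frame_def by blast
  show "\<And>v. linear (\<lambda>u. q u v)" "\<And>u. linear (q u)" "\<And>u. u \<noteq> 0 \<Longrightarrow> q u u > 0"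
    unfolding q by (rule g_linear1[OF c], rule g_linear2[OF c], rule g_pos[OF c])
qed

lemma frame_tangent: "frame a b P q \<Longrightarrow> t \<in> {a..b} \<Longrightarrow> P t u \<in> tangent_space M (\<gamma> t)"
  using covdD(1)[OF frameD(3)] .

lemma frame_inj:
  assumes F: "frame a b P q" and t: "t \<in> {a..b}" and c: "\<phi> \<in> Atlas M" "\<gamma> t \<in> fst \<phi>"
  shows "inj (\<lambda>u. P t u \<phi>)"
  unfolding linear_injective_0[OF frameD(4)[OF F]]
proof (intro allI impI)
  fix u assume 0: "P t u \<phi> = 0"
  have xU: "x \<phi> t \<in> U \<phi>" using c by auto
  have "q u u = 0"
    using frameD(5)[OF F t, of u u] ip_coord[OF frame_tangent[OF F t] frame_tangent[OF F t] c, of u u] 0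
      linear_0[OF g_linear1[OF c(1) xU]] by simp
  then show "u = 0" using frame_inner(3)[OF F, of u] by fastforce
qed

lemma frame_cancel:
  assumes F: "frame a b P q" and t: "t \<in> {a..b}" and eq: "P t u = P t v"
  shows "u = v"
proof -
  obtain \<phi> where c: "\<phi> \<in> Atlas M" "\<gamma> t \<in> fst \<phi>" using chart_at_\<gamma>[OF frameD(6)[OF F t]] .
  show ?thesis using injD[OF frame_inj[OF F t c], of u v] eq by simp
qed

lemma frame_surj:
  assumes F: "frame a b P q" and t: "t \<in> {a..b}" and v: "v \<in> tangent_space M (\<gamma> t)"
  shows "\<exists>u. P t u = v"
proof -
  obtain \<phi> where c: "\<phi> \<in> Atlas M" "\<gamma> t \<in> fst \<phi>" using chart_at_\<gamma>[OF frameD(6)[OF F t]] .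
  obtain u where "v \<phi> = P t u \<phi>"
    using surjD[OF linear_injective_imp_surjective[OF frameD(4)[OF F] frame_inj[OF F t c]], of "v \<phi>"] by blast
  then have "P t u = v" using tangent_eqI[OF frame_tangent[OF F t] v c] by simp
  then show ?thesis ..
qed

lemma frame_covd:
  assumes F: "frame a b P q" and y: "\<And>t. t \<in> {a..b} \<Longrightarrow> (y has_vector_derivative y' t) (at t within {a..b})"
  shows "covd {a..b} (\<lambda>t. P t (y t)) (\<lambda>t. P t (y' t))"
  unfolding covd_def
proof (intro conjI ballI impI frame_tangent[OF F])
  fix \<phi> t assume c: "\<phi> \<in> Atlas M" and t: "t \<in> {a..b}" and p: "\<gamma> t \<in> fst \<phi>"
  have Pu: "((\<lambda>s. P s u \<phi>) has_vector_derivative (0 \<phi> - \<Gamma> \<phi> (x \<phi> t) (w t \<phi>) (P t u \<phi>))) (at t within {a..b})" for u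
    using covdD(3)[OF frameD(3)[OF F] t c p] .
  have "((\<lambda>s. P s (y s) \<phi>) has_vector_derivative
    ((0 \<phi> - \<Gamma> \<phi> (x \<phi> t) (w t \<phi>) (P t (y t) \<phi>)) + P t (y' t) \<phi>)) (at t within {a..b})"
    by (rule has_vector_derivative_param_linear[where B = "\<lambda>s u. P s u \<phi>" and B' = "\<lambda>u. 0 \<phi> - \<Gamma> \<phi> (x \<phi> t) (w t \<phi>) (P t u \<phi>)",
          OF t frameD(4)[OF F] Pu y[OF t]])
  then show "((\<lambda>s. P s (y s) \<phi>) has_vector_derivative
    (P t (y' t) \<phi> - \<Gamma> \<phi> (x \<phi> t) (w t \<phi>) (P t (y t) \<phi>))) (at t within {a..b})" by simp
qed

text \<open>The component function solves a linear system whose matrix is the frame in a chart,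
  hence is differentiable. The Christoffel terms of the frame and of the field then cancel, leaving
  the ordinary derivative.\<close>

lemma frame_components:
  assumes F: "frame a b P q" and V: "covd {a..b} V V'"
  shows "\<exists>y y'. \<forall>t\<in>{a..b}. V t = P t (y t) \<and> V' t = P t (y' t) \<and> (y has_vector_derivative y' t) (at t within {a..b})"
proof -
  have "\<exists>u. t \<in> {a..b} \<longrightarrow> P t u = V t" "\<exists>u. t \<in> {a..b} \<longrightarrow> P t u = V' t" for t
    using frame_surj[OF F _ covdD(1)[OF V]] frame_surj[OF F _ covdD(2)[OF V]] by blast+
  then obtain y y' where y: "\<And>t. t \<in> {a..b} \<Longrightarrow> P t (y t) = V t" and y': "\<And>t. t \<in> {a..b} \<Longrightarrow> P t (y' t) = V' t" by metis
  have "(y has_vector_derivative y' t) (at t within {a..b})" if t: "t \<in> {a..b}" for t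
  proof -
    obtain \<phi> where c: "\<phi> \<in> Atlas M" "\<gamma> t \<in> fst \<phi>" using chart_at_\<gamma>[OF frameD(6)[OF F t]] .
    let ?G = "\<Gamma> \<phi> (x \<phi> t) (w t \<phi>)"
    have lin: "linear ?G" using c by (intro christoffel_linear2) auto
    have A: "((\<lambda>s. P s u \<phi>) has_derivative (\<lambda>h. h *\<^sub>R (0 \<phi> - ?G (P t u \<phi>)))) (at t within {a..b})" for u
      using covdD(3)[OF frameD(3)[OF F] t c] unfolding has_vector_derivative_def .
    have FV: "((\<lambda>s. V s \<phi>) has_derivative (\<lambda>h. h *\<^sub>R (V' t \<phi> - ?G (V t \<phi>)))) (at t within {a..b})"
      using covdD(3)[OF V t c] unfolding has_vector_derivative_def .
    have "\<exists>h'. (y has_derivative h') (at t within {a..b}) \<and> (\<forall>v. P t (h' v) \<phi> =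
      v *\<^sub>R (V' t \<phi> - ?G (V t \<phi>)) - (\<Sum>i\<in>Basis. (y t \<bullet> i) *\<^sub>R (v *\<^sub>R (0 \<phi> - ?G (P t i \<phi>)))))"
      by (rule linear_system_differentiable[where A = "\<lambda>s u. P s u \<phi>" and A' = "\<lambda>h u. h *\<^sub>R (0 \<phi> - ?G (P t u \<phi>))"
          and F = "\<lambda>s. V s \<phi>" and F' = "\<lambda>h. h *\<^sub>R (V' t \<phi> - ?G (V t \<phi>))", OF t frameD(4)[OF F] frame_inj[OF F t c] A FV])
        (simp add: y)
    then obtain h' where h': "(y has_derivative h') (at t within {a..b})" and
      eq: "P t (h' v) \<phi> = v *\<^sub>R (V' t \<phi> - ?G (V t \<phi>)) - (\<Sum>i\<in>Basis. (y t \<bullet> i) *\<^sub>R (v *\<^sub>R (0 \<phi> - ?G (P t i \<phi>))))" for v by blast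
    have G: "?G (V t \<phi>) = (\<Sum>i\<in>Basis. (y t \<bullet> i) *\<^sub>R ?G (P t i \<phi>))"
      using linear_sum_Basis[OF linear_compose[OF frameD(4)[OF F, of t \<phi>] lin], of "y t"] y[OF t] by (simp add: o_def)
    have "P t (h' 1) \<phi> = V' t \<phi>" using eq[of 1] unfolding G by (simp add: sum_negf)
    then have "P t (h' 1) \<phi> = P t (y' t) \<phi>" using y'[OF t] by simp
    then have "h' 1 = y' t" using injD[OF frame_inj[OF F t c]] by blast
    then have "h' v = v *\<^sub>R y' t" for v
      using linear_scale[OF has_derivative_linear[OF h'], of v 1] by simp
    then show ?thesis using h' unfolding has_vector_derivative_def by (metis (no_types, lifting) ext)
  qed
  then show ?thesis using y y' by (intro exI[of _ y] exI[of _ y']) auto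
qed

subsection \<open>The Jacobi equation\<close>

definition Rop :: "real \<Rightarrow> ('a, 'e) tvec \<Rightarrow> ('a, 'e) tvec" where
  "Rop t v = curvature M (\<gamma> t) v (w t) (w t)"

lemma Rop_chart: "\<phi> \<in> Atlas M \<Longrightarrow> \<gamma> t \<in> fst \<phi> \<Longrightarrow> Rop t v \<phi> = R \<phi> (x \<phi> t) (v \<phi>) (w t \<phi>) (w t \<phi>)"
  by (simp add: Rop_def curvature_def chart_at_def)

lemma Rop_tangent: assumes t: "t \<in> I" and v: "v \<in> tangent_space M (\<gamma> t)" shows "Rop t v \<in> tangent_space M (\<gamma> t)"
proof (rule tangentI)
  fix \<phi> \<psi> assume c: "\<phi> \<in> Atlas M" "\<gamma> t \<in> fst \<phi>" "\<psi> \<in> Atlas M" "\<gamma> t \<in> fst \<psi>"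
  have ov: "x \<phi> t \<in> overlap \<phi> \<psi>" using c by auto
  show "Rop t v \<psi> = tr \<phi> \<psi> (x \<phi> t) (Rop t v \<phi>)"
    using R_transform[OF c(1,3) ov, of "v \<phi>" "w t \<phi>" "w t \<phi>"] c transition_snd[OF c(1,2)]
      tangent_transform[OF v c] tangent_transform[OF w_tangent[OF t] c] by (simp add: Rop_chart)
qed (simp add: Rop_def curvature_def)

lemma Rop_symmetric:
  assumes t: "t \<in> I" and u: "u \<in> tangent_space M (\<gamma> t)" and v: "v \<in> tangent_space M (\<gamma> t)"
  shows "ip M (\<gamma> t) (Rop t u) v = ip M (\<gamma> t) u (Rop t v)"
proof -
  obtain \<phi> where c: "\<phi> \<in> Atlas M" "\<gamma> t \<in> fst \<phi>" using chart_at_\<gamma>[OF t] .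
  have xU: "x \<phi> t \<in> U \<phi>" using c by auto
  show ?thesis using ip_coord[OF Rop_tangent[OF t u] v c] ip_coord[OF u Rop_tangent[OF t v] c]
    by (simp add: Rop_chart[OF c] g_R_symmetric[OF c(1) xU])
qed

text \<open>The Jacobi equation as a first-order system with the covariant derivative carried along,
  so that restriction and linear combinations act on the pair.\<close>

definition jac :: "real set \<Rightarrow> (real \<Rightarrow> ('a, 'e) tvec) \<Rightarrow> (real \<Rightarrow> ('a, 'e) tvec) \<Rightarrow> bool" where
  "jac T J J' \<longleftrightarrow> covd T J J' \<and> covd T J' (\<lambda>t. - Rop t (J t))"

lemma uds_sub:
  assumes ab: "a < b" "{a..b} \<subseteq> I" and c: "\<phi> \<in> Atlas M"
  shows "uds ({a..b} \<inter> dom \<phi>)"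
proof -
  obtain Q where Q: "open Q" "dom \<phi> = I \<inter> Q" using dom_open[OF c] .
  have "{a..b} \<inter> dom \<phi> = {a..b} \<inter> Q" using Q ab by blast
  then have "openin (top_of_set {a..b}) ({a..b} \<inter> dom \<phi>)" using Q by (auto simp: openin_open)
  then show ?thesis by (intro uds_real_interval[of "{a..b}" a b]) (use ab in auto)
qed

lemma smooth_frame:
  assumes F: "frame a b P q" and c: "\<phi> \<in> Atlas M"
  shows "smooth_on ({a..b} \<inter> dom \<phi>) (\<lambda>t. P t u \<phi>)"
proof (rule smooth_on_linear_ode[OF uds_sub[OF frameD(1,2)[OF F] c]])
  let ?S = "{a..b} \<inter> dom \<phi>"
  let ?B = "\<lambda>t u. - \<Gamma> \<phi> (x \<phi> t) (w t \<phi>) u"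
  show "linear (?B t)" if "t \<in> ?S" for t
    using christoffel_linear2[OF c, of "x \<phi> t" "w t \<phi>"] that by (intro linear_compose_neg) auto
  have sub: "?S \<subseteq> dom \<phi>" by blast
  show "smooth_on ?S (\<lambda>t. ?B t u)" for u
    by (intro smooth_on_minus uds_sub frameD(1,2)[OF F] c
        smooth_on_subset[OF uds_dom[OF c] uds_sub[OF frameD(1,2)[OF F] c] sub smooth_christoffel_along[OF c]])
  show "((\<lambda>t. P t u \<phi>) has_vector_derivative ?B t (P t u \<phi>)) (at t within ?S)" if "t \<in> ?S" for t
    using has_vector_derivative_within_subset[OF covdD(3)[OF frameD(3)[OF F], of t \<phi> u], of ?S] that c by simp
qed

text \<open>In the frame the Jacobi operator becomes a family of endomorphisms of one space,
  self-adjoint for the fixed \<open>q\<close>. Continuity on the whole interval serves existence of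
  solutions; smoothness on each chart serves smoothness of the resulting fields.\<close>

lemma frame_curvature:
  assumes F: "frame a b P q"
  shows "\<exists>Rh. (\<forall>t\<in>{a..b}. linear (Rh t)) \<and> (\<forall>t\<in>{a..b}. \<forall>u. P t (Rh t u) = Rop t (P t u)) \<and>
    (\<forall>t\<in>{a..b}. \<forall>u v. q (Rh t u) v = q u (Rh t v)) \<and> (\<forall>u. continuous_on {a..b} (\<lambda>t. Rh t u)) \<and>
    (\<forall>u. \<forall>\<phi>\<in>Atlas M. smooth_on ({a..b} \<inter> dom \<phi>) (\<lambda>t. Rh t u))"
proof -
  have "\<exists>v. t \<in> {a..b} \<longrightarrow> P t v = Rop t (P t u)" for t u
    using frame_surj[OF F _ Rop_tangent[OF frameD(6)[OF F] frame_tangent[OF F]]] by blast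
  then obtain Rh where Rh: "\<And>t u. t \<in> {a..b} \<Longrightarrow> P t (Rh t u) = Rop t (P t u)" by metis
  have lin: "linear (Rh t)" if t: "t \<in> {a..b}" for t
  proof -
    obtain \<phi> where c: "\<phi> \<in> Atlas M" "\<gamma> t \<in> fst \<phi>" using chart_at_\<gamma>[OF frameD(6)[OF F t]] .
    have xU: "x \<phi> t \<in> U \<phi>" using c by auto
    note L = frameD(4)[OF F, of t \<phi>] and i = injD[OF frame_inj[OF F t c]] and RL = R_linear(1)[OF c(1) xU, of "w t \<phi>" "w t \<phi>"]
    have RhC: "P t (Rh t u) \<phi> = R \<phi> (x \<phi> t) (P t u \<phi>) (w t \<phi>) (w t \<phi>)" for u
      using Rh[OF t, of u] Rop_chart[OF c] by simp
    show ?thesis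
    proof (rule linearI)
      show "Rh t (u + v) = Rh t u + Rh t v" for u v
        by (rule i) (simp add: RhC linear_add[OF L] linear_add[OF RL])
      show "Rh t (r *\<^sub>R u) = r *\<^sub>R Rh t u" for r u
        by (rule i) (simp add: RhC linear_scale[OF L] linear_scale[OF RL])
    qed
  qed
  have sym: "q (Rh t u) v = q u (Rh t v)" if t: "t \<in> {a..b}" for t u v
    using Rop_symmetric[OF frameD(6)[OF F t] frame_tangent[OF F t, of u] frame_tangent[OF F t, of v]]
    by (simp add: frameD(5)[OF F t, symmetric] Rh[OF t])
  have sm: "smooth_on ({a..b} \<inter> dom \<phi>) (\<lambda>t. Rh t u)" if c: "\<phi> \<in> Atlas M" for \<phi> u
  proof (rule smooth_on_linear_system[where A = "\<lambda>t u. P t u \<phi>", OF uds_sub[OF frameD(1,2)[OF F] c] frameD(4)[OF F]])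
    let ?S = "{a..b} \<inter> dom \<phi>"
    have sub: "?S \<subseteq> dom \<phi>" by blast
    note u = uds_sub[OF frameD(1,2)[OF F] c]
    have sub_smooth: "smooth_on ?S f" if "smooth_on (dom \<phi>) f" for f :: "real \<Rightarrow> 'e"
      by (rule smooth_on_subset[OF uds_dom[OF c] u sub that])
    show "inj (\<lambda>u. P t u \<phi>)" if "t \<in> ?S" for t using frame_inj[OF F _ c] that by simp
    show "smooth_on ?S (\<lambda>t. P t u \<phi>)" for u by (rule smooth_frame[OF F c])
    have RU: "x \<phi> t \<in> U \<phi>" if "t \<in> ?S" for t using that by auto
    have 0: "smooth_on ?S (\<lambda>t. R \<phi> (x \<phi> t) v' a b)" for v' a b
      by (rule sub_smooth, rule smooth_along[OF c smooth_R[OF c]])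
    have 1: "smooth_on ?S (\<lambda>t. R \<phi> (x \<phi> t) v' (w t \<phi>) b)" for v' b
      by (rule smooth_on_param_linear[where B = "\<lambda>t a. R \<phi> (x \<phi> t) v' a b", OF u R_linear(2)[OF c RU] 0 sub_smooth[OF smooth_w[OF c]]])
    have 2: "smooth_on ?S (\<lambda>t. R \<phi> (x \<phi> t) v' (w t \<phi>) (w t \<phi>))" for v'
      by (rule smooth_on_param_linear[where B = "\<lambda>t b. R \<phi> (x \<phi> t) v' (w t \<phi>) b", OF u R_linear(3)[OF c RU] 1 sub_smooth[OF smooth_w[OF c]]])
    show "smooth_on ?S (\<lambda>t. R \<phi> (x \<phi> t) (P t u \<phi>) (w t \<phi>) (w t \<phi>))"
      by (rule smooth_on_param_linear[where B = "\<lambda>t v'. R \<phi> (x \<phi> t) v' (w t \<phi>) (w t \<phi>)", OF u R_linear(1)[OF c RU] 2 smooth_frame[OF F c]])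
    show "P t (Rh t u) \<phi> = R \<phi> (x \<phi> t) (P t u \<phi>) (w t \<phi>) (w t \<phi>)" if "t \<in> ?S" for t
      using that Rh[of t u] Rop_chart[OF c] by simp
  qed
  have cont: "continuous_on {a..b} (\<lambda>t. Rh t u)" for u
    unfolding continuous_on_eq_continuous_within
  proof
    fix t assume t: "t \<in> {a..b}"
    obtain \<phi> where c: "\<phi> \<in> Atlas M" "\<gamma> t \<in> fst \<phi>" using chart_at_\<gamma>[OF frameD(6)[OF F t]] .
    have "t \<in> {a..b} \<inter> dom \<phi>" using t c frameD(6)[OF F t] by simp
    then have "continuous (at t within ({a..b} \<inter> dom \<phi>)) (\<lambda>t. Rh t u)"
      using smooth_on_continuous[OF sm[OF c(1), of u]] unfolding continuous_on_eq_continuous_within by blast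
    then show "continuous (at t within {a..b}) (\<lambda>t. Rh t u)"
      unfolding at_within_dom[OF c(1) frameD(2)[OF F] t c(2)] .
  qed
  show ?thesis
    by (rule exI[of _ Rh]) (intro conjI ballI allI lin sym sm cont Rh)
qed

lemma jac_components:
  assumes F: "frame a b P q" and Rh: "\<And>t u. t \<in> {a..b} \<Longrightarrow> P t (Rh t u) = Rop t (P t u)"
    and J: "jac {a..b} J J'"
  shows "\<exists>y z. \<forall>t\<in>{a..b}. J t = P t (y t) \<and> J' t = P t (z t) \<and>
    (y has_vector_derivative z t) (at t within {a..b}) \<and> (z has_vector_derivative - Rh t (y t)) (at t within {a..b})"
proof -
  obtain y z where y: "\<And>t. t \<in> {a..b} \<Longrightarrow> J t = P t (y t)" "\<And>t. t \<in> {a..b} \<Longrightarrow> J' t = P t (z t)"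
    "\<And>t. t \<in> {a..b} \<Longrightarrow> (y has_vector_derivative z t) (at t within {a..b})"
    using frame_components[OF F, of J J'] J unfolding jac_def by blast
  obtain z2 u where z: "\<And>t. t \<in> {a..b} \<Longrightarrow> J' t = P t (z2 t)" "\<And>t. t \<in> {a..b} \<Longrightarrow> - Rop t (J t) = P t (u t)"
    "\<And>t. t \<in> {a..b} \<Longrightarrow> (z2 has_vector_derivative u t) (at t within {a..b})"
    using frame_components[OF F, of J' "\<lambda>t. - Rop t (J t)"] J unfolding jac_def by blast
  have zz: "z2 t = z t" if "t \<in> {a..b}" for t
    using frame_cancel[OF F that, of "z2 t" "z t"] y(2)[OF that] z(1)[OF that] by simp
  have uu: "u t = - Rh t (y t)" if t: "t \<in> {a..b}" for t
  proof (rule frame_cancel[OF F t])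
    have "P t (- v) = - P t v" for v
      using linear_neg[OF frameD(4)[OF F, of t]] by (simp add: fun_eq_iff)
    then show "P t (u t) = P t (- Rh t (y t))" using z(2)[OF t] y(1)[OF t] Rh[OF t] by simp
  qed
  have "(z has_vector_derivative - Rh t (y t)) (at t within {a..b})" if t: "t \<in> {a..b}" for t
    by (rule has_vector_derivative_transform[OF t _ z(3)[OF t, unfolded uu[OF t]]]) (simp add: zz)
  then show ?thesis using y by blast
qed

lemma jac_from_components:
  assumes F: "frame a b P q" and Rh: "\<And>t u. t \<in> {a..b} \<Longrightarrow> P t (Rh t u) = Rop t (P t u)"
    and y: "\<And>t. t \<in> {a..b} \<Longrightarrow> (y has_vector_derivative z t) (at t within {a..b})"
    and z: "\<And>t. t \<in> {a..b} \<Longrightarrow> (z has_vector_derivative - Rh t (y t)) (at t within {a..b})"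
  shows "jac {a..b} (\<lambda>t. P t (y t)) (\<lambda>t. P t (z t))"
proof -
  have "P t (- v) = - P t v" for t v
    using linear_neg[OF frameD(4)[OF F, of t]] by (simp add: fun_eq_iff)
  then have "covd {a..b} (\<lambda>t. P t (z t)) (\<lambda>t. - Rop t (P t (y t)))"
    by (intro covd_cong[OF frame_covd[OF F z]]) (simp_all add: Rh)
  then show ?thesis unfolding jac_def using frame_covd[OF F y] by blast
qed

text \<open>\<open>field_along\<close> demands smooth components of a Jacobi field, whereas the
  equation gives only derivatives of \<open>y\<close> and \<open>z\<close>. The pair solves a smooth
  linear first-order system.\<close>

lemma jac_smooth:
  assumes F: "frame a b P q" and c: "\<phi> \<in> Atlas M"
    and lin: "\<And>t. t \<in> {a..b} \<Longrightarrow> linear (Rh t)"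
    and sm: "\<And>u. smooth_on ({a..b} \<inter> dom \<phi>) (\<lambda>t. Rh t u)"
    and y: "\<And>t. t \<in> {a..b} \<Longrightarrow> (y has_vector_derivative z t) (at t within {a..b})"
    and z: "\<And>t. t \<in> {a..b} \<Longrightarrow> (z has_vector_derivative - Rh t (y t)) (at t within {a..b})"
  shows "smooth_on ({a..b} \<inter> dom \<phi>) (\<lambda>t. P t (y t) \<phi>)"
proof -
  let ?S = "{a..b} \<inter> dom \<phi>"
  note u = uds_sub[OF frameD(1,2)[OF F] c]
  let ?B = "\<lambda>t p. (snd p, - Rh t (fst p))"
  have "smooth_on ?S (\<lambda>t. (y t, z t))"
  proof (rule smooth_on_linear_ode[where B = ?B, OF u])
    show "linear (?B t)" if "t \<in> ?S" for t
      using lin[of t] that by (intro linearI) (simp_all add: linear_add linear_scale)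
    show "smooth_on ?S (\<lambda>t. ?B t p)" for p
    proof -
      have "smooth_on ?S (\<lambda>t. (snd p, 0) + (\<lambda>v. (0, v)) (- Rh t (fst p)))"
        by (intro smooth_on_add u smooth_on_const smooth_on_bounded_linear[where h = "\<lambda>v. (0, v)"] smooth_on_minus sm
            bounded_linear_Pair bounded_linear_zero bounded_linear_ident)
      then show ?thesis by simp
    qed
    show "((\<lambda>t. (y t, z t)) has_vector_derivative ?B t (y t, z t)) (at t within ?S)" if "t \<in> ?S" for t
      using has_vector_derivative_within_subset[OF y, of t ?S] has_vector_derivative_within_subset[OF z, of t ?S] that
      by (intro has_vector_derivative_eq_rhs[OF has_vector_derivative_Pair]) auto
  qed
  from smooth_on_bounded_linear[OF bounded_linear_fst u this] have ys: "smooth_on ?S y" by simp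
  show ?thesis
    by (rule smooth_on_param_linear[where B = "\<lambda>t u. P t u \<phi>", OF u frameD(4)[OF F] smooth_frame[OF F c] ys])
qed

end

section \<open>Isotropic families of solutions of a Jacobi equation\<close>

locale jacobi_ode =
  fixes a b :: real and Rh :: "real \<Rightarrow> 'e::euclidean_space \<Rightarrow> 'e" and q :: "'e \<Rightarrow> 'e \<Rightarrow> real"
  assumes ab: "a < b"
    and lin: "\<And>t. t \<in> {a..b} \<Longrightarrow> linear (Rh t)" and cont: "\<And>u. continuous_on {a..b} (\<lambda>t. Rh t u)"
    and q1: "\<And>v. linear (\<lambda>u. q u v)" and q2: "\<And>u. linear (q u)"
    and q_pos: "\<And>u. u \<noteq> 0 \<Longrightarrow> q u u > 0"
    and Rh_sym: "\<And>t u v. t \<in> {a..b} \<Longrightarrow> q (Rh t u) v = q u (Rh t v)"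
begin

text \<open>The right end \<open>c\<close> varies because absence of conjugate points is a statement
  about every interval starting at \<open>a\<close>.\<close>

definition sol :: "real \<Rightarrow> (real \<Rightarrow> 'e) \<Rightarrow> (real \<Rightarrow> 'e) \<Rightarrow> bool" where
  "sol c y z \<longleftrightarrow> (\<forall>t\<in>{a..c}. (y has_vector_derivative z t) (at t within {a..c}) \<and>
    (z has_vector_derivative - Rh t (y t)) (at t within {a..c}))"

lemma solD:
  assumes "sol c y z" "t \<in> {a..c}"
  shows "(y has_vector_derivative z t) (at t within {a..c})" "(z has_vector_derivative - Rh t (y t)) (at t within {a..c})"
  using assms unfolding sol_def by simp_all

lemma linear_system: "t \<in> {a..b} \<Longrightarrow> linear (\<lambda>p. (snd p, - Rh t (fst p)))"
  by (intro linearI) (simp_all add: linear_add[OF lin] linear_scale[OF lin])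

lemma continuous_system: "continuous_on {a..b} (\<lambda>t. (snd p, - Rh t (fst p)))"
  by (intro continuous_intros cont)

lemma sol_exists: "\<exists>y z. sol b y z \<and> y a = y0 \<and> z a = z0"
proof -
  obtain p where p: "p a = (y0, z0)" "\<And>t. t \<in> {a..b} \<Longrightarrow> (p has_vector_derivative (snd (p t), - Rh t (fst (p t)))) (at t within {a..b})"
    using linear_ode_exists[OF less_imp_le[OF ab] linear_system continuous_system, of "(y0, z0)"] by auto
  have "sol b (\<lambda>t. fst (p t)) (\<lambda>t. snd (p t))" unfolding sol_def
    using bounded_linear.has_vector_derivative[OF bounded_linear_fst p(2)]
      bounded_linear.has_vector_derivative[OF bounded_linear_snd p(2)] by simp
  then show ?thesis using p(1) by (intro exI[of _ "\<lambda>t. fst (p t)"] exI[of _ "\<lambda>t. snd (p t)"]) simp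
qed

lemma sol_unique:
  assumes s: "sol b y z" and t0: "t0 \<in> {a..b}" "y t0 = 0" "z t0 = 0" and t: "t \<in> {a..b}"
  shows "y t = 0 \<and> z t = 0"
proof -
  have "((\<lambda>t. (y t, z t)) has_vector_derivative (snd (y t, z t), - Rh t (fst (y t, z t)))) (at t within {a..b})" if "t \<in> {a..b}" for t
    using has_vector_derivative_Pair[OF solD[OF s that]] by simp
  from linear_ode_unique[OF linear_system continuous_system this t0(1) _ t] show ?thesis using t0 by (simp add: zero_prod_def)
qed

lemma sol_scale: assumes "sol c y z" "c \<le> b" shows "sol c (\<lambda>t. r *\<^sub>R y t) (\<lambda>t. r *\<^sub>R z t)"
  unfolding sol_def
proof (intro ballI conjI)
  fix t assume t: "t \<in> {a..c}"
  show "((\<lambda>t. r *\<^sub>R y t) has_vector_derivative r *\<^sub>R z t) (at t within {a..c})"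
    by (rule bounded_linear.has_vector_derivative[OF bounded_linear_scaleR_right solD(1)[OF assms(1) t]])
  have "- Rh t (r *\<^sub>R y t) = r *\<^sub>R (- Rh t (y t))" using linear_scale[OF lin[of t]] t assms(2) by simp
  then show "((\<lambda>t. r *\<^sub>R z t) has_vector_derivative - Rh t (r *\<^sub>R y t)) (at t within {a..c})"
    using bounded_linear.has_vector_derivative[OF bounded_linear_scaleR_right solD(2)[OF assms(1) t], of r] by simp
qed

lemma sol_add: assumes "sol c y z" "sol c y' z'" "c \<le> b" shows "sol c (\<lambda>t. y t + y' t) (\<lambda>t. z t + z' t)"
  unfolding sol_def
proof (intro ballI conjI)
  fix t assume t: "t \<in> {a..c}"
  show "((\<lambda>t. y t + y' t) has_vector_derivative z t + z' t) (at t within {a..c})"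
    by (intro has_vector_derivative_add solD(1)[OF assms(1) t] solD(1)[OF assms(2) t])
  have "- Rh t (y t + y' t) = - Rh t (y t) + - Rh t (y' t)" using linear_add[OF lin[of t]] t assms(3) by simp
  then show "((\<lambda>t. z t + z' t) has_vector_derivative - Rh t (y t + y' t)) (at t within {a..c})"
    using has_vector_derivative_add[OF solD(2)[OF assms(1) t] solD(2)[OF assms(2) t]] by simp
qed

lemma sol_zero: "c \<le> b \<Longrightarrow> sol c (\<lambda>t. 0) (\<lambda>t. 0)"
  unfolding sol_def using linear_0[OF lin] by auto

lemma sol_sum: "(\<And>i. i \<in> A \<Longrightarrow> sol c (y i) (z i)) \<Longrightarrow> c \<le> b \<Longrightarrow> sol c (\<lambda>t. \<Sum>i\<in>A. y i t) (\<lambda>t. \<Sum>i\<in>A. z i t)"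
  by (induction A rule: infinite_finite_induct) (simp_all add: sol_zero sol_add)

lemma sol_subset: assumes "sol b y z" "c \<le> b" shows "sol c y z"
  unfolding sol_def
proof (intro ballI conjI)
  fix t assume t: "t \<in> {a..c}"
  have sub: "{a..c} \<subseteq> {a..b}" and tb: "t \<in> {a..b}" using assms(2) t by auto
  show "(y has_vector_derivative z t) (at t within {a..c})" "(z has_vector_derivative - Rh t (y t)) (at t within {a..c})"
    by (rule has_vector_derivative_within_subset[OF solD(1)[OF assms(1) tb] sub],
        rule has_vector_derivative_within_subset[OF solD(2)[OF assms(1) tb] sub])
qed

lemma q_has_derivative:
  assumes "(V has_vector_derivative V') (at t within S)" "(W has_vector_derivative W') (at t within S)" "t \<in> S"
  shows "((\<lambda>t. q (V t) (W t)) has_vector_derivative (q (V t) W' + q V' (W t))) (at t within S)"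
proof -
  have "((\<lambda>t. q (V t) (W t)) has_vector_derivative (0 + q (V t) W' + q V' (W t))) (at t within S)"
    by (rule has_vector_derivative_param_bilinear[where B = "\<lambda>_. q" and B' = "\<lambda>_ _. 0", OF assms(3) q1 q2 has_vector_derivative_const assms(1,2)])
  then show ?thesis by simp
qed

lemma wronskian:
  assumes "sol b y z" "sol b y' z'" "t \<in> {a..b}" "s \<in> {a..b}"
  shows "q (z t) (y' t) - q (y t) (z' t) = q (z s) (y' s) - q (y s) (z' s)"
proof -
  have "((\<lambda>t. q (z t) (y' t) - q (y t) (z' t)) has_vector_derivative 0) (at t within {a..b})" if t: "t \<in> {a..b}" for t
  proof -
    have "((\<lambda>t. q (z t) (y' t) - q (y t) (z' t)) has_vector_derivative
      ((q (z t) (z' t) + q (- Rh t (y t)) (y' t)) - (q (y t) (- Rh t (y' t)) + q (z t) (z' t)))) (at t within {a..b})"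
      by (intro has_vector_derivative_diff q_has_derivative solD[OF assms(1) t] solD[OF assms(2) t] t)
    moreover have "q (- Rh t (y t)) (y' t) = q (y t) (- Rh t (y' t))"
      using Rh_sym[OF t] linear_neg[OF q1] linear_neg[OF q2] by simp
    ultimately show ?thesis by simp
  qed
  then obtain k where "\<And>t. t \<in> {a..b} \<Longrightarrow> q (z t) (y' t) - q (y t) (z' t) = k"
    using has_vector_derivative_zero_constant[of "{a..b}" "\<lambda>t. q (z t) (y' t) - q (y t) (z' t)"] by auto
  then show ?thesis using assms(3,4) by metis
qed

end

locale jacobi_ode_no_conj = jacobi_ode a b Rh q
  for a b :: real and Rh :: "real \<Rightarrow> 'e::euclidean_space \<Rightarrow> 'e" and q :: "'e \<Rightarrow> 'e \<Rightarrow> real" +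
  assumes no_conj: "\<And>y z c. a < c \<Longrightarrow> c \<le> b \<Longrightarrow> sol c y z \<Longrightarrow> y a = 0 \<Longrightarrow> y c = 0 \<Longrightarrow> z a = 0"
begin

definition basis_sol :: "'e \<Rightarrow> (real \<Rightarrow> 'e) \<times> (real \<Rightarrow> 'e)" where
  "basis_sol e = (SOME p. sol b (fst p) (snd p) \<and> fst p a = 0 \<and> snd p a = e)"
text \<open>The matrix solution that vanishes at \<open>a\<close> with the identity as derivative
  there; \<open>Z\<close> is its derivative. The columns are the solutions
  \<open>basis_sol i\<close>.\<close>

definition Y :: "real \<Rightarrow> 'e \<Rightarrow> 'e" where "Y t u = (\<Sum>i\<in>Basis. (u \<bullet> i) *\<^sub>R fst (basis_sol i) t)"
definition Z :: "real \<Rightarrow> 'e \<Rightarrow> 'e" where "Z t u = (\<Sum>i\<in>Basis. (u \<bullet> i) *\<^sub>R snd (basis_sol i) t)"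

lemma basis_sol: "sol b (fst (basis_sol e)) (snd (basis_sol e))" "fst (basis_sol e) a = 0" "snd (basis_sol e) a = e"
proof -
  obtain y z where "sol b y z \<and> y a = 0 \<and> z a = e" using sol_exists by blast
  then have "\<exists>p. sol b (fst p) (snd p) \<and> fst p a = 0 \<and> snd p a = e" by (intro exI[of _ "(y, z)"]) simp
  from someI_ex[OF this]
  show "sol b (fst (basis_sol e)) (snd (basis_sol e))" "fst (basis_sol e) a = 0" "snd (basis_sol e) a = e"
    unfolding basis_sol_def by simp_all
qed

lemma sol_YZ: "sol b (\<lambda>t. Y t u) (\<lambda>t. Z t u)"
  unfolding Y_def Z_def by (intro sol_sum sol_scale basis_sol order_refl)

lemma Y_a: "Y a u = 0" and Z_a: "Z a u = u"
  unfolding Y_def Z_def by (simp_all add: basis_sol euclidean_representation)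

lemma linear_Y: "linear (Y t)" and linear_Z: "linear (Z t)"
  unfolding Y_def[abs_def] Z_def[abs_def]
  by (intro linearI; simp add: inner_add_left scaleR_add_left sum.distrib scaleR_sum_right)+

lemma inj_Y: assumes "a < t" "t \<le> b" shows "inj (Y t)"
  unfolding linear_injective_0[OF linear_Y]
proof (intro allI impI)
  fix u assume "Y t u = 0"
  from no_conj[OF assms sol_subset[OF sol_YZ assms(2)] Y_a this] show "u = 0" by (simp add: Z_a)
qed

text \<open>The Wronskian of two columns is 0 at \<open>a\<close>, where both vanish.\<close>

lemma YZ_symmetric: "t \<in> {a..b} \<Longrightarrow> q (Z t u) (Y t v) = q (Y t u) (Z t v)"
  using wronskian[OF sol_YZ sol_YZ, of t a u v] ab by (simp add: Y_a linear_0[OF q1] linear_0[OF q2])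

text \<open>The vector function f of the ansatz y = Y f. It is significant only to the right of
  \<open>a\<close>, since \<open>Y a\<close> is zero.\<close>

definition coef :: "(real \<Rightarrow> 'e) \<Rightarrow> real \<Rightarrow> 'e" where "coef y t = inv (Y t) (y t)"

lemma Y_coef: assumes "a < t" "t \<le> b" shows "Y t (coef y t) = y t"
  unfolding coef_def
  by (rule surj_f_inv_f) (intro linear_injective_imp_surjective[OF linear_Y inj_Y[OF assms]] refl)

text \<open>The derivative \<open>z\<close> is a separate argument, so that at a break of the field
  either one-sided derivative can be inserted.\<close>

definition F :: "(real \<Rightarrow> 'e) \<Rightarrow> (real \<Rightarrow> 'e) \<Rightarrow> real \<Rightarrow> real" where
  "F y z t = q (z t - Z t (coef y t)) (y t)"

text \<open>Writing \<open>y = Y f\<close>, one gets \<open>F' = \<langle>Y f', Y f'\<rangle>\<close>; this replaces the index form.\<close>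

lemma F_has_derivative:
  assumes s: "sol b y z" and t: "a < t" "t \<le> b"
  shows "\<exists>f'. Y t f' = z t - Z t (coef y t) \<and> (F y z has_vector_derivative q (Y t f') (Y t f')) (at t within {a<..b})"
proof -
  let ?S = "{a<..b}"
  have tS: "t \<in> ?S" and tI: "t \<in> {a..b}" and sub: "?S \<subseteq> {a..b}" using t by auto
  note W = has_vector_derivative_within_subset[OF _ sub]
  note dY = W[OF solD(1)[OF sol_YZ tI]] and dZ = W[OF solD(2)[OF sol_YZ tI]]
  \<comment> \<open>Differentiability of the coefficients comes from
    \<open>Y t (coef y t) = y t\<close>, a linear system whose matrix \<open>Y\<close> has
    derivative \<open>Z\<close>.\<close>
  have "\<exists>h'. (coef y has_derivative h') (at t within ?S) \<and> (\<forall>v. Y t (h' v) = v *\<^sub>R z t - (\<Sum>i\<in>Basis. (coef y t \<bullet> i) *\<^sub>R (v *\<^sub>R Z t i)))"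
    by (rule linear_system_differentiable[where A = Y and A' = "\<lambda>v u. v *\<^sub>R Z t u" and F = y and F' = "\<lambda>v. v *\<^sub>R z t",
          OF tS linear_Y inj_Y[OF t] dY[unfolded has_vector_derivative_def] W[OF solD(1)[OF s tI], unfolded has_vector_derivative_def]])
      (simp add: Y_coef)
  then obtain h' where h': "(coef y has_derivative h') (at t within ?S)"
    and eq: "\<And>v. Y t (h' v) = v *\<^sub>R z t - (\<Sum>i\<in>Basis. (coef y t \<bullet> i) *\<^sub>R (v *\<^sub>R Z t i))" by blast
  define f' where "f' = h' 1"
  have Yf': "Y t f' = z t - Z t (coef y t)"
    using eq[of 1] linear_sum_Basis[OF linear_Z, of t "coef y t"] by (simp add: f'_def)
  have "h' v = v *\<^sub>R f'" for v
    using linear_scale[OF has_derivative_linear[OF h'], of v 1] by (simp add: f'_def)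
  then have f: "(coef y has_vector_derivative f') (at t within ?S)"
    using h' unfolding has_vector_derivative_def by presburger
  have Zf: "((\<lambda>t. Z t (coef y t)) has_vector_derivative (- Rh t (Y t (coef y t)) + Z t f')) (at t within ?S)"
    by (rule has_vector_derivative_param_linear[where B = Z and B' = "\<lambda>u. - Rh t (Y t u)", OF tS linear_Z dZ f])
  have "((\<lambda>t. z t - Z t (coef y t)) has_vector_derivative (- Rh t (y t) - (- Rh t (Y t (coef y t)) + Z t f'))) (at t within ?S)"
    by (intro has_vector_derivative_diff W[OF solD(2)[OF s tI]] Zf)
  then have zZ: "((\<lambda>t. z t - Z t (coef y t)) has_vector_derivative - Z t f') (at t within ?S)"
    by (simp add: Y_coef[OF t])
  have "(F y z has_vector_derivative (q (z t - Z t (coef y t)) (z t) + q (- Z t f') (y t))) (at t within ?S)"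
    unfolding F_def[abs_def] by (rule q_has_derivative[OF zZ W[OF solD(1)[OF s tI]] tS])
  \<comment> \<open>By \<open>YZ_symmetric\<close> the term with \<open>Z t f'\<close> becomes the
    pairing of \<open>Y t f'\<close> with \<open>Z t (coef y t)\<close>, which completes
    \<open>z t\<close> to \<open>Y t f'\<close>.\<close>
  moreover have "q (z t - Z t (coef y t)) (z t) + q (- Z t f') (y t) = q (Y t f') (Y t f')"
  proof -
    have "q (Z t f') (y t) = q (Y t f') (Z t (coef y t))"
      using YZ_symmetric[OF tI, of f' "coef y t"] by (simp add: Y_coef[OF t])
    then show ?thesis unfolding Yf' by (simp add: linear_diff[OF q2] linear_neg[OF q1])
  qed
  ultimately show ?thesis using Yf' by auto
qed

lemma q_nonneg: "q u u \<ge> 0"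
  using q_pos[of u] linear_0[OF q1, of u] by (cases "u = 0") auto

lemma F_mono:
  assumes s: "sol b y z" and st: "a < s" "s \<le> t" "t \<le> b"
  shows "F y z s \<le> F y z t"
proof -
  have "\<exists>d\<ge>0. (F y z has_vector_derivative d) (at r within {a<..b})" if "a < r" "r \<le> b" for r
    using F_has_derivative[OF s that] q_nonneg by blast
  then obtain d where d: "\<And>r. a < r \<Longrightarrow> r \<le> b \<Longrightarrow> d r \<ge> 0"
    "\<And>r. a < r \<Longrightarrow> r \<le> b \<Longrightarrow> (F y z has_vector_derivative d r) (at r within {a<..b})" by metis
  show ?thesis
  proof (rule increasing_within[OF st(2), where f' = d])
    fix r assume r: "s \<le> r" "r \<le> t"
    have sub: "{s..t} \<subseteq> {a<..b}" using st by auto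
    show "(F y z has_real_derivative d r) (at r within {s..t})"
      unfolding has_real_derivative_iff_has_vector_derivative
      using has_vector_derivative_within_subset[OF d(2) sub] r st by simp
    show "d r \<ge> 0" using d(1) r st by simp
  qed
qed

text \<open>The one-sided derivative of \<open>F\<close> at \<open>b\<close> is the square of
  \<open>Y b f'\<close> with respect to \<open>q\<close>, so it vanishes only if the derivative f'
  of the coefficients is 0 there.\<close>

lemma F_constant:
  assumes s: "sol b y z" and r: "a < r" "r < b" and c: "\<And>t. r \<le> t \<Longrightarrow> t \<le> b \<Longrightarrow> F y z t = k"
  shows "z b = Z b (coef y b)"
proof -
  obtain f' where f': "Y b f' = z b - Z b (coef y b)" "(F y z has_vector_derivative q (Y b f') (Y b f')) (at b within {a<..b})"
    using F_has_derivative[OF s ab order_refl] by blast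
  have "(F y z has_vector_derivative q (Y b f') (Y b f')) (at b within {r..b})"
    by (rule has_vector_derivative_within_subset[OF f'(2)]) (use r in auto)
  moreover have "(F y z has_vector_derivative 0) (at b within {r..b})"
    by (rule has_vector_derivative_transform[OF _ _ has_vector_derivative_const[of k]]) (use r c in auto)
  moreover have "at b within {r..b} \<noteq> bot" using r by (simp add: trivial_limit_within islimpt_Icc)
  ultimately have "q (Y b f') (Y b f') = 0" using vector_derivative_unique_within by blast
  then have "Y b f' = 0" using q_pos[of "Y b f'"] by fastforce
  then show ?thesis using f'(1) by simp
qed

text \<open>Continuity across a break: the added field vanishes at \<open>t\<close> and leaves the
  coefficients alone, and the jump of the derivative is orthogonal to the value.\<close>

lemma F_jump:
  assumes t: "a < t" "t \<le> b" and y2: "y2 t = 0" and perp: "q (z2 t) (y1 t) = 0"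
  shows "F (\<lambda>t. y1 t + y2 t) (\<lambda>t. z1 t + z2 t) t = F y1 z1 t"
proof -
  have "coef (\<lambda>t. y1 t + y2 t) t = coef y1 t" by (simp add: coef_def y2)
  then show ?thesis using perp
    by (simp add: F_def y2 linear_diff[OF q1] linear_add[OF q1])
qed

text \<open>A solution vanishing at \<open>a\<close> is \<open>Y\<close> applied to a constant
  vector. This replaces a limit at \<open>a\<close>, where \<open>F\<close> carries no
  information.\<close>

lemma F_start:
  assumes s: "sol b y z" and 0: "y a = 0" and t: "a < t" "t \<le> b"
  shows "F y z t = 0"
proof -
  let ?u = "z a"
  have "sol b (\<lambda>t. y t + (-1) *\<^sub>R Y t ?u) (\<lambda>t. z t + (-1) *\<^sub>R Z t ?u)"
    by (intro sol_add s sol_scale sol_YZ order_refl)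
  from sol_unique[OF this, of a t] have e: "y t = Y t ?u" "z t = Z t ?u" using t ab 0 by (simp_all add: Y_a Z_a)
  have "coef y t = ?u" unfolding coef_def e(1) by (rule inv_f_f[OF inj_Y[OF t]])
  then show ?thesis by (simp add: F_def e(2) linear_0[OF q1])
qed

text \<open>Induction over the breaks in increasing order: monotonicity between breaks,
  \<open>F_jump\<close> at each of them. The broken field itself is never formed; only its pieces,
  the partial sums, occur.\<close>

lemma F_partial_sum:
  assumes T: "finite T" "T \<subseteq> {a<..<b}"
    and s: "\<And>t. t \<in> insert a T \<Longrightarrow> sol b (y t) (z t)" and 0: "\<And>t. t \<in> insert a T \<Longrightarrow> y t t = 0"
    and iso: "\<And>s t r. s \<in> insert a T \<Longrightarrow> t \<in> insert a T \<Longrightarrow> r \<in> {a..b} \<Longrightarrow> q (z s r) (y t r) = q (y s r) (z t r)"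
    and r: "a < r" "r \<le> b" "\<And>t. t \<in> T \<Longrightarrow> t \<le> r"
  shows "0 \<le> F (\<lambda>r. y a r + (\<Sum>t\<in>T. y t r)) (\<lambda>r. z a r + (\<Sum>t\<in>T. z t r)) r"
  using T s 0 iso r
proof (induction T arbitrary: r rule: finite_linorder_max_induct)
  case empty
  then show ?case using F_start[of "y a" "z a" r] by simp
next
  case (insert m T)
  let ?V = "\<lambda>r. y a r + (\<Sum>t\<in>T. y t r)" and ?W = "\<lambda>r. z a r + (\<Sum>t\<in>T. z t r)"
  let ?V' = "\<lambda>r. y a r + (\<Sum>t\<in>insert m T. y t r)" and ?W' = "\<lambda>r. z a r + (\<Sum>t\<in>insert m T. z t r)"
  have mT: "m \<notin> T" using insert.hyps(2) by blast
  have m: "a < m" "m < b" using insert.prems(1) by auto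
  have V': "?V' = (\<lambda>r. ?V r + y m r)" "?W' = (\<lambda>r. ?W r + z m r)"
    using insert.hyps(1) mT by (simp_all add: fun_eq_iff add_ac)
  have sV': "sol b ?V' ?W'"
    by (intro sol_add sol_sum insert.prems(2) order_refl) auto
  have 1: "0 \<le> F ?V ?W m"
  proof (rule insert.IH)
    show "T \<subseteq> {a<..<b}" using insert.prems(1) by simp
    show "q (z s r) (y t r) = q (y s r) (z t r)" if "s \<in> insert a T" "t \<in> insert a T" "r \<in> {a..b}" for s t r
      using insert.prems(4)[of s t r] that by blast
  qed (use insert.prems insert.hyps m in \<open>auto simp: less_imp_le\<close>)
  \<comment> \<open>Isotropy moves the derivative from \<open>z m\<close> to the other factor and
    leaves \<open>y m\<close>, which is 0 at \<open>m\<close>.\<close>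
  have perp: "q (z m m) (?V m) = 0"
  proof -
    have mm: "m \<in> {a..b}" using m by simp
    have "q (z m m) (y t m) = 0" if "t \<in> insert a T" for t
      using insert.prems(4)[of m t m] insert.prems(3)[of m] that mm linear_0[OF q1] by auto
    then show ?thesis by (simp add: linear_add[OF q2] linear_sum[OF q2])
  qed
  have "F ?V' ?W' m = F ?V ?W m"
    unfolding V' by (rule F_jump) (use m insert.prems(3)[of m] perp in auto)
  then have "0 \<le> F ?V' ?W' m" using 1 by simp
  also have "\<dots> \<le> F ?V' ?W' r" by (rule F_mono[OF sV' m(1)]) (use insert.prems in auto)
  finally show ?case .
qed

text \<open>To the right of the last break, \<open>F\<close> of the sum without \<open>y b\<close>
  is nonnegative by \<open>F_partial_sum\<close> and at most its value 0 at \<open>b\<close>. Being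
  constant, it forces the derivative of that sum to vanish at \<open>b\<close>, and hence that of
  \<open>y b\<close>.\<close>

theorem isotropic_sum_last:
  assumes T: "finite T" "T \<subseteq> {a<..<b}"
    and s: "\<And>t. t \<in> insert a (insert b T) \<Longrightarrow> sol b (y t) (z t)" and 0: "\<And>t. t \<in> insert a (insert b T) \<Longrightarrow> y t t = 0"
    and iso: "\<And>s t r. s \<in> insert a (insert b T) \<Longrightarrow> t \<in> insert a (insert b T) \<Longrightarrow> r \<in> {a..b} \<Longrightarrow> q (z s r) (y t r) = q (y s r) (z t r)"
    and total: "\<And>r. r \<in> {a..b} \<Longrightarrow> y a r + (\<Sum>t\<in>T. y t r) + y b r = 0"
  shows "z b b = 0"
proof -
  let ?V = "\<lambda>r. y a r + (\<Sum>t\<in>T. y t r)" and ?W = "\<lambda>r. z a r + (\<Sum>t\<in>T. z t r)"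
  have sV: "sol b ?V ?W" by (intro sol_add sol_sum s order_refl) auto
  have bI: "b \<in> {a..b}" using ab by simp
  have Vb: "?V b = 0" using total[OF bI] 0[of b] by simp
  \<comment> \<open>The total field is identically 0 on the interval, so its derivative at
    \<open>b\<close> is 0 as well.\<close>
  have Wb: "?W b + z b b = 0"
  proof -
    have sb: "sol b (y b) (z b)" by (rule s) simp
    have "((\<lambda>r. ?V r + y b r) has_vector_derivative (?W b + z b b)) (at b within {a..b})"
      by (intro has_vector_derivative_add[OF solD(1)[OF sV bI] solD(1)[OF sb bI]])
    moreover have "((\<lambda>r. ?V r + y b r) has_vector_derivative 0) (at b within {a..b})"
      by (rule has_vector_derivative_transform[OF bI _ has_vector_derivative_const[of 0]]) (simp add: total)
    moreover have "at b within {a..b} \<noteq> bot" using ab by (simp add: trivial_limit_within islimpt_Icc)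
    ultimately show ?thesis using vector_derivative_unique_within by blast
  qed
  have coef_b: "coef ?V b = 0"
    using inv_f_f[OF inj_Y[OF ab order_refl], of 0] linear_0[OF linear_Y, of b] unfolding coef_def Vb by simp
  \<comment> \<open>The midpoint makes the set nonempty and keeps \<open>r0\<close> to the right of
    \<open>a\<close> when there are no breaks.\<close>
  define r0 where "r0 = Max (insert ((a + b) / 2) T)"
  have fin: "finite (insert ((a + b) / 2) T)" using T by simp
  have r0T: "t \<le> r0" if "t \<in> T" for t unfolding r0_def using that fin by (intro Max_ge) auto
  have "r0 \<in> insert ((a + b) / 2) T" unfolding r0_def by (rule Max_in[OF fin]) simp
  then have r0: "a < r0" "r0 < b" using T(2) ab by auto
  have "F ?V ?W r = 0" if r: "r0 \<le> r" "r \<le> b" for r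
  proof (rule antisym)
    have "F ?V ?W r \<le> F ?V ?W b" by (rule F_mono[OF sV]) (use r r0 in auto)
    also have "\<dots> = 0" unfolding F_def Vb by (rule linear_0[OF q2])
    finally show "F ?V ?W r \<le> 0" .
    show "0 \<le> F ?V ?W r"
    proof (rule F_partial_sum[OF T])
      show "t \<le> r" if "t \<in> T" for t using r0T[OF that] r by simp
      show "q (z s r) (y t r) = q (y s r) (z t r)" if "s \<in> insert a T" "t \<in> insert a T" "r \<in> {a..b}" for s t r
        by (rule iso) (use that in auto)
    qed (use r r0 s 0 in auto)
  qed
  from F_constant[OF sV r0 this] have "?W b = 0" unfolding coef_b linear_0[OF linear_Z] .
  then show ?thesis using Wb by simp
qed

end

section \<open>Jacobi fields along geodesics without conjugate points\<close>

context riem_curve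
begin

section \<open>Covariant derivatives on an interval and on its subintervals\<close>

lemma velocity_restrict:
  assumes T: "uds T" "T \<subseteq> I" and t: "t \<in> T"
  shows "velocity M T \<gamma> t = w t"
proof
  fix \<phi>
  show "velocity M T \<gamma> t \<phi> = w t \<phi>"
  proof (cases "chart_at M (\<gamma> t) \<phi>")
    case True
    then have c: "\<phi> \<in> Atlas M" "\<gamma> t \<in> fst \<phi>" by (simp_all add: chart_at_def)
    have tI: "t \<in> I" using t T by blast
    show ?thesis
      using uds_vector_derivative[OF T(1) t x_has_vector_derivative[OF c(1) tI c(2) T(2)]] t True
      by (simp add: velocity_def)
  next
    case False
    then show ?thesis using w_outside[of t \<phi>] by (simp add: velocity_def)
  qed
qed

text \<open>\<open>T\<close> may be a proper subinterval: \<open>without_conjugate_points\<close>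
  differentiates within closed intervals, and uniqueness of derivatives identifies the result with
  that on \<open>I\<close>.\<close>

lemma cov_deriv_covd:
  assumes T: "uds T" "T \<subseteq> I" and V: "covd T V V'" and t: "t \<in> T"
  shows "cov_deriv M T \<gamma> V t = V' t"
proof
  fix \<phi>
  show "cov_deriv M T \<gamma> V t \<phi> = V' t \<phi>"
  proof (cases "chart_at M (\<gamma> t) \<phi>")
    case True
    then have c: "\<phi> \<in> Atlas M" "\<gamma> t \<in> fst \<phi>" by (simp_all add: chart_at_def)
    show ?thesis
      using uds_vector_derivative[OF T(1) t covdD(3)[OF V t c]] t True
      by (simp add: cov_deriv_def velocity_restrict[OF T t])
  next
    case False
    then show ?thesis using tangent_outside[OF covdD(2)[OF V t]] by (simp add: cov_deriv_def)
  qed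
qed

lemma field_has_vector_derivative:
  assumes V: "field_along M I \<gamma> V" and t: "t \<in> I" and c: "\<phi> \<in> Atlas M" "\<gamma> t \<in> fst \<phi>"
  shows "((\<lambda>s. V s \<phi>) has_vector_derivative
    (cov_deriv M I \<gamma> V t \<phi> - \<Gamma> \<phi> (x \<phi> t) (w t \<phi>) (V t \<phi>))) (at t within I)"
proof -
  have at: "at t within dom \<phi> = at t within I" using at_within_dom[OF c(1) subset_refl t c(2)] by (simp add: Int_absorb1)
  have "smooth_on (dom \<phi>) (\<lambda>t. V t \<phi>)" using V c by (simp add: field_along_def)
  from smooth_on_real_has_vector_derivative[OF uds_dom[OF c(1)] this, of t]
  have "((\<lambda>s. V s \<phi>) has_vector_derivative vector_derivative (\<lambda>s. V s \<phi>) (at t within I)) (at t within I)"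
    using at t c by simp
  then show ?thesis using t c by (simp add: cov_deriv_def chart_at_def w_def)
qed

lemma field_covd:
  assumes V: "field_along M I \<gamma> V"
  shows "covd I V (cov_deriv M I \<gamma> V)"
proof -
  have VT: "V t \<in> tangent_space M (\<gamma> t)" if "t \<in> I" for t using V that by (simp add: field_along_def)
  have "cov_deriv M I \<gamma> V t \<in> tangent_space M (\<gamma> t)" if t: "t \<in> I" for t
  proof (rule tangentI)
    fix \<phi> \<psi> assume c: "\<phi> \<in> Atlas M" "\<gamma> t \<in> fst \<phi>" "\<psi> \<in> Atlas M" "\<gamma> t \<in> fst \<psi>"
    from component_transform[OF VT subset_refl t c field_has_vector_derivative[OF V t c(1,2)]]
    have "((\<lambda>s. V s \<psi>) has_vector_derivative (tr \<phi> \<psi> (x \<phi> t) (cov_deriv M I \<gamma> V t \<phi>)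
      - \<Gamma> \<psi> (x \<psi> t) (w t \<psi>) (V t \<psi>))) (at t within I)" by simp
    from uds_vector_derivative[OF uds_I t this] uds_vector_derivative[OF uds_I t field_has_vector_derivative[OF V t c(3,4)]]
    show "cov_deriv M I \<gamma> V t \<psi> = tr \<phi> \<psi> (x \<phi> t) (cov_deriv M I \<gamma> V t \<phi>)" by simp
  qed (simp add: cov_deriv_def)
  then show ?thesis unfolding covd_def using VT field_has_vector_derivative[OF V] by simp
qed

text \<open>Makes the second covariant derivative in the Jacobi equation accessible to
  \<open>field_covd\<close>, which asks for a smooth field.\<close>

lemma field_cov_deriv:
  assumes V: "field_along M I \<gamma> V"
  shows "field_along M I \<gamma> (cov_deriv M I \<gamma> V)"
  unfolding field_along_def
proof (intro conjI ballI allI impI)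
  show "cov_deriv M I \<gamma> V t \<in> tangent_space M (\<gamma> t)" if "t \<in> I" for t using covdD(2)[OF field_covd[OF V] that] .
  show "cov_deriv M I \<gamma> V t = 0" if "t \<notin> I" for t using that by (simp add: cov_deriv_def zero_fun_def)
  fix \<phi> assume c: "\<phi> \<in> Atlas M"
  have Vs: "smooth_on (dom \<phi>) (\<lambda>t. V t \<phi>)" using V c by (simp add: field_along_def)
  let ?G = "\<lambda>t. \<Gamma> \<phi> (x \<phi> t) (w t \<phi>) (V t \<phi>)"
  have G: "smooth_on (dom \<phi>) ?G"
    by (rule smooth_on_param_linear[where B = "\<lambda>t u. \<Gamma> \<phi> (x \<phi> t) (w t \<phi>) u", OF uds_dom[OF c] christoffel_linear2[OF c x_in_U]
          smooth_christoffel_along[OF c] Vs])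
  have "((\<lambda>s. V s \<phi>) has_vector_derivative (cov_deriv M I \<gamma> V t \<phi> - ?G t)) (at t within dom \<phi>)" if "t \<in> dom \<phi>" for t
    by (rule has_vector_derivative_within_subset[OF field_has_vector_derivative[OF V _ c]]) (use that in auto)
  from smooth_on_real_iff[OF uds_dom[OF c] this] Vs
  have "smooth_on (dom \<phi>) (\<lambda>t. cov_deriv M I \<gamma> V t \<phi> - ?G t)" by blast
  from smooth_on_add[OF uds_dom[OF c] this G] show "smooth_on (dom \<phi>) (\<lambda>t. cov_deriv M I \<gamma> V t \<phi>)" by simp
qed

lemma jacobi_field_jac:
  assumes J: "jacobi_field M I \<gamma> J"
  shows "jac I J (cov_deriv M I \<gamma> J)"
proof -
  have V: "field_along M I \<gamma> J" and eq: "\<And>t. t \<in> I \<Longrightarrow> cov_deriv M I \<gamma> (cov_deriv M I \<gamma> J) t + Rop t (J t) = 0"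
    using J by (simp_all add: jacobi_field_def Rop_def w_def)
  have "covd I (cov_deriv M I \<gamma> J) (\<lambda>t. - Rop t (J t))"
    by (rule covd_cong[OF field_covd[OF field_cov_deriv[OF V]] refl]) (use eq in \<open>simp add: eq_neg_iff_add_eq_0\<close>)
  then show ?thesis unfolding jac_def using field_covd[OF V] by blast
qed

lemma frame_subset:
  assumes F: "frame a b P q" and c: "a < c" "c \<le> b"
  shows "frame a c P q"
proof -
  have sub: "{a..c} \<subseteq> {a..b}" using c by auto
  have "covd {a..c} (\<lambda>t. P t u) (\<lambda>_. 0)" for u by (rule covd_subset[OF frameD(3)[OF F] sub])
  then show ?thesis using F sub c(1) unfolding frame_def by blast
qed

lemma frame_linear: assumes F: "frame a b P q" shows "linear (P t)"
  by (rule linearI) (simp_all add: fun_eq_iff scaleR_fun_def linear_add[OF frameD(4)[OF F]] linear_scale[OF frameD(4)[OF F]])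

lemma frame_ode:
  assumes F: "frame a b P q"
  shows "\<exists>Rh. jacobi_ode a b Rh q \<and> (\<forall>t\<in>{a..b}. \<forall>u. P t (Rh t u) = Rop t (P t u)) \<and>
    (\<forall>\<phi>\<in>Atlas M. \<forall>u. smooth_on ({a..b} \<inter> dom \<phi>) (\<lambda>t. Rh t u))"
proof -
  obtain Rh where Rh: "\<And>t. t \<in> {a..b} \<Longrightarrow> linear (Rh t)" "\<And>t u. t \<in> {a..b} \<Longrightarrow> P t (Rh t u) = Rop t (P t u)"
    "\<And>t u v. t \<in> {a..b} \<Longrightarrow> q (Rh t u) v = q u (Rh t v)" "\<And>u. continuous_on {a..b} (\<lambda>t. Rh t u)"
    "\<And>u \<phi>. \<phi> \<in> Atlas M \<Longrightarrow> smooth_on ({a..b} \<inter> dom \<phi>) (\<lambda>t. Rh t u)"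
    using frame_curvature[OF F] by blast
  have "jacobi_ode a b Rh q"
  proof (rule jacobi_ode.intro)
    show "a < b" by (rule frameD(1)[OF F])
    show "linear (Rh t)" if "t \<in> {a..b}" for t by (rule Rh(1)[OF that])
    show "continuous_on {a..b} (\<lambda>t. Rh t u)" for u by (rule Rh(4))
    show "linear (\<lambda>u. q u v)" for v by (rule frame_inner(1)[OF F])
    show "linear (q u)" for u by (rule frame_inner(2)[OF F])
    show "q u u > 0" if "u \<noteq> 0" for u by (rule frame_inner(3)[OF F that])
    show "q (Rh t u) v = q u (Rh t v)" if "t \<in> {a..b}" for t u v by (rule Rh(3)[OF that])
  qed
  then show ?thesis by (intro exI[of _ Rh] conjI ballI allI Rh(2) Rh(5))
qed

lemma jac_unique:
  assumes J: "jac I J J'" and t0: "t0 \<in> I" "J t0 = 0" "J' t0 = 0" and t: "t \<in> I"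
  shows "J t = 0"
proof (cases "t = t0")
  case False
  \<comment> \<open>Frames are available over compact nondegenerate intervals, so the interval
    spanned by the two parameters is used.\<close>
  define a b where "a = min t t0" and "b = max t t0"
  have ab: "a < b" "t \<in> {a..b}" "t0 \<in> {a..b}" using False by (auto simp: a_def b_def)
  have "a \<in> I" "b \<in> I" using t t0 by (auto simp: a_def b_def min_def max_def)
  then have sub: "{a..b} \<subseteq> I" using interval unfolding is_interval_1 by (meson atLeastAtMost_iff subsetI)
  obtain P q where F: "frame a b P q" using frame_exists[OF ab(1) sub] by blast
  obtain Rh where "jacobi_ode a b Rh q" and Rh: "\<And>t u. t \<in> {a..b} \<Longrightarrow> P t (Rh t u) = Rop t (P t u)"
    using frame_ode[OF F] by blast
  then interpret E: jacobi_ode a b Rh q by simp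
  have "jac {a..b} J J'" using J covd_subset[OF _ sub] unfolding jac_def by blast
  from jac_components[where Rh = Rh, OF F Rh this]
  obtain y z where yz: "\<And>t. t \<in> {a..b} \<Longrightarrow> J t = P t (y t)" "\<And>t. t \<in> {a..b} \<Longrightarrow> J' t = P t (z t)" and "E.sol b y z"
    unfolding E.sol_def by blast
  note P0 = linear_0[OF frame_linear[OF F]]
  have "y t0 = 0" "z t0 = 0"
    using frame_cancel[OF F ab(3), of _ 0] yz[OF ab(3)] t0 P0[of t0] by simp_all
  then have "y t = 0" using E.sol_unique[OF \<open>E.sol b y z\<close> ab(3) _ _ ab(2)] by blast
  then show ?thesis using yz(1)[OF ab(2)] P0 by simp
qed (simp add: t0)

text \<open>Its derivative is the difference of two curvature terms, which cancel by
  self-adjointness of the Jacobi operator.\<close>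

lemma wronskian_constant:
  assumes J: "jac I J J'" and K: "jac I K K'" and t: "s \<in> I" "t \<in> I"
  shows "ip M (\<gamma> t) (J' t) (K t) - ip M (\<gamma> t) (J t) (K' t) = ip M (\<gamma> s) (J' s) (K s) - ip M (\<gamma> s) (J s) (K' s)"
proof -
  note J1 = J[unfolded jac_def, THEN conjunct1] and J2 = J[unfolded jac_def, THEN conjunct2]
    and K1 = K[unfolded jac_def, THEN conjunct1] and K2 = K[unfolded jac_def, THEN conjunct2]
  let ?W = "\<lambda>t. ip M (\<gamma> t) (J' t) (K t) - ip M (\<gamma> t) (J t) (K' t)"
  have "(?W has_vector_derivative 0) (at r within I)" if r: "r \<in> I" for r
  proof -
    have neg: "ip M (\<gamma> r) (- u) v = - ip M (\<gamma> r) u v" "ip M (\<gamma> r) v (- u) = - ip M (\<gamma> r) v u"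
      if "u \<in> tangent_space M (\<gamma> r)" "v \<in> tangent_space M (\<gamma> r)" for u v
      using ip_props(3)[OF \<gamma>_topspace[OF r] that, of "-1"] ip_props(1)[OF \<gamma>_topspace[OF r] that(2)] tangent_minus[OF that(1)] that by simp_all
    have "(?W has_vector_derivative ((ip M (\<gamma> r) (- Rop r (J r)) (K r) + ip M (\<gamma> r) (J' r) (K' r)) -
      (ip M (\<gamma> r) (J' r) (K' r) + ip M (\<gamma> r) (J r) (- Rop r (K r))))) (at r within I)"
      by (intro has_vector_derivative_diff ip_has_derivative J1 J2 K1 K2 subset_refl r)
    then show ?thesis
      using Rop_symmetric[OF r covdD(1)[OF J1 r] covdD(1)[OF K1 r]]
      by (simp add: neg Rop_tangent[OF r] covdD(1)[OF J1 r] covdD(1)[OF K1 r])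
  qed
  then obtain k where "\<And>r. r \<in> I \<Longrightarrow> ?W r = k"
    using has_vector_derivative_zero_constant[OF is_interval_convex[OF interval], of ?W] by auto
  then show ?thesis using t by metis
qed

lemma smooth_curve_restrict:
  assumes "a < b" "{a..b} \<subseteq> I"
  shows "smooth_curve M {a..b} \<gamma>"
  unfolding smooth_curve_def
proof (intro conjI ballI)
  show "continuous_map (top_of_set {a..b}) (Top M) \<gamma>"
    using curve assms(2) continuous_map_from_subtopology_mono unfolding smooth_curve_def by blast
  fix \<phi> assume c: "\<phi> \<in> Atlas M"
  have eq: "{t \<in> {a..b}. \<gamma> t \<in> fst \<phi>} = {a..b} \<inter> dom \<phi>" using assms(2) by auto
  show "smooth_on {t \<in> {a..b}. \<gamma> t \<in> fst \<phi>} (x \<phi>)"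
    unfolding eq by (rule smooth_on_subset[OF uds_dom[OF c] uds_sub[OF assms c] Int_lower2 smooth_x[OF c]])
qed

end

locale riem_geodesic = riem_curve +
  assumes geodesic: "geodesic M I \<gamma>" and nonconstant: "\<not> \<gamma> constant_on I"
begin

lemma covd_w: "covd I w (\<lambda>_. 0)"
proof -
  have "field_along M I \<gamma> w" unfolding field_along_def
  proof (intro conjI ballI allI impI)
    show "w t = 0" if "t \<notin> I" for t using w_outside[of t] that by (simp add: fun_eq_iff)
  qed (simp_all add: w_tangent smooth_w)
  from field_covd[OF this] show ?thesis
    by (rule covd_cong) (use geodesic in \<open>simp_all add: geodesic_def w_def\<close>)
qed

text \<open>Constancy can be read off only while the curve stays in one chart;
  \<open>Bolzano\<close> joins the short intervals.\<close>

lemma constant_if_w_zero: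
  assumes 0: "\<And>t. t \<in> I \<Longrightarrow> w t = 0" and st: "s \<in> I" "t \<in> I" "s \<le> t"
  shows "\<gamma> s = \<gamma> t"
proof -
  have sub: "{s..t} \<subseteq> I" using st interval unfolding is_interval_1 by (meson atLeastAtMost_iff subsetI)
  define Q where "Q a b \<longleftrightarrow> (s \<le> a \<and> a \<le> b \<and> b \<le> t \<longrightarrow> \<gamma> a = \<gamma> b)" for a b
  have "Q s t" using st(3)
  proof (induction rule: Bolzano)
    case (trans a b c)
    then show ?case unfolding Q_def by auto
  next
    case (local r)
    then have rI: "r \<in> I" using sub by auto
    obtain \<phi> where c: "\<phi> \<in> Atlas M" "\<gamma> r \<in> fst \<phi>" using chart_at_\<gamma>[OF rI] .
    obtain W where W: "open W" "dom \<phi> = I \<inter> W" using dom_open[OF c(1)] .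
    have "r \<in> W" using W c rI by auto
    then obtain d where d: "d > 0" "ball r d \<subseteq> W" using W(1) openE by blast
    show ?case
    proof (intro exI[of _ d] conjI d allI impI)
      fix a b assume ab: "a \<le> r \<and> r \<le> b \<and> b - a < d"
      show "Q a b" unfolding Q_def
      proof
        assume le: "s \<le> a \<and> a \<le> b \<and> b \<le> t"
        have "{a..b} \<subseteq> I \<inter> ball r d" using le sub ab by (auto simp: dist_real_def)
        then have dm: "{a..b} \<subseteq> dom \<phi>" using W d by blast
        have "(x \<phi> has_vector_derivative 0) (at u within {a..b})" if "u \<in> {a..b}" for u
        proof -
          have u: "u \<in> I" "\<gamma> u \<in> fst \<phi>" "{a..b} \<subseteq> I" using dm that by auto
          show ?thesis using x_has_vector_derivative[OF c(1) u] 0[OF u(1)] by simp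
        qed
        then obtain k where k: "\<And>u. u \<in> {a..b} \<Longrightarrow> x \<phi> u = k"
          using has_vector_derivative_zero_constant[of "{a..b}" "x \<phi>"] by auto
        have "x \<phi> a = x \<phi> b" using k[of a] k[of b] le by simp
        then show "\<gamma> a = \<gamma> b" by (rule inj_onD[OF chart_inj[OF c(1)]]) (use dm le in auto)
      qed
    qed
  qed
  then show ?thesis using st unfolding Q_def by simp
qed

text \<open>Geodesics have constant speed, so a single zero of the velocity would make the curve
  constant.\<close>

lemma w_nonzero: assumes t: "t \<in> I" shows "w t \<noteq> 0"
proof
  assume wt: "w t = 0"
  have "((\<lambda>t. ip M (\<gamma> t) (w t) (w t)) has_vector_derivative 0) (at r within I)" if r: "r \<in> I" for r
    using ip_has_derivative[OF covd_w covd_w subset_refl r] ip_zero[OF r w_tangent[OF r]] by simp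
  then obtain k where k: "\<And>r. r \<in> I \<Longrightarrow> ip M (\<gamma> r) (w r) (w r) = k"
    using has_vector_derivative_zero_constant[OF is_interval_convex[OF interval], of "\<lambda>t. ip M (\<gamma> t) (w t) (w t)"] by auto
  have "k = 0" using k[OF t] wt ip_zero[OF t tangent_zero] by simp
  then have w0: "w r = 0" if "r \<in> I" for r
    using k[OF that] ip_props(4)[OF \<gamma>_topspace[OF that] w_tangent[OF that] w_tangent[OF that]] by fastforce
  have "\<gamma> r = \<gamma> t" if "r \<in> I" for r
    using constant_if_w_zero[OF w0 that t] constant_if_w_zero[OF w0 t that] linear[of r t] by metis
  then show False using nonconstant unfolding constant_on_def by blast
qed

text \<open>\<open>without_conjugate_points\<close> speaks of non-constant geodesics. That the
  restriction is non-constant does not follow from the assumption on \<open>I\<close> alone; it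
  follows from the velocity having no zeros.\<close>

lemma geodesic_restrict:
  assumes ab: "a < b" "{a..b} \<subseteq> I"
  shows "geodesic M {a..b} \<gamma>" "\<not> \<gamma> constant_on {a..b}"
proof -
  have u: "uds {a..b}" by (rule uds_real_interval[of "{a..b}" a b]) (use ab in auto)
  have "covd {a..b} (velocity M {a..b} \<gamma>) (\<lambda>_. 0)"
    by (rule covd_cong[OF covd_subset[OF covd_w ab(2)] velocity_restrict[OF u ab(2), symmetric] refl])
  from cov_deriv_covd[OF u ab(2) this] show "geodesic M {a..b} \<gamma>"
    unfolding geodesic_def using smooth_curve_restrict[OF ab] by (simp add: zero_fun_def)
  show "\<not> \<gamma> constant_on {a..b}"
  proof
    assume "\<gamma> constant_on {a..b}"
    then obtain k where k: "\<And>t. t \<in> {a..b} \<Longrightarrow> \<gamma> t = k" unfolding constant_on_def by blast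
    have a: "a \<in> {a..b}" using ab by simp
    then have aI: "a \<in> I" using ab by blast
    obtain \<phi> where c: "\<phi> \<in> Atlas M" "\<gamma> a \<in> fst \<phi>" using chart_at_\<gamma>[OF aI] .
    have "(x \<phi> has_vector_derivative 0) (at a within {a..b})"
      by (rule has_vector_derivative_transform[OF a _ has_vector_derivative_const[of "snd \<phi> k"]]) (simp add: k)
    then have "w a \<phi> = 0"
      using uds_vector_derivative[OF u a] x_has_vector_derivative[OF c(1) aI c(2) ab(2)] by metis
    then have "w a = 0" using tangent_eqI[OF w_tangent[OF aI] tangent_zero c] by simp
    then show False using w_nonzero[OF aI] by simp
  qed
qed

text \<open>A solution of the equation in the frame is turned back into a Jacobi field over the
  closed interval, to which the geometric assumption applies.\<close>

lemma no_conj_ode: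
  assumes nc: "without_conjugate_points M" and F: "frame a b P q" and ode: "jacobi_ode a b Rh q"
    and Rh: "\<And>t u. t \<in> {a..b} \<Longrightarrow> P t (Rh t u) = Rop t (P t u)"
    and sm: "\<And>u \<phi>. \<phi> \<in> Atlas M \<Longrightarrow> smooth_on ({a..b} \<inter> dom \<phi>) (\<lambda>t. Rh t u)"
  shows "jacobi_ode_no_conj a b Rh q"
proof -
  interpret E: jacobi_ode a b Rh q by (rule ode)
  show ?thesis
  proof
    fix y z c assume c: "a < c" "c \<le> b" and s: "E.sol c y z" and y: "y a = 0" "y c = 0"
    have sub: "{a..c} \<subseteq> {a..b}" using c by auto
    have subI: "{a..c} \<subseteq> I" using sub frameD(2)[OF F] by blast
    note Fc = frame_subset[OF F c]
    have u: "uds {a..c}" by (rule uds_real_interval[of "{a..c}" a c]) (use c in auto)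
    have Rhc: "P t (Rh t u) = Rop t (P t u)" if "t \<in> {a..c}" for t u using Rh sub that by blast
    have linc: "linear (Rh t)" if "t \<in> {a..c}" for t using E.lin sub that by blast
    \<comment> \<open>The extension by 0 outside is part of \<open>field_along\<close>, and makes
      \<open>J = 0\<close> an equation between functions on the whole line.\<close>
    define J where "J t = (if t \<in> {a..c} then P t (y t) else 0)" for t
    have "jac {a..c} (\<lambda>t. P t (y t)) (\<lambda>t. P t (z t))"
      by (rule jac_from_components[where Rh = Rh, OF Fc Rhc E.solD[OF s]])
    then have J1: "covd {a..c} J (\<lambda>t. P t (z t))" and J2: "covd {a..c} (\<lambda>t. P t (z t)) (\<lambda>t. - Rop t (J t))"
      unfolding jac_def by (auto intro: covd_cong simp: J_def)
    have "jacobi_field M {a..c} \<gamma> J"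
      unfolding jacobi_field_def field_along_def
    proof (intro conjI ballI allI impI)
      show "J t \<in> tangent_space M (\<gamma> t)" if "t \<in> {a..c}" for t using covdD(1)[OF J1 that] .
      show "J t = 0" if "t \<notin> {a..c}" for t using that unfolding J_def by (rule if_not_P)
      show "smooth_on {t \<in> {a..c}. \<gamma> t \<in> fst \<phi>} (\<lambda>t. J t \<phi>)" if ch: "\<phi> \<in> Atlas M" for \<phi>
      proof -
        have eq: "{t \<in> {a..c}. \<gamma> t \<in> fst \<phi>} = {a..c} \<inter> dom \<phi>" using subI by auto
        note uc = uds_sub[OF c(1) subI ch] and ub = uds_sub[OF frameD(1,2)[OF F] ch]
        have "smooth_on ({a..c} \<inter> dom \<phi>) (\<lambda>t. Rh t u)" for u
          by (rule smooth_on_subset[OF ub uc _ sm[OF ch]]) (use sub in blast)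
        from jac_smooth[where Rh = Rh, OF Fc ch linc this E.solD[OF s]]
        have "smooth_on ({a..c} \<inter> dom \<phi>) (\<lambda>t. P t (y t) \<phi>)" .
        then show ?thesis unfolding eq by (rule smooth_on_cong[OF uc, rotated]) (simp add: J_def)
      qed
      fix t assume t: "t \<in> {a..c}"
      have "covd {a..c} (cov_deriv M {a..c} \<gamma> J) (\<lambda>t. - Rop t (J t))"
        by (rule covd_cong[OF J2 _ refl]) (simp add: cov_deriv_covd[OF u subI J1])
      from cov_deriv_covd[OF u subI this t]
      show "cov_deriv M {a..c} \<gamma> (cov_deriv M {a..c} \<gamma> J) t +
         curvature M (\<gamma> t) (J t) (velocity M {a..c} \<gamma> t) (velocity M {a..c} \<gamma> t) = 0"
        by (simp add: velocity_restrict[OF u subI t] Rop_def)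
    qed
    moreover have "J a = 0" "J c = 0" using y linear_0[OF frame_linear[OF F]] by (simp_all add: J_def)
    ultimately have J0: "J = 0"
      using nc geodesic_restrict[OF c(1) subI] c(1) unfolding without_conjugate_points_def by blast
    have y0: "y t = 0" if t: "t \<in> {a..c}" for t
    proof (rule frame_cancel[OF Fc t])
      show "P t (y t) = P t 0" using fun_cong[OF J0, of t] t linear_0[OF frame_linear[OF F], of t] by (simp add: J_def)
    qed
    have a: "a \<in> {a..c}" using c by simp
    have "(y has_vector_derivative 0) (at a within {a..c})"
      by (rule has_vector_derivative_transform[OF a _ has_vector_derivative_const[of 0]]) (simp add: y0)
    then show "z a = 0" using uds_vector_derivative[OF u a] E.solD(1)[OF s a] by metis
  qed
qed

text \<open>Formulated for any isotropic family of Jacobi fields, so that linear combinations of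
  members of \<open>\<Lambda>\<close> can be inserted without a proof that \<open>\<Lambda>\<close>
  is a subspace. The induction removes the largest point of \<open>T\<close>.\<close>

theorem vanishing_independent:
  assumes nc: "without_conjugate_points M" and T: "finite T" "T \<subseteq> I"
    and J: "\<And>t. t \<in> T \<Longrightarrow> jac I (J t) (J' t)" and 0: "\<And>t. t \<in> T \<Longrightarrow> J t t = 0"
    and iso: "\<And>s t r. s \<in> T \<Longrightarrow> t \<in> T \<Longrightarrow> r \<in> I \<Longrightarrow> ip M (\<gamma> r) (J' s r) (J t r) = ip M (\<gamma> r) (J s r) (J' t r)"
    and total: "\<And>r. r \<in> I \<Longrightarrow> (\<Sum>t\<in>T. J t r) = 0"
    and t: "t \<in> T" "r \<in> I"
  shows "J t r = 0"
  using T J 0 iso total t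
proof (induction T arbitrary: t r rule: finite_linorder_max_induct)
  case (insert b T)
  have bI: "b \<in> I" using insert.prems by simp
  have bT: "b \<notin> T" using insert.hyps(2) by blast
  have Jb: "J b r = 0" if r: "r \<in> I" for r
  proof (cases "T = {}")
    case True
    then show ?thesis using insert.prems(5)[OF r] by (simp add: zero_fun_def)
  next
    case False
    \<comment> \<open>Comparison with the matrix solution takes place on the interval from the
      smallest point of \<open>T\<close> to the largest point \<open>b\<close>.\<close>
    define a where "a = Min T"
    have aT: "a \<in> T" and amin: "\<And>t. t \<in> T \<Longrightarrow> a \<le> t" using Min_in Min_le insert.hyps(1) False by (simp_all add: a_def)
    have aI: "a \<in> I" using insert.prems(1) aT by blast
    have ab: "a < b" using insert.hyps(2) aT by blast
    have sub: "{a..b} \<subseteq> I" using aI bI interval unfolding is_interval_1 by (meson atLeastAtMost_iff subsetI)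
    obtain P q where F: "frame a b P q" using frame_exists[OF ab sub] by blast
    obtain Rh where ode: "jacobi_ode a b Rh q" and Rh: "\<And>t u. t \<in> {a..b} \<Longrightarrow> P t (Rh t u) = Rop t (P t u)"
      and sm: "\<And>u \<phi>. \<phi> \<in> Atlas M \<Longrightarrow> smooth_on ({a..b} \<inter> dom \<phi>) (\<lambda>t. Rh t u)"
      using frame_ode[OF F] by blast
    interpret E: jacobi_ode_no_conj a b Rh q by (rule no_conj_ode[OF nc F ode Rh sm])
    have "\<exists>y z. (\<forall>s\<in>{a..b}. J t s = P s (y s) \<and> J' t s = P s (z s)) \<and> E.sol b y z" if "t \<in> insert b T" for t
    proof -
      have "jac {a..b} (J t) (J' t)" using insert.prems(2)[OF that] covd_subset[OF _ sub] unfolding jac_def by blast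
      from jac_components[where Rh = Rh, OF F Rh this] show ?thesis unfolding E.sol_def by blast
    qed
    then obtain y z where yz: "\<And>t s. t \<in> insert b T \<Longrightarrow> s \<in> {a..b} \<Longrightarrow> J t s = P s (y t s)"
      "\<And>t s. t \<in> insert b T \<Longrightarrow> s \<in> {a..b} \<Longrightarrow> J' t s = P s (z t s)" "\<And>t. t \<in> insert b T \<Longrightarrow> E.sol b (y t) (z t)"
      by metis
    have inab: "t \<in> {a..b}" if "t \<in> insert b T" for t using that amin insert.hyps(2) ab by (auto simp: less_imp_le)
    \<comment> \<open>\<open>isotropic_sum_last\<close> lists the two end points apart from the
      inner points.\<close>
    have split: "insert a (insert b (T - {a})) = insert b T" using aT by blast
    note P0 = linear_0[OF frame_linear[OF F]]
    have bb: "b \<in> {a..b}" using ab by simp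
    have "z b b = 0"
    proof (rule E.isotropic_sum_last[where T = "T - {a}" and y = y and z = z], unfold split)
      show "T - {a} \<subseteq> {a<..<b}"
      proof
        fix t assume t: "t \<in> T - {a}"
        then have "a \<le> t" "t \<noteq> a" "t < b" using amin insert.hyps(2) by auto
        then show "t \<in> {a<..<b}" by simp
      qed
      show "y t t = 0" if t: "t \<in> insert b T" for t
        by (rule frame_cancel[OF F inab[OF t]]) (simp add: yz(1)[OF t inab[OF t], symmetric] insert.prems(3)[OF t] P0 zero_fun_def)
      show "q (z s r) (y t r) = q (y s r) (z t r)" if st: "s \<in> insert b T" "t \<in> insert b T" and r: "r \<in> {a..b}" for s t r
        using insert.prems(4)[OF st subsetD[OF sub r]]
        unfolding yz(1)[OF st(1) r] yz(1)[OF st(2) r] yz(2)[OF st(1) r] yz(2)[OF st(2) r] frameD(5)[OF F r] .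
      show "y a r + (\<Sum>t\<in>T - {a}. y t r) + y b r = 0" if r: "r \<in> {a..b}" for r
      proof (rule frame_cancel[OF F r])
        have rI: "r \<in> I" using r sub by blast
        have "y a r + (\<Sum>t\<in>T - {a}. y t r) + y b r = (\<Sum>t\<in>insert b T. y t r)"
          using sum.remove[OF insert.hyps(1) aT, of "\<lambda>t. y t r"] insert.hyps(1) bT by (simp add: add_ac)
        then have "P r (y a r + (\<Sum>t\<in>T - {a}. y t r) + y b r) = (\<Sum>t\<in>insert b T. P r (y t r))"
          by (simp only: linear_sum[OF frame_linear[OF F]])
        also have "\<dots> = (\<Sum>t\<in>insert b T. J t r)" by (rule sum.cong) (simp_all only: yz(1) r)
        also have "\<dots> = P r 0" unfolding insert.prems(5)[OF rI] P0 ..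
        finally show "P r (y a r + (\<Sum>t\<in>T - {a}. y t r) + y b r) = P r 0" .
      qed
    qed (use yz(3) insert.hyps(1) in simp_all)
    then have "J' b b = 0" using yz(2)[OF _ bb, of b] P0 by simp
    show ?thesis by (rule jac_unique[OF insert.prems(2) bI insert.prems(3) \<open>J' b b = 0\<close> r]) (rule insertI1)+
  qed
  have total': "(\<Sum>t\<in>T. J t r) = 0" if "r \<in> I" for r
    using insert.prems(5)[OF that] unfolding sum.insert[OF insert.hyps(1) bT] Jb[OF that] by (rule back_subst[of "\<lambda>v. v = 0"]) (rule add_0)
  show ?case
  proof (cases "t = b")
    case True
    then show ?thesis using Jb insert.prems(7) by simp
  next
    case False
    show ?thesis
    proof (rule insert.IH[OF _ _ _ _ total'])
      show "ip M (\<gamma> r) (J' s r) (J t r) = ip M (\<gamma> r) (J s r) (J' t r)" if "s \<in> T" "t \<in> T" "r \<in> I" for s t r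
        using insert.prems(4)[of s t r] that by simp
    qed (use insert.prems False in auto)
  qed
qed simp

end

section \<open>Submanifolds and their shape operators\<close>

text \<open>A linear projection onto \<open>L\<close> fixes the curve, hence also its
  derivative.\<close>

lemma vector_derivative_in_subspace:
  fixes f :: "real \<Rightarrow> 'e::euclidean_space"
  assumes L: "subspace L" and S: "uds S" "t \<in> S" and f: "\<And>s. s \<in> S \<Longrightarrow> f s \<in> L"
    and D: "(f has_vector_derivative D) (at t within S)"
  shows "D \<in> L"
proof -
  obtain p where p: "linear p" "\<And>x. p x \<in> L" "\<And>x. x \<in> L \<Longrightarrow> p x = x"
    using subspace_projection[OF L] by blast
  have "bounded_linear p" using p(1) by (simp add: linear_conv_bounded_linear)
  from bounded_linear.has_vector_derivative[OF this D]
  have pD: "(f has_vector_derivative p D) (at t within S)"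
    by (rule has_vector_derivative_transform[OF S(2), rotated]) (simp add: p(3)[OF f])
  have "D = p D" using uds_vector_derivative[OF S D] uds_vector_derivative[OF S pD] by simp
  then show ?thesis using p(2) by metis
qed

text \<open>Independence of an indexed family. Injectivity is part of it: a repeated value would
  give a relation with coefficients 1 and -1.\<close>

lemma card_le_dim_family:
  fixes h :: "'i \<Rightarrow> 'e::euclidean_space"
  assumes X: "finite X" and L: "\<And>x. x \<in> X \<Longrightarrow> h x \<in> L"
    and ind: "\<And>c x. (\<Sum>x\<in>X. c x *\<^sub>R h x) = 0 \<Longrightarrow> x \<in> X \<Longrightarrow> c x = (0::real)"
  shows "card X \<le> dim L"
proof -
  have inj: "inj_on h X"
  proof (rule inj_onI, rule ccontr)
    fix x y assume xy: "x \<in> X" "y \<in> X" "h x = h y" "x \<noteq> y"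
    let ?c = "\<lambda>z. (if z = x then 1 else 0) - (if z = y then 1 else (0::real))"
    have "(\<Sum>z\<in>X. ?c z *\<^sub>R h z) = (\<Sum>z\<in>X. (if z = x then h z else 0)) - (\<Sum>z\<in>X. (if z = y then h z else 0))"
      unfolding sum_subtractf[symmetric] by (rule sum.cong) (auto simp: scaleR_diff_left)
    also have "\<dots> = 0" using xy X by (simp add: sum.delta)
    finally have "?c x = 0" by (rule ind[OF _ xy(1)])
    then show False using xy(4) by simp
  qed
  have "independent (h ` X)"
  proof (rule ccontr)
    assume "\<not> independent (h ` X)"
    then obtain u v where u: "v \<in> h ` X" "u v \<noteq> 0" "(\<Sum>v\<in>h ` X. u v *\<^sub>R v) = 0"
      using dependent_finite[of "h ` X"] X by blast
    then obtain x where x: "x \<in> X" "v = h x" by blast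
    have "(\<Sum>x\<in>X. u (h x) *\<^sub>R h x) = 0" using u(3) sum.reindex[OF inj, of "\<lambda>v. u v *\<^sub>R v"] by (simp add: o_def)
    from ind[OF this x(1)] show False using u(2) x(2) by simp
  qed
  then have "card (h ` X) \<le> dim L" using L by (intro independent_card_le_dim) auto
  then show ?thesis using card_image[OF inj] by simp
qed

lemma sum_fun_apply: "(\<Sum>i\<in>A. f i) x = (\<Sum>i\<in>A. f i x)"
  by (induction A rule: infinite_finite_induct) simp_all

locale riem_submanifold = riem_mfd M for M :: "('a, 'e::euclidean_space) riem" +
  fixes k :: nat and N :: "'a topology"
  assumes submanifold: "submanifold M k N"
begin

section \<open>Slice charts and the tangent spaces of a submanifold\<close>

lemma slice:
  assumes "slice_chart M k N \<phi> W L"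
  shows "\<phi> \<in> Atlas M" "openin N W" "W \<subseteq> fst \<phi>" "subspace L" "dim L = k"
    "homeomorphic_map (subtopology N W) (top_of_set (U \<phi> \<inter> L)) (snd \<phi>)" "snd \<phi> ` W = U \<phi> \<inter> L"
proof -
  show s: "\<phi> \<in> Atlas M" "openin N W" "W \<subseteq> fst \<phi>" "subspace L" "dim L = k"
    "homeomorphic_map (subtopology N W) (top_of_set (U \<phi> \<inter> L)) (snd \<phi>)"
    using assms unfolding slice_chart_def by auto
  have "topspace (subtopology N W) = W" using openin_subset[OF s(2)] by auto
  then show "snd \<phi> ` W = U \<phi> \<inter> L" using homeomorphic_imp_surjective_map[OF s(6)] by simp
qed

text \<open>\<open>N\<close> may be finer than the subspace topology, so openness is transported by
  the slice chart, which is a homeomorphism for the topology of \<open>N\<close>.\<close>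

lemma slice_open_image:
  assumes s: "slice_chart M k N \<phi> W L" and V: "openin N V"
  obtains Q where "open Q" "snd \<phi> ` (W \<inter> V) = U \<phi> \<inter> L \<inter> Q"
proof -
  have "openin (subtopology N W) (W \<inter> V)" using V by (simp add: openin_subtopology_Int2)
  then have "openin (top_of_set (U \<phi> \<inter> L)) (snd \<phi> ` (W \<inter> V))"
    using homeomorphic_imp_open_map[OF slice(6)[OF s]] unfolding open_map_def by blast
  then show thesis unfolding openin_open using that by blast
qed

text \<open>The straight line in \<open>L\<close> through the point stays, for small parameters, in
  both slices. Its image under the transition therefore runs in \<open>L'\<close>, and so does the
  derivative.\<close>

lemma slice_transition:
  assumes s: "slice_chart M k N \<phi> W L" and s': "slice_chart M k N \<psi> W' L'" and p: "p \<in> W" "p \<in> W'" and u: "u \<in> L"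
  shows "tr \<phi> \<psi> (snd \<phi> p) u \<in> L'"
proof -
  obtain Q where Q: "open Q" "snd \<phi> ` (W \<inter> W') = U \<phi> \<inter> L \<inter> Q" using slice_open_image[OF s slice(2)[OF s']] .
  note c = slice(1)[OF s] slice(1)[OF s']
  have pp: "p \<in> fst \<phi>" "p \<in> fst \<psi>" using p slice(3)[OF s] slice(3)[OF s'] by auto
  define S where "S = (\<lambda>t::real. snd \<phi> p + t *\<^sub>R u) -` (U \<phi> \<inter> Q)"
  have "open S" unfolding S_def
    by (rule open_vimage[OF open_Int[OF open_U[OF c(1)] Q(1)]]) (intro continuous_intros)
  then have uS: "uds S" by (rule open_uds)
  have "snd \<phi> p \<in> snd \<phi> ` (W \<inter> W')" using p by blast
  then have pQ: "snd \<phi> p \<in> U \<phi> \<inter> L \<inter> Q" using Q(2) by simp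
  then have 0: "0 \<in> S" unfolding S_def by simp
  have "((\<lambda>t. transition \<phi> \<psi> (snd \<phi> p + t *\<^sub>R u + 0)) has_vector_derivative tr \<phi> \<psi> (snd \<phi> p + 0 *\<^sub>R u + 0) u) (at 0 within S)"
    by (rule line_derivative[OF open_overlap[OF c] smooth_transition[OF c]]) (use pp in simp)
  then have D: "((\<lambda>t. transition \<phi> \<psi> (snd \<phi> p + t *\<^sub>R u)) has_vector_derivative tr \<phi> \<psi> (snd \<phi> p) u) (at 0 within S)" by simp
  show ?thesis
  proof (rule vector_derivative_in_subspace[OF slice(4)[OF s'] uS 0 _ D])
    fix t assume "t \<in> S"
    then have "snd \<phi> p + t *\<^sub>R u \<in> U \<phi> \<inter> L \<inter> Q"
      using pQ u slice(4)[OF s] unfolding S_def by (simp add: subspace_add subspace_scale)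
    then obtain r where r: "r \<in> W" "r \<in> W'" "snd \<phi> p + t *\<^sub>R u = snd \<phi> r" using Q(2) by blast
    have "snd \<psi> r \<in> L'" using slice(7)[OF s'] r(2) by blast
    then show "transition \<phi> \<psi> (snd \<phi> p + t *\<^sub>R u) \<in> L'"
      using r slice(3)[OF s] transition_snd[OF c(1), of r \<psi>] by auto
  qed
qed

text \<open>The definition asks for some slice chart; by \<open>slice_transition\<close> any one of
  them decides.\<close>

lemma tangent_sub_iff:
  assumes s: "slice_chart M k N \<phi> W L" and p: "p \<in> W"
  shows "v \<in> tangent_sub M k N p \<longleftrightarrow> v \<in> tangent_space M p \<and> v \<phi> \<in> L"
proof
  assume "v \<in> tangent_sub M k N p"
  then obtain \<psi> W' L' where v: "v \<in> tangent_space M p" and p': "p \<in> W'" and s': "slice_chart M k N \<psi> W' L'" and vL: "v \<psi> \<in> L'"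
    unfolding tangent_sub_def by blast
  have pp: "p \<in> fst \<phi>" "p \<in> fst \<psi>" using p p' slice(3)[OF s] slice(3)[OF s'] by auto
  have "v \<phi> = tr \<psi> \<phi> (snd \<psi> p) (v \<psi>)" using tangent_transform[OF v slice(1)[OF s'] pp(2) slice(1)[OF s] pp(1)] .
  then show "v \<in> tangent_space M p \<and> v \<phi> \<in> L" using v slice_transition[OF s' s p' p vL] by simp
next
  assume "v \<in> tangent_space M p \<and> v \<phi> \<in> L"
  then show "v \<in> tangent_sub M k N p" unfolding tangent_sub_def using s p by blast
qed

section \<open>Second fundamental form and shape operator at a point, in a slice chart\<close>

context
  fixes \<phi> :: "('a, 'e) chart" and W :: "'a set" and L :: "'e set" and p :: 'a
  assumes s: "slice_chart M k N \<phi> W L" and p: "p \<in> W"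
begin

lemma slice_p: "\<phi> \<in> Atlas M" "p \<in> fst \<phi>" "snd \<phi> p \<in> U \<phi>" "snd \<phi> p \<in> L"
proof -
  show "\<phi> \<in> Atlas M" "p \<in> fst \<phi>" using slice(1,3)[OF s] p by auto
  have "snd \<phi> p \<in> U \<phi> \<inter> L" using slice(7)[OF s] p by blast
  then show "snd \<phi> p \<in> U \<phi>" "snd \<phi> p \<in> L" by auto
qed

lemma coord_vec_sub: "u \<in> L \<Longrightarrow> coord_vec M \<phi> p u \<in> tangent_sub M k N p"
  using tangent_sub_iff[OF s p] coord_vec_tangent[OF slice_p(1,2)] coord_vec_chart[OF slice_p(1,2)] by simp

lemma normal_tangent: "v \<in> normal_space M k N p \<Longrightarrow> v \<in> tangent_space M p"
  unfolding normal_space_def by blast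

lemma normal_orth:
  assumes v: "v \<in> normal_space M k N p" and l: "l \<in> L"
  shows "g \<phi> (snd \<phi> p) (v \<phi>) l = 0" "g \<phi> (snd \<phi> p) l (v \<phi>) = 0"
proof -
  have "ip M p v (coord_vec M \<phi> p l) = 0" using v coord_vec_sub[OF l] unfolding normal_space_def by blast
  then show "g \<phi> (snd \<phi> p) (v \<phi>) l = 0"
    using ip_coord[OF normal_tangent[OF v] coord_vec_tangent[OF slice_p(1,2)] slice_p(1,2), of l]
    by (simp add: coord_vec_chart[OF slice_p(1,2)])
  then show "g \<phi> (snd \<phi> p) l (v \<phi>) = 0" using g_commute[OF slice_p(1,3), of l] by simp
qed

text \<open>\<open>l\<close> is the tangential part of \<open>d\<close>, the orthogonal projection
  with respect to the metric at \<open>p\<close>.\<close>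

lemma normal_part:
  obtains l where "l \<in> L" "coord_vec M \<phi> p (d - l) \<in> normal_space M k N p"
proof -
  note gx = g_linear1[OF slice_p(1,3)] g_linear2[OF slice_p(1,3)] g_pos[OF slice_p(1,3)]
  obtain l where l: "l \<in> L" "\<And>m. m \<in> L \<Longrightarrow> g \<phi> (snd \<phi> p) l m = g \<phi> (snd \<phi> p) d m"
    using riesz_subspace[where g = "g \<phi> (snd \<phi> p)" and f = "g \<phi> (snd \<phi> p) d", OF gx slice(4)[OF s] gx(2)] by blast
  have "coord_vec M \<phi> p (d - l) \<in> normal_space M k N p"
    unfolding normal_space_def
  proof (intro CollectI conjI ballI coord_vec_tangent[OF slice_p(1,2)])
    fix y assume "y \<in> tangent_sub M k N p"
    then have y: "y \<in> tangent_space M p" "y \<phi> \<in> L" using tangent_sub_iff[OF s p] by auto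
    show "ip M p (coord_vec M \<phi> p (d - l)) y = 0"
      using ip_coord[OF coord_vec_tangent[OF slice_p(1,2)] y(1) slice_p(1,2), of "d - l"] l(2)[OF y(2)]
      by (simp add: coord_vec_chart[OF slice_p(1,2)] linear_diff[OF gx(1)])
  qed
  with l(1) show thesis by (rule that)
qed

text \<open>The curve and the field that realise \<open>II(x, y)\<close> are a straight line and a constant field
  in the slice chart.\<close>

lemma second_ff_witness:
  assumes X: "X \<in> tangent_sub M k N p" and Y: "Y \<in> tangent_sub M k N p"
  shows "\<exists>\<epsilon>>0. \<exists>c V. let I = {-\<epsilon><..<\<epsilon>} in
        smooth_curve M I c \<and> continuous_map (top_of_set I) N c \<and>
        c 0 = p \<and> velocity M I c 0 = X \<and>
        field_along M I c V \<and> (\<forall>t\<in>I. V t \<in> tangent_sub M k N (c t)) \<and> V 0 = Y \<and>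
        cov_deriv M I c V 0 = coord_vec M \<phi> p (\<Gamma> \<phi> (snd \<phi> p) (X \<phi>) (Y \<phi>))"
proof -
  note cp = slice_p(1,2)
  let ?u = "X \<phi>" and ?x = "snd \<phi> p"
  have XL: "X \<in> tangent_space M p" "?u \<in> L" and YL: "Y \<in> tangent_space M p" "Y \<phi> \<in> L"
    using X Y tangent_sub_iff[OF s p] by auto
  obtain r where r: "r > 0" "ball ?x r \<subseteq> U \<phi>" using open_U[OF cp(1)] slice_p(3) openE by blast
  \<comment> \<open>For parameters below this bound the line stays in the ball of radius
    \<open>r\<close>; the summand 1 allows \<open>X\<close> to be zero.\<close>
  define \<epsilon> where "\<epsilon> = r / (norm ?u + 1)"
  have n1: "norm ?u + 1 > 0" by (smt (verit) norm_ge_zero)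
  have \<epsilon>: "\<epsilon> > 0" using r n1 by (simp add: \<epsilon>_def)
  define I where "I = {-\<epsilon><..<\<epsilon>}"
  let ?l = "\<lambda>t::real. ?x + t *\<^sub>R ?u"
  have lUL: "?l t \<in> U \<phi> \<inter> L" if "t \<in> I" for t
  proof
    have "\<bar>t\<bar> * norm ?u \<le> \<bar>t\<bar> * (norm ?u + 1)" by (simp add: mult_left_mono)
    also have "\<dots> < \<epsilon> * (norm ?u + 1)" using that n1 by (intro mult_strict_right_mono) (auto simp: I_def)
    also have "\<dots> = r" using n1 by (simp add: \<epsilon>_def)
    finally have "?l t \<in> ball ?x r" by (simp add: dist_norm)
    then show "?l t \<in> U \<phi>" using r(2) by blast
    show "?l t \<in> L" using slice(4)[OF s] slice_p(4) XL(2) by (simp add: subspace_add subspace_scale)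
  qed
  define c where "c t = chart_inv \<phi> (?l t)" for t
  have cW: "c t \<in> W \<and> snd \<phi> (c t) = ?l t" if t: "t \<in> I" for t
  proof -
    obtain q where q: "q \<in> W" "?l t = snd \<phi> q" using lUL[OF t] slice(7)[OF s] by blast
    have "q \<in> fst \<phi>" using q(1) slice(3)[OF s] by blast
    then have "c t = q" unfolding c_def q(2) by (rule chart_inv_snd[OF cp(1)])
    then show ?thesis using q by simp
  qed
  have cphi: "c t \<in> fst \<phi>" if "t \<in> I" for t using cW[OF that] slice(3)[OF s] by blast
  have I: "open I" "is_interval I" "0 \<in> I" using \<epsilon> by (auto simp: I_def is_interval_1)
  have c0: "c 0 = p" using chart_inv_snd[OF cp] by (simp add: c_def)
  have open_pre: "open {t \<in> I. ?l t \<in> Q}" if "open Q" for Q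
  proof -
    have "open (?l -` Q)" by (rule open_vimage[OF that]) (intro continuous_intros)
    then have "open (I \<inter> ?l -` Q)" using I(1) by blast
    moreover have "I \<inter> ?l -` Q = {t \<in> I. ?l t \<in> Q}" by auto
    ultimately show ?thesis by simp
  qed
  have openinI: "openin (top_of_set I) S" if "open S" "S \<subseteq> I" for S
    using that open_subset by blast
  have contN: "continuous_map (top_of_set I) N c"
    unfolding continuous_map_def
  proof (intro conjI allI impI)
    show "c \<in> topspace (top_of_set I) \<rightarrow> topspace N"
      using cW openin_subset[OF slice(2)[OF s]] by auto
    fix V assume "openin N V"
    then obtain Q where Q: "open Q" "snd \<phi> ` (W \<inter> V) = U \<phi> \<inter> L \<inter> Q" using slice_open_image[OF s] by metis
    have "c t \<in> V \<longleftrightarrow> ?l t \<in> Q" if t: "t \<in> I" for t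
    proof
      assume "c t \<in> V"
      then have "snd \<phi> (c t) \<in> snd \<phi> ` (W \<inter> V)" using cW[OF t] by blast
      then show "?l t \<in> Q" using Q(2) cW[OF t] by auto
    next
      assume "?l t \<in> Q"
      then have "?l t \<in> snd \<phi> ` (W \<inter> V)" using Q(2) lUL[OF t] by blast
      then obtain q where q: "q \<in> W" "q \<in> V" "?l t = snd \<phi> q" by blast
      have "c t = q" using inj_onD[OF chart_inj[OF cp(1)], of "c t" q] cW[OF t] q cphi[OF t] slice(3)[OF s] by auto
      then show "c t \<in> V" using q by simp
    qed
    then have "{t \<in> topspace (top_of_set I). c t \<in> V} = {t \<in> I. ?l t \<in> Q}" by auto
    then show "openin (top_of_set I) {t \<in> topspace (top_of_set I). c t \<in> V}"
      using openinI[OF open_pre[OF Q(1)]] by auto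
  qed
  have pre_chart: "{t \<in> I. c t \<in> fst \<psi>} = {t \<in> I. ?l t \<in> overlap \<phi> \<psi>}" for \<psi>
  proof (intro Collect_cong conj_cong refl iffI)
    fix t assume t: "t \<in> I"
    { assume "c t \<in> fst \<psi>"
      then show "?l t \<in> overlap \<phi> \<psi>" using cW[OF t] cphi[OF t] by (metis IntI image_eqI) }
    { assume "?l t \<in> overlap \<phi> \<psi>"
      then obtain q where q: "q \<in> fst \<phi>" "q \<in> fst \<psi>" "?l t = snd \<phi> q" by blast
      have "c t = q" using inj_onD[OF chart_inj[OF cp(1)], of "c t" q] cW[OF t] q cphi[OF t] by auto
      then show "c t \<in> fst \<psi>" using q by simp }
  qed
  have contM: "continuous_map (top_of_set I) (Top M) c"
    unfolding continuous_map_def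
  proof (intro conjI allI impI)
    show "c \<in> topspace (top_of_set I) \<rightarrow> topspace (Top M)" using cphi chart_topspace[OF cp(1)] by auto
    fix V assume V: "openin (Top M) V"
    have "openin (subtopology (Top M) (fst \<phi>)) (fst \<phi> \<inter> V)" using V by (simp add: openin_subtopology_Int2)
    then have "openin (top_of_set (U \<phi>)) (snd \<phi> ` (fst \<phi> \<inter> V))"
      using homeomorphic_imp_open_map[OF chart_homeo[OF cp(1)]] unfolding open_map_def by blast
    then have oV: "open (snd \<phi> ` (fst \<phi> \<inter> V))" using open_U[OF cp(1)] openin_open_eq by blast
    have "c t \<in> V \<longleftrightarrow> ?l t \<in> snd \<phi> ` (fst \<phi> \<inter> V)" if t: "t \<in> I" for t
    proof
      assume "c t \<in> V"
      then show "?l t \<in> snd \<phi> ` (fst \<phi> \<inter> V)" using cW[OF t] cphi[OF t] by (metis IntI image_eqI)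
    next
      assume "?l t \<in> snd \<phi> ` (fst \<phi> \<inter> V)"
      then obtain q where q: "q \<in> fst \<phi>" "q \<in> V" "?l t = snd \<phi> q" by blast
      have "c t = q" using inj_onD[OF chart_inj[OF cp(1)], of "c t" q] cW[OF t] q cphi[OF t] by auto
      then show "c t \<in> V" using q by simp
    qed
    then have "{t \<in> topspace (top_of_set I). c t \<in> V} = {t \<in> I. ?l t \<in> snd \<phi> ` (fst \<phi> \<inter> V)}" by auto
    then show "openin (top_of_set I) {t \<in> topspace (top_of_set I). c t \<in> V}"
      using openinI[OF open_pre[OF oV]] by auto
  qed
  have smooth_line: "smooth_on S ?l" if "uds S" for S
    by (intro smooth_on_add that smooth_on_const smooth_on_bounded_linear[OF bounded_linear_scaleR_left]
        smooth_on_real_iff[THEN iffD2, where D1 = "\<lambda>_. 1"])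
      (auto intro: has_vector_derivative_id smooth_on_const that)
  have comp: "smooth_on {t \<in> I. c t \<in> fst \<psi>} (\<lambda>t. f (?l t))"
    if ps: "\<psi> \<in> Atlas M" and f: "smooth_on (overlap \<phi> \<psi>) f" for \<psi> and f :: "'e \<Rightarrow> 'e"
  proof -
    have u: "uds {t \<in> I. ?l t \<in> overlap \<phi> \<psi>}" by (rule open_uds[OF open_pre[OF open_overlap[OF cp(1) ps]]])
    show ?thesis unfolding pre_chart
      by (rule smooth_on_compose[OF u open_uds[OF open_overlap[OF cp(1) ps]] _ smooth_line[OF u] f]) auto
  qed
  have uds_chart: "uds {t \<in> I. c t \<in> fst \<psi>}" if "\<psi> \<in> Atlas M" for \<psi>
    unfolding pre_chart by (rule open_uds[OF open_pre[OF open_overlap[OF cp(1) that]]])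
  have sc: "smooth_curve M I c"
    unfolding smooth_curve_def
  proof (intro conjI contM ballI)
    fix \<psi> assume ps: "\<psi> \<in> Atlas M"
    show "smooth_on {t \<in> I. c t \<in> fst \<psi>} (\<lambda>t. snd \<psi> (c t))"
    proof (rule smooth_on_cong[OF uds_chart[OF ps] _ comp[OF ps smooth_transition[OF cp(1) ps]]])
      fix t assume "t \<in> {t \<in> I. c t \<in> fst \<psi>}"
      then have t: "t \<in> I" by simp
      show "transition \<phi> \<psi> (?l t) = snd \<psi> (c t)" using transition_snd[OF cp(1) cphi[OF t], of \<psi>] cW[OF t] by simp
    qed
  qed
  have "-\<epsilon>/2 \<in> I" "\<epsilon>/2 \<in> I" "-\<epsilon>/2 < \<epsilon>/2" using \<epsilon> by (auto simp: I_def)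
  then interpret C: riem_curve M I c
    using sc I by unfold_locales blast+
  define V where "V t = (if t \<in> I then coord_vec M \<phi> (c t) (Y \<phi>) else 0)" for t
  have fa: "field_along M I c V"
    unfolding field_along_def
  proof (intro conjI ballI allI impI)
    show "V t \<in> tangent_space M (c t)" if "t \<in> I" for t
      using coord_vec_tangent[OF cp(1) cphi[OF that]] that by (simp add: V_def)
    show "V t = 0" if "t \<notin> I" for t using that unfolding V_def by (rule if_not_P)
    fix \<psi> assume ps: "\<psi> \<in> Atlas M"
    show "smooth_on {t \<in> I. c t \<in> fst \<psi>} (\<lambda>t. V t \<psi>)"
    proof (rule smooth_on_cong[OF uds_chart[OF ps] _ comp[OF ps smooth_tr[OF cp(1) ps, of "Y \<phi>"]]])
      fix t assume "t \<in> {t \<in> I. c t \<in> fst \<psi>}"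
      then have t: "t \<in> I" "c t \<in> fst \<psi>" by simp_all
      show "tr \<phi> \<psi> (?l t) (Y \<phi>) = V t \<psi>" using t ps cW[OF t(1)] by (simp add: V_def coord_vec_def chart_at_def)
    qed
  qed
  have c0phi: "c 0 \<in> fst \<phi>" using c0 cp by simp
  have Vphi: "V t \<phi> = Y \<phi>" if "t \<in> I" for t
    using that coord_vec_chart[OF cp(1) cphi[OF that]] by (simp add: V_def)
  have vphi: "C.w 0 \<phi> = ?u"
  proof -
    have "(?l has_vector_derivative ?u) (at 0 within I)" by (auto intro!: derivative_eq_intros)
    then have "((\<lambda>t. snd \<phi> (c t)) has_vector_derivative ?u) (at 0 within I)"
      by (rule has_vector_derivative_transform[OF I(3), rotated]) (simp add: cW)
    from uds_vector_derivative[OF C.uds_I I(3) this]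
      uds_vector_derivative[OF C.uds_I I(3) C.x_has_vector_derivative[OF cp(1) I(3) c0phi subset_refl]]
    show ?thesis by simp
  qed
  have vel: "velocity M I c 0 = X"
    using tangent_eqI[OF C.w_tangent[OF I(3), unfolded c0] XL(1) cp vphi] by (simp add: C.w_def)
  have V0: "V 0 = Y" using tangent_eq_coord_vec[OF YL(1) cp] c0 I(3) by (simp add: V_def)
  have Vsub: "V t \<in> tangent_sub M k N (c t)" if t: "t \<in> I" for t
  proof -
    have "c t \<in> W" using cW[OF t] by simp
    from tangent_sub_iff[OF s this] show ?thesis
      using fa t Vphi[OF t] YL(2) by (simp add: field_along_def)
  qed
  have cd: "cov_deriv M I c V 0 = coord_vec M \<phi> p (\<Gamma> \<phi> (snd \<phi> p) (X \<phi>) (Y \<phi>))"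
  proof (rule tangent_eqI[OF _ coord_vec_tangent[OF cp] cp])
    show "cov_deriv M I c V 0 \<in> tangent_space M p" using C.covdD(2)[OF C.field_covd[OF fa] I(3)] c0 by simp
    have "((\<lambda>t. V t \<phi>) has_vector_derivative 0) (at 0 within I)"
      by (rule has_vector_derivative_transform[OF I(3) _ has_vector_derivative_const[of "Y \<phi>"]]) (simp add: Vphi)
    from uds_vector_derivative[OF C.uds_I I(3) this]
      uds_vector_derivative[OF C.uds_I I(3) C.field_has_vector_derivative[OF fa I(3) cp(1) c0phi]]
    show "cov_deriv M I c V 0 \<phi> = coord_vec M \<phi> p (\<Gamma> \<phi> (snd \<phi> p) (X \<phi>) (Y \<phi>)) \<phi>"
      using vphi V0 c0 by (simp add: coord_vec_chart[OF cp])
  qed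
  show ?thesis
    unfolding Let_def using \<epsilon> sc contN c0 vel fa Vsub V0 cd unfolding I_def by blast
qed

text \<open>In the slice chart a field tangent to \<open>N\<close> takes values in \<open>L\<close>,
  and so does its ordinary derivative. Modulo \<open>L\<close>, the covariant derivative is thus the
  Christoffel term, whatever curve and extension are chosen.\<close>

lemma second_ff_unique:
  assumes X: "X \<in> tangent_sub M k N p" and Y: "Y \<in> tangent_sub M k N p" and \<epsilon>: "\<epsilon> > 0" and I: "I = {-\<epsilon><..<\<epsilon>}"
    and sc: "smooth_curve M I c" and cN: "continuous_map (top_of_set I) N c"
    and c0: "c 0 = p" and vel: "velocity M I c 0 = X" and fa: "field_along M I c V"
    and Vsub: "\<forall>t\<in>I. V t \<in> tangent_sub M k N (c t)" and V0: "V 0 = Y"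
    and z: "cov_deriv M I c V 0 - z \<in> tangent_sub M k N p"
  shows "\<Gamma> \<phi> (snd \<phi> p) (X \<phi>) (Y \<phi>) - z \<phi> \<in> L"
proof -
  note cp = slice_p(1,2)
  have II: "open I" "is_interval I" "0 \<in> I" "-\<epsilon>/2 \<in> I" "\<epsilon>/2 \<in> I" "-\<epsilon>/2 < \<epsilon>/2" using \<epsilon> by (auto simp: I is_interval_1)
  interpret C: riem_curve M I c using sc II by unfold_locales blast+
  \<comment> \<open>Continuity of the curve into \<open>N\<close>, with its own topology, keeps it
    in the slice \<open>W\<close> for small parameters.\<close>
  define S where "S = {t \<in> I. c t \<in> W}"
  have "openin (top_of_set I) S" unfolding S_def
    using openin_continuous_map_preimage[OF cN slice(2)[OF s]] by simp
  then have "open S" using II(1) openin_open_eq by blast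
  then have uS: "uds S" by (rule open_uds)
  have S0: "0 \<in> S" using II c0 p by (simp add: S_def)
  have SI: "S \<subseteq> I" by (auto simp: S_def)
  have c0phi: "c 0 \<in> fst \<phi>" using c0 cp by simp
  note D = C.field_has_vector_derivative[OF fa II(3) cp(1) c0phi]
  have "cov_deriv M I c V 0 \<phi> - \<Gamma> \<phi> (snd \<phi> (c 0)) (C.w 0 \<phi>) (V 0 \<phi>) \<in> L"
  proof (rule vector_derivative_in_subspace[OF slice(4)[OF s] uS S0 _ has_vector_derivative_within_subset[OF D SI]])
    fix t assume t: "t \<in> S"
    then have "t \<in> I" "c t \<in> W" by (auto simp: S_def)
    then show "V t \<phi> \<in> L" using Vsub tangent_sub_iff[OF s, of "c t"] by blast
  qed
  then have 1: "cov_deriv M I c V 0 \<phi> - \<Gamma> \<phi> (snd \<phi> p) (X \<phi>) (Y \<phi>) \<in> L"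
    using vel c0 V0 by (simp add: C.w_def)
  have 2: "cov_deriv M I c V 0 \<phi> - z \<phi> \<in> L"
    using z tangent_sub_iff[OF s p] by simp
  from subspace_diff[OF slice(4)[OF s] 2 1] show ?thesis by simp
qed

text \<open>Against a normal vector only the normal part of the Christoffel term counts. The
  definite description is discharged by the witness and by \<open>second_ff_unique\<close>: two
  candidates differ by a vector that is both normal and tangent to \<open>N\<close>.\<close>

lemma second_ff_normal:
  assumes X: "X \<in> tangent_sub M k N p" and Y: "Y \<in> tangent_sub M k N p" and \<nu>: "\<nu> \<in> normal_space M k N p"
  shows "ip M p (second_ff M k N p X Y) \<nu> = g \<phi> (snd \<phi> p) (\<Gamma> \<phi> (snd \<phi> p) (X \<phi>) (Y \<phi>)) (\<nu> \<phi>)"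
proof -
  note cp = slice_p(1,2)
  let ?G = "\<Gamma> \<phi> (snd \<phi> p) (X \<phi>) (Y \<phi>)"
  obtain l where l: "l \<in> L" "coord_vec M \<phi> p (?G - l) \<in> normal_space M k N p" using normal_part .
  let ?z = "coord_vec M \<phi> p (?G - l)"
  have eqz: "coord_vec M \<phi> p ?G - ?z = coord_vec M \<phi> p l"
    using coord_vec_linear(1)[OF cp, of "?G - l" l] by (simp add: algebra_simps)
  have "second_ff M k N p X Y = ?z"
    unfolding second_ff_def
  proof (rule the_equality)
    obtain \<epsilon> c V where w: "\<epsilon> > 0" "let I = {-\<epsilon><..<\<epsilon>} in
        smooth_curve M I c \<and> continuous_map (top_of_set I) N c \<and>
        c 0 = p \<and> velocity M I c 0 = X \<and>
        field_along M I c V \<and> (\<forall>t\<in>I. V t \<in> tangent_sub M k N (c t)) \<and> V 0 = Y \<and>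
        cov_deriv M I c V 0 = coord_vec M \<phi> p ?G"
      using second_ff_witness[OF X Y] by blast
    have "let I = {-\<epsilon><..<\<epsilon>} in
        smooth_curve M I c \<and> continuous_map (top_of_set I) N c \<and>
        c 0 = p \<and> velocity M I c 0 = X \<and>
        field_along M I c V \<and> (\<forall>t\<in>I. V t \<in> tangent_sub M k N (c t)) \<and> V 0 = Y \<and>
        cov_deriv M I c V 0 - ?z \<in> tangent_sub M k N p"
      using w(2) eqz coord_vec_sub[OF l(1)] unfolding Let_def by presburger
    then show "?z \<in> normal_space M k N p \<and> (\<exists>\<epsilon>>0. \<exists>c V. let I = {-\<epsilon><..<\<epsilon>} in
        smooth_curve M I c \<and> continuous_map (top_of_set I) N c \<and>
        c 0 = p \<and> velocity M I c 0 = X \<and>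
        field_along M I c V \<and> (\<forall>t\<in>I. V t \<in> tangent_sub M k N (c t)) \<and> V 0 = Y \<and>
        cov_deriv M I c V 0 - ?z \<in> tangent_sub M k N p)"
      using w(1) l(2) by blast
  next
    fix z assume z: "z \<in> normal_space M k N p \<and> (\<exists>\<epsilon>>0. \<exists>c V. let I = {-\<epsilon><..<\<epsilon>} in
        smooth_curve M I c \<and> continuous_map (top_of_set I) N c \<and>
        c 0 = p \<and> velocity M I c 0 = X \<and>
        field_along M I c V \<and> (\<forall>t\<in>I. V t \<in> tangent_sub M k N (c t)) \<and> V 0 = Y \<and>
        cov_deriv M I c V 0 - z \<in> tangent_sub M k N p)"
    then have zL: "?G - z \<phi> \<in> L"
      unfolding Let_def by (elim conjE exE) (rule second_ff_unique[OF X Y _ refl])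
    have zn: "z \<in> normal_space M k N p" using z by blast
    have zt: "z \<in> tangent_space M p" by (rule normal_tangent[OF zn])
    have dL: "?z \<phi> - z \<phi> \<in> L"
      using subspace_diff[OF slice(4)[OF s] zL l(1)] by (simp add: coord_vec_chart[OF cp] algebra_simps)
    have "?z \<phi> - z \<phi> = 0"
    proof (rule ccontr)
      assume "?z \<phi> - z \<phi> \<noteq> 0"
      from g_pos[OF slice_p(1,3) this] show False
        using normal_orth(1)[OF l(2) dL] normal_orth(1)[OF zn dL] linear_diff[OF g_linear1[OF slice_p(1,3)]] by simp
    qed
    then show "z = ?z" using tangent_eqI[OF zt coord_vec_tangent[OF cp] cp] by simp
  qed
  then show ?thesis
    using ip_coord[OF coord_vec_tangent[OF cp] normal_tangent[OF \<nu>] cp, of "?G - l"] normal_orth(2)[OF \<nu> l(1)]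
    by (simp add: coord_vec_chart[OF cp] linear_diff[OF g_linear1[OF slice_p(1,3)]])
qed

text \<open>Riesz representation on \<open>L\<close> discharges the definite description. The
  resulting formula makes symmetry of the shape operator a consequence of symmetry of the
  Christoffel symbols.\<close>

lemma shape_op_spec:
  assumes X: "X \<in> tangent_sub M k N p" and \<nu>: "\<nu> \<in> normal_space M k N p"
  shows "shape_op M k N p \<nu> X \<in> tangent_sub M k N p"
    "Y \<in> tangent_sub M k N p \<Longrightarrow>
      ip M p (shape_op M k N p \<nu> X) Y = g \<phi> (snd \<phi> p) (\<Gamma> \<phi> (snd \<phi> p) (X \<phi>) (Y \<phi>)) (\<nu> \<phi>)"
proof -
  note cp = slice_p(1,2) and gx = g_linear1[OF slice_p(1,3)] g_linear2[OF slice_p(1,3)] g_pos[OF slice_p(1,3)]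
  let ?f = "\<lambda>m. g \<phi> (snd \<phi> p) (\<Gamma> \<phi> (snd \<phi> p) (X \<phi>) m) (\<nu> \<phi>)"
  have "linear ?f" using linear_compose[OF christoffel_linear2[OF slice_p(1,3)] gx(1)] by (simp add: o_def)
  from riesz_subspace[where g = "g \<phi> (snd \<phi> p)", OF gx slice(4)[OF s] this]
  obtain l where l: "l \<in> L" "\<And>m. m \<in> L \<Longrightarrow> g \<phi> (snd \<phi> p) l m = ?f m" by blast
  have ex: "coord_vec M \<phi> p l \<in> tangent_sub M k N p \<and>
    (\<forall>y\<in>tangent_sub M k N p. ip M p (coord_vec M \<phi> p l) y = ip M p (second_ff M k N p X y) \<nu>)"
  proof (intro conjI ballI coord_vec_sub[OF l(1)])
    fix y assume y: "y \<in> tangent_sub M k N p"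
    then have yL: "y \<in> tangent_space M p" "y \<phi> \<in> L" using tangent_sub_iff[OF s p] by auto
    show "ip M p (coord_vec M \<phi> p l) y = ip M p (second_ff M k N p X y) \<nu>"
      using ip_coord[OF coord_vec_tangent[OF cp] yL(1) cp, of l] l(2)[OF yL(2)] second_ff_normal[OF X y \<nu>]
      by (simp add: coord_vec_chart[OF cp])
  qed
  have "shape_op M k N p \<nu> X \<in> tangent_sub M k N p \<and>
    (\<forall>y\<in>tangent_sub M k N p. ip M p (shape_op M k N p \<nu> X) y = ip M p (second_ff M k N p X y) \<nu>)"
    unfolding shape_op_def
  proof (rule theI[where P = "\<lambda>s. s \<in> tangent_sub M k N p \<and> (\<forall>y\<in>tangent_sub M k N p. ip M p s y = ip M p (second_ff M k N p X y) \<nu>)", OF ex])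
    fix t assume t: "t \<in> tangent_sub M k N p \<and> (\<forall>y\<in>tangent_sub M k N p. ip M p t y = ip M p (second_ff M k N p X y) \<nu>)"
    have tt: "t \<in> tangent_space M p" "t \<phi> \<in> L" using t tangent_sub_iff[OF s p] by auto
    have dL: "t \<phi> - l \<in> L" using subspace_diff[OF slice(4)[OF s] tt(2) l(1)] .
    have "ip M p t (coord_vec M \<phi> p (t \<phi> - l)) = ip M p (coord_vec M \<phi> p l) (coord_vec M \<phi> p (t \<phi> - l))"
      using t ex coord_vec_sub[OF dL] by simp
    then have "g \<phi> (snd \<phi> p) (t \<phi> - l) (t \<phi> - l) = 0"
      using ip_coord[OF tt(1) coord_vec_tangent[OF cp] cp, of "t \<phi> - l"]
        ip_coord[OF coord_vec_tangent[OF cp] coord_vec_tangent[OF cp] cp, of l "t \<phi> - l"]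
      by (simp add: coord_vec_chart[OF cp] linear_diff[OF gx(1)])
    then have "t \<phi> - l = 0" using gx(3)[of "t \<phi> - l"] by fastforce
    then show "t = coord_vec M \<phi> p l" using tangent_eqI[OF tt(1) coord_vec_tangent[OF cp] cp] by (simp add: coord_vec_chart[OF cp])
  qed
  then show "shape_op M k N p \<nu> X \<in> tangent_sub M k N p"
    "Y \<in> tangent_sub M k N p \<Longrightarrow>
      ip M p (shape_op M k N p \<nu> X) Y = g \<phi> (snd \<phi> p) (\<Gamma> \<phi> (snd \<phi> p) (X \<phi>) (Y \<phi>)) (\<nu> \<phi>)"
    using second_ff_normal[OF X _ \<nu>] by simp_all
qed

lemma shape_op_symmetric:
  assumes "X \<in> tangent_sub M k N p" "Y \<in> tangent_sub M k N p" "\<nu> \<in> normal_space M k N p"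
  shows "ip M p (shape_op M k N p \<nu> X) Y = ip M p (shape_op M k N p \<nu> Y) X"
  using shape_op_spec(2)[OF assms(1,3,2)] shape_op_spec(2)[OF assms(2,3,1)] christoffel_commute[OF slice_p(1,3)] by simp

end

end

section \<open>Counting focal points\<close>

context riem_mfd
begin

lemma tangent_sum:
  assumes "\<And>i. i \<in> A \<Longrightarrow> v i \<in> tangent_space M p"
  shows "(\<Sum>i\<in>A. c i *\<^sub>R v i) \<in> tangent_space M p"
  using assms
proof (induction A rule: infinite_finite_induct)
  case (insert i A)
  show ?case unfolding sum.insert[OF insert.hyps(1,2)]
    by (intro tangent_add tangent_scale insert.IH insert.prems) auto
qed (simp_all add: tangent_zero)

lemma ip_sum_sum:
  assumes p: "p \<in> topspace (Top M)" and v: "\<And>i. i \<in> A \<Longrightarrow> v i \<in> tangent_space M p"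
    and u: "\<And>j. j \<in> B \<Longrightarrow> u j \<in> tangent_space M p"
  shows "ip M p (\<Sum>i\<in>A. c i *\<^sub>R v i) (\<Sum>j\<in>B. d j *\<^sub>R u j) = (\<Sum>i\<in>A. \<Sum>j\<in>B. c i * (d j * ip M p (v i) (u j)))"
proof -
  obtain \<phi> where ch: "\<phi> \<in> Atlas M" "p \<in> fst \<phi>" using chart_exists[OF p] .
  have xU: "snd \<phi> p \<in> U \<phi>" using ch by auto
  note g1 = g_linear1[OF ch(1) xU] and g2 = g_linear2[OF ch(1) xU]
  have "ip M p (\<Sum>i\<in>A. c i *\<^sub>R v i) (\<Sum>j\<in>B. d j *\<^sub>R u j) =
    g \<phi> (snd \<phi> p) (\<Sum>i\<in>A. c i *\<^sub>R v i \<phi>) (\<Sum>j\<in>B. d j *\<^sub>R u j \<phi>)"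
    using ip_coord[OF tangent_sum[OF v] tangent_sum[OF u] ch] by (simp add: sum_fun_apply scaleR_fun_def)
  also have "\<dots> = (\<Sum>i\<in>A. \<Sum>j\<in>B. c i * (d j * g \<phi> (snd \<phi> p) (v i \<phi>) (u j \<phi>)))"
    unfolding linear_sum[OF g1] linear_scale[OF g1] unfolding linear_sum[OF g2] linear_scale[OF g2] by (simp add: sum_distrib_left)
  also have "\<dots> = (\<Sum>i\<in>A. \<Sum>j\<in>B. c i * (d j * ip M p (v i) (u j)))"
    by (intro sum.cong refl) (simp add: ip_coord[OF v u ch])
  finally show ?thesis .
qed

end

context riem_curve
begin

section \<open>Linear combinations of Jacobi fields\<close>

lemma covd_add:
  assumes V: "covd T V V'" and W: "covd T W W'" and T: "T \<subseteq> I"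
  shows "covd T (\<lambda>t. V t + W t) (\<lambda>t. V' t + W' t)"
  unfolding covd_def
proof (intro conjI ballI impI)
  fix t assume t: "t \<in> T"
  show "V t + W t \<in> tangent_space M (\<gamma> t)" "V' t + W' t \<in> tangent_space M (\<gamma> t)"
    by (intro tangent_add covdD[OF V t] covdD[OF W t])+
  fix \<phi> assume c: "\<phi> \<in> Atlas M" "\<gamma> t \<in> fst \<phi>"
  have lin: "linear (\<Gamma> \<phi> (x \<phi> t) (w t \<phi>))" using c by (intro christoffel_linear2) auto
  show "((\<lambda>s. (V s + W s) \<phi>) has_vector_derivative
     (V' t + W' t) \<phi> - \<Gamma> \<phi> (x \<phi> t) (w t \<phi>) ((V t + W t) \<phi>)) (at t within T)"
    using has_vector_derivative_add[OF covdD(3)[OF V t c] covdD(3)[OF W t c]]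
    by (simp add: linear_add[OF lin] algebra_simps)
qed

lemma covd_scale:
  assumes V: "covd T V V'"
  shows "covd T (\<lambda>t. r *\<^sub>R V t) (\<lambda>t. r *\<^sub>R V' t)"
  unfolding covd_def
proof (intro conjI ballI impI)
  fix t assume t: "t \<in> T"
  show "r *\<^sub>R V t \<in> tangent_space M (\<gamma> t)" "r *\<^sub>R V' t \<in> tangent_space M (\<gamma> t)"
    by (intro tangent_scale covdD[OF V t])+
  fix \<phi> assume c: "\<phi> \<in> Atlas M" "\<gamma> t \<in> fst \<phi>"
  have lin: "linear (\<Gamma> \<phi> (x \<phi> t) (w t \<phi>))" using c by (intro christoffel_linear2) auto
  show "((\<lambda>s. (r *\<^sub>R V s) \<phi>) has_vector_derivative
     (r *\<^sub>R V' t) \<phi> - \<Gamma> \<phi> (x \<phi> t) (w t \<phi>) ((r *\<^sub>R V t) \<phi>)) (at t within T)"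
    using bounded_linear.has_vector_derivative[OF bounded_linear_scaleR_right covdD(3)[OF V t c], of r]
    by (simp add: scaleR_fun_def linear_scale[OF lin] scaleR_diff_right)
qed

lemma covd_zero: "covd T (\<lambda>t. 0) (\<lambda>t. 0)"
  unfolding covd_def
proof (intro conjI ballI impI tangent_zero)
  fix \<phi> t assume c: "\<phi> \<in> Atlas M" "\<gamma> t \<in> fst \<phi>"
  have lin: "linear (\<Gamma> \<phi> (x \<phi> t) (w t \<phi>))" using c by (intro christoffel_linear2) auto
  show "((\<lambda>s. 0 \<phi>) has_vector_derivative 0 \<phi> - \<Gamma> \<phi> (x \<phi> t) (w t \<phi>) (0 \<phi>)) (at t within T)"
    by (simp add: linear_0[OF lin])
qed

lemma Rop_linear:
  shows "Rop t (u + v) = Rop t u + Rop t v" "Rop t (r *\<^sub>R u) = r *\<^sub>R Rop t u"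
proof -
  have "Rop t (u + v) \<phi> = (Rop t u + Rop t v) \<phi> \<and> Rop t (r *\<^sub>R u) \<phi> = (r *\<^sub>R Rop t u) \<phi>" for \<phi>
  proof (cases "chart_at M (\<gamma> t) \<phi>")
    case True
    then have c: "\<phi> \<in> Atlas M" "\<gamma> t \<in> fst \<phi>" by (simp_all add: chart_at_def)
    have xU: "x \<phi> t \<in> U \<phi>" using c by auto
    show ?thesis
      by (simp add: Rop_chart[OF c] scaleR_fun_def linear_add[OF R_linear(1)[OF c(1) xU]] linear_scale[OF R_linear(1)[OF c(1) xU]])
  next
    case False
    then show ?thesis by (simp add: Rop_def curvature_def scaleR_fun_def)
  qed
  then show "Rop t (u + v) = Rop t u + Rop t v" "Rop t (r *\<^sub>R u) = r *\<^sub>R Rop t u" by (auto intro!: ext)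
qed

lemma jac_add: "jac I J J' \<Longrightarrow> jac I K K' \<Longrightarrow> jac I (\<lambda>t. J t + K t) (\<lambda>t. J' t + K' t)"
  unfolding jac_def
proof (elim conjE, intro conjI)
  assume *: "covd I J J'" "covd I J' (\<lambda>t. - Rop t (J t))" "covd I K K'" "covd I K' (\<lambda>t. - Rop t (K t))"
  show "covd I (\<lambda>t. J t + K t) (\<lambda>t. J' t + K' t)" by (intro covd_add * subset_refl)
  show "covd I (\<lambda>t. J' t + K' t) (\<lambda>t. - Rop t (J t + K t))"
    by (rule covd_cong[OF covd_add[OF *(2,4) subset_refl] refl]) (simp add: Rop_linear)
qed

lemma jac_scale: "jac I J J' \<Longrightarrow> jac I (\<lambda>t. r *\<^sub>R J t) (\<lambda>t. r *\<^sub>R J' t)"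
  unfolding jac_def
proof (elim conjE, intro conjI)
  assume *: "covd I J J'" "covd I J' (\<lambda>t. - Rop t (J t))"
  show "covd I (\<lambda>t. r *\<^sub>R J t) (\<lambda>t. r *\<^sub>R J' t)" by (rule covd_scale[OF *(1)])
  show "covd I (\<lambda>t. r *\<^sub>R J' t) (\<lambda>t. - Rop t (r *\<^sub>R J t))"
    by (rule covd_cong[OF covd_scale[OF *(2), of r] refl]) (simp only: Rop_linear scaleR_minus_right)
qed

lemma jac_zero: "jac I (\<lambda>t. 0) (\<lambda>t. 0)"
proof -
  have "- Rop t 0 = 0" for t using Rop_linear(2)[of t 0 0] by simp
  then show ?thesis unfolding jac_def using covd_zero[of I] by simp
qed

lemma jac_sum:
  assumes "\<And>i. i \<in> A \<Longrightarrow> jac I (J i) (J' i)"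
  shows "jac I (\<lambda>t. \<Sum>i\<in>A. c i *\<^sub>R J i t) (\<lambda>t. \<Sum>i\<in>A. c i *\<^sub>R J' i t)"
  using assms
proof (induction A rule: infinite_finite_induct)
  case (insert i A)
  show ?case unfolding sum.insert[OF insert.hyps(1,2)]
    by (intro jac_add jac_scale insert.IH insert.prems) auto
next
  case (infinite A)
  show ?case unfolding sum.infinite[OF infinite.hyps] by (rule jac_zero)
next
  case empty
  show ?case unfolding sum.empty by (rule jac_zero)
qed

lemma isotropic_sums:
  assumes r: "r \<in> I" and J: "\<And>i. i \<in> A \<Longrightarrow> jac I (J i) (J' i)" and K: "\<And>j. j \<in> B \<Longrightarrow> jac I (K j) (K' j)"
    and iso: "\<And>i j. i \<in> A \<Longrightarrow> j \<in> B \<Longrightarrow> ip M (\<gamma> r) (J' i r) (K j r) = ip M (\<gamma> r) (J i r) (K' j r)"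
  shows "ip M (\<gamma> r) (\<Sum>i\<in>A. c i *\<^sub>R J' i r) (\<Sum>j\<in>B. d j *\<^sub>R K j r) =
    ip M (\<gamma> r) (\<Sum>i\<in>A. c i *\<^sub>R J i r) (\<Sum>j\<in>B. d j *\<^sub>R K' j r)"
proof -
  have T: "J i r \<in> tangent_space M (\<gamma> r)" "J' i r \<in> tangent_space M (\<gamma> r)" if "i \<in> A" for i
    using J[OF that] r unfolding jac_def covd_def by blast+
  have T': "K j r \<in> tangent_space M (\<gamma> r)" "K' j r \<in> tangent_space M (\<gamma> r)" if "j \<in> B" for j
    using K[OF that] r unfolding jac_def covd_def by blast+
  have "ip M (\<gamma> r) (\<Sum>i\<in>A. c i *\<^sub>R J' i r) (\<Sum>j\<in>B. d j *\<^sub>R K j r) =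
    (\<Sum>i\<in>A. \<Sum>j\<in>B. c i * (d j * ip M (\<gamma> r) (J' i r) (K j r)))"
    by (rule ip_sum_sum[OF \<gamma>_topspace[OF r] T(2) T'(1)])
  also have "\<dots> = (\<Sum>i\<in>A. \<Sum>j\<in>B. c i * (d j * ip M (\<gamma> r) (J i r) (K' j r)))"
    by (intro sum.cong refl) (simp add: iso)
  also have "\<dots> = ip M (\<gamma> r) (\<Sum>i\<in>A. c i *\<^sub>R J i r) (\<Sum>j\<in>B. d j *\<^sub>R K' j r)"
    by (rule ip_sum_sum[OF \<gamma>_topspace[OF r] T(1) T'(2), symmetric])
  finally show ?thesis .
qed

end

locale orthogonal_geodesic_no_conj = riem_geodesic M I \<gamma> + riem_submanifold M k N
  for M :: "('a, 'e::euclidean_space) riem" and I :: "real set" and \<gamma> :: "real \<Rightarrow> 'a" and k :: nat and N :: "'a topology" +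
  assumes zero: "0 \<in> I" and base: "\<gamma> 0 \<in> topspace N"
    and normal: "velocity M I \<gamma> 0 \<in> normal_space M k N (\<gamma> 0)" and nc: "without_conjugate_points M"
begin

abbreviation "\<Lambda> \<equiv> N_jacobi M k N I \<gamma>"
abbreviation "D \<equiv> cov_deriv M I \<gamma>"

lemma N_jacobiD:
  assumes "J \<in> \<Lambda>"
  shows "jac I J (D J)" "J 0 \<in> tangent_sub M k N (\<gamma> 0)"
    "D J 0 + shape_op M k N (\<gamma> 0) (velocity M I \<gamma> 0) (J 0) \<in> normal_space M k N (\<gamma> 0)"
    "\<And>t. t \<notin> I \<Longrightarrow> J t = 0"
  using assms jacobi_field_jac unfolding N_jacobi_def normal_jacobi_field_def jacobi_field_def field_along_def by auto

text \<open>The Wronskian is constant, so it is evaluated at 0. There \<open>D J 0\<close> plus the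
  shape operator term is normal and \<open>K 0\<close> is tangent to \<open>N\<close>, so the
  pairing is minus a form that is symmetric in \<open>J\<close> and \<open>K\<close>.\<close>

lemma N_jacobi_isotropic:
  assumes J: "J \<in> \<Lambda>" and K: "K \<in> \<Lambda>" and r: "r \<in> I"
  shows "ip M (\<gamma> r) (D J r) (K r) = ip M (\<gamma> r) (J r) (D K r)"
proof -
  obtain \<phi> W L where p: "\<gamma> 0 \<in> W" and s: "slice_chart M k N \<phi> W L"
    using submanifold base unfolding submanifold_def by blast
  let ?S = "shape_op M k N (\<gamma> 0) (velocity M I \<gamma> 0)"
  have at0: "ip M (\<gamma> 0) (D J 0) (K 0) = - ip M (\<gamma> 0) (?S (J 0)) (K 0)" if J: "J \<in> \<Lambda>" and K: "K \<in> \<Lambda>" for J K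
  proof -
    have T: "D J 0 \<in> tangent_space M (\<gamma> 0)" using N_jacobiD(1)[OF J] zero unfolding jac_def covd_def by blast
    have S: "?S (J 0) \<in> tangent_space M (\<gamma> 0)"
      using shape_op_spec(1)[OF s p N_jacobiD(2)[OF J] normal] unfolding tangent_sub_def by blast
    have K0: "K 0 \<in> tangent_space M (\<gamma> 0)" using N_jacobiD(2)[OF K] unfolding tangent_sub_def by blast
    have "ip M (\<gamma> 0) (D J 0 + ?S (J 0)) (K 0) = 0"
      using N_jacobiD(3)[OF J] N_jacobiD(2)[OF K] unfolding normal_space_def by blast
    then show ?thesis using ip_props(2)[OF \<gamma>_topspace[OF zero] T K0 S] by simp
  qed
  have T: "J 0 \<in> tangent_space M (\<gamma> 0)" "D K 0 \<in> tangent_space M (\<gamma> 0)"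
    using N_jacobiD(1)[OF J] N_jacobiD(1)[OF K] zero unfolding jac_def covd_def by blast+
  have "ip M (\<gamma> 0) (D J 0) (K 0) = ip M (\<gamma> 0) (J 0) (D K 0)"
    using at0[OF J K] at0[OF K J] ip_props(1)[OF \<gamma>_topspace[OF zero] T]
      shape_op_symmetric[OF s p N_jacobiD(2)[OF J] N_jacobiD(2)[OF K] normal] by simp
  then show ?thesis using wronskian_constant[OF N_jacobiD(1)[OF J] N_jacobiD(1)[OF K] zero r] by simp
qed

text \<open>The values at 0 of all the chosen fields, read in a slice chart, form an independent
  family in the space \<open>L\<close> of dimension \<open>k\<close>.\<close>

lemma card_independent_le:
  assumes T: "finite T" "T \<subseteq> I - {0}" and fin: "\<And>t. t \<in> T \<Longrightarrow> finite (B t)"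
    and ind: "\<And>t. t \<in> T \<Longrightarrow> independent (B t)" and sub: "\<And>t. t \<in> T \<Longrightarrow> B t \<subseteq> {J \<in> \<Lambda>. J t = 0}"
  shows "(\<Sum>t\<in>T. card (B t)) \<le> k"
proof -
  obtain \<phi> W L where p: "\<gamma> 0 \<in> W" and s: "slice_chart M k N \<phi> W L"
    using submanifold base unfolding submanifold_def by blast
  note cp = slice_p(1,2)[OF s p]
  \<comment> \<open>Pairs of a point and a field: that one field is not counted at two points is
    part of what is being proved.\<close>
  define X where "X = Sigma T B"
  have finX: "finite X" unfolding X_def using T fin by blast
  have XL: "snd x \<in> \<Lambda>" if "x \<in> X" for x
  proof -
    have "fst x \<in> T" "snd x \<in> B (fst x)" using that by (auto simp: X_def)
    then show ?thesis using sub[of "fst x"] by blast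
  qed
  have "card X \<le> dim L"
  proof (rule card_le_dim_family[where h = "\<lambda>x. snd x 0 \<phi>", OF finX])
    show "snd x 0 \<phi> \<in> L" if "x \<in> X" for x
      using N_jacobiD(2)[OF XL[OF that]] tangent_sub_iff[OF s p] by blast
    fix c :: "real \<times> (real \<Rightarrow> ('a, 'e) tvec) \<Rightarrow> real" and x
    assume c0: "(\<Sum>x\<in>X. c x *\<^sub>R snd x 0 \<phi>) = 0" and x: "x \<in> X"
    have T0: "0 \<notin> T" using T(2) by blast
    text \<open>The negative of the total sum vanishes at \<open>0\<close>, so it is one more member of the family.\<close>
    define K where "K t = (if t = 0 then (\<lambda>r. \<Sum>x\<in>X. (- c x) *\<^sub>R snd x r) else (\<lambda>r. \<Sum>J\<in>B t. c (t, J) *\<^sub>R J r))" for t :: real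
    define K' where "K' t = (if t = 0 then (\<lambda>r. \<Sum>x\<in>X. (- c x) *\<^sub>R D (snd x) r) else (\<lambda>r. \<Sum>J\<in>B t. c (t, J) *\<^sub>R D J r))" for t :: real
    have K0: "K 0 = (\<lambda>r. \<Sum>x\<in>X. (- c x) *\<^sub>R snd x r)" "K' 0 = (\<lambda>r. \<Sum>x\<in>X. (- c x) *\<^sub>R D (snd x) r)"
      by (simp_all add: K_def K'_def)
    have Kt: "K t = (\<lambda>r. \<Sum>J\<in>B t. c (t, J) *\<^sub>R J r)" "K' t = (\<lambda>r. \<Sum>J\<in>B t. c (t, J) *\<^sub>R D J r)" if "t \<in> T" for t
      using that T0 by (auto simp: K_def K'_def)
    have BL: "J \<in> \<Lambda>" "J t = 0" if "t \<in> T" "J \<in> B t" for t J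
      using sub[OF that(1)] that(2) by blast+
    have jK0: "jac I (K 0) (K' 0)" unfolding K0 by (rule jac_sum) (rule N_jacobiD(1)[OF XL])
    have jKt: "jac I (K t) (K' t)" if "t \<in> T" for t
      unfolding Kt[OF that] by (rule jac_sum) (rule N_jacobiD(1)[OF BL(1)[OF that]])
    have iso: "ip M (\<gamma> r) (K' s r) (K t r) = ip M (\<gamma> r) (K s r) (K' t r)"
      if st: "s \<in> insert 0 T" "t \<in> insert 0 T" "r \<in> I" for s t r
    proof -
      note iS = isotropic_sums[OF st(3) N_jacobiD(1) N_jacobiD(1) N_jacobi_isotropic[OF _ _ st(3)]]
      consider "s = 0" "t = 0" | "s = 0" "t \<in> T" | "s \<in> T" "t = 0" | "s \<in> T" "t \<in> T" using st by blast
      then show ?thesis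
      proof cases
        case 1 then show ?thesis unfolding 1 K0 by (intro iS XL)
      next
        case 2 then show ?thesis unfolding 2(1) K0 Kt[OF 2(2)] by (intro iS XL BL(1)[OF 2(2)])
      next
        case 3 then show ?thesis unfolding 3(2) K0 Kt[OF 3(1)] by (intro iS XL BL(1)[OF 3(1)])
      next
        case 4 then show ?thesis unfolding Kt[OF 4(1)] Kt[OF 4(2)] by (intro iS BL(1)[OF 4(1)] BL(1)[OF 4(2)])
      qed
    qed
    have van0: "K 0 0 = 0"
    proof (rule tangent_eqI[OF _ tangent_zero cp])
      show "K 0 0 \<in> tangent_space M (\<gamma> 0)" using jK0 zero unfolding jac_def covd_def by blast
      show "K 0 0 \<phi> = 0 \<phi>" unfolding K0 using c0 by (simp add: sum_fun_apply scaleR_fun_def sum_negf)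
    qed
    have vant: "K t t = 0" if "t \<in> T" for t
      unfolding Kt[OF that] by (rule sum.neutral) (simp add: BL(2)[OF that] scaleR_fun_def zero_fun_def)
    have total: "(\<Sum>t\<in>insert 0 T. K t r) = 0" for r
    proof -
      have "(\<Sum>t\<in>T. K t r) = (\<Sum>t\<in>T. \<Sum>J\<in>B t. c (t, J) *\<^sub>R J r)" by (rule sum.cong) (simp_all add: Kt)
      also have "\<dots> = (\<Sum>x\<in>X. c x *\<^sub>R snd x r)"
        unfolding X_def using sum.Sigma[of T B "\<lambda>t J. c (t, J) *\<^sub>R J r"] T(1) fin by (simp add: split_def)
      finally have "(\<Sum>t\<in>T. K t r) = (\<Sum>x\<in>X. c x *\<^sub>R snd x r)" .
      then show ?thesis unfolding sum.insert[OF T(1) T0] K0 by (simp only: scaleR_minus_left sum_negf left_minus)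
    qed
    obtain t J where tJ: "x = (t, J)" "t \<in> T" "J \<in> B t" using x unfolding X_def by blast
    have "K t r = 0" if "r \<in> I" for r
    proof (rule vanishing_independent[where J = K and J' = K', OF nc _ _ _ _ iso total _ that])
      show "finite (insert 0 T)" "insert 0 T \<subseteq> I" "t \<in> insert 0 T" using T zero tJ by auto
      show "jac I (K t) (K' t)" if "t \<in> insert 0 T" for t using that jK0 jKt by blast
      show "K t t = 0" if "t \<in> insert 0 T" for t using that van0 vant by blast
    qed
    \<comment> \<open>Independence of \<open>B t\<close> is independence of functions on the whole
      line; outside \<open>I\<close> the fields are 0 by convention.\<close>
    moreover have "K t r = 0" if "r \<notin> I" for r
      unfolding Kt[OF tJ(2)] by (rule sum.neutral) (simp add: N_jacobiD(4)[OF BL(1)[OF tJ(2)] that] scaleR_fun_def zero_fun_def)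
    ultimately have "K t = 0" by (auto simp: fun_eq_iff)
    moreover have "(\<Sum>J\<in>B t. c (t, J) *\<^sub>R J) = K t"
      unfolding Kt[OF tJ(2)] by (rule ext) (simp add: sum_fun_apply scaleR_fun_def)
    ultimately have "(\<Sum>J\<in>B t. c (t, J) *\<^sub>R J) = 0" by simp
    from independentD[OF ind[OF tJ(2)] fin[OF tJ(2)] subset_refl this tJ(3)] show "c x = 0" by (simp add: tJ(1))
  qed
  moreover have "card X = (\<Sum>t\<in>T. card (B t))" unfolding X_def using T(1) fin by (simp add: card_SigmaI)
  ultimately show ?thesis using slice(5)[OF s] by simp
qed

text \<open>Finiteness is asserted along with the bound because a sum over an infinite set is 0 by
  convention and would satisfy the bound vacuously.\<close>

theorem focal_count:
  "finite (focal_points M k N I \<gamma>) \<and>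
   (\<Sum>t\<in>focal_points M k N I \<gamma>. focal_multiplicity M k N I \<gamma> t) \<le> k"
proof
  let ?F = "focal_points M k N I \<gamma>"
  have FI: "?F \<subseteq> I - {0}" unfolding focal_points_def by blast
  show fin: "finite ?F"
  proof (rule ccontr)
    assume "infinite ?F"
    \<comment> \<open>One nonzero field at each of \<open>Suc k\<close> focal points would already
      exceed the bound \<open>k\<close>.\<close>
    then obtain T where T: "finite T" "card T = Suc k" "T \<subseteq> ?F"
      using infinite_arbitrarily_large by blast
    have "\<exists>J. J \<in> \<Lambda> \<and> J \<noteq> 0 \<and> J t = 0" if "t \<in> T" for t using T(3) that unfolding focal_points_def by blast
    then obtain J where J: "\<And>t. t \<in> T \<Longrightarrow> J t \<in> \<Lambda> \<and> J t \<noteq> 0 \<and> J t t = 0" by metis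
    have "(\<Sum>t\<in>T. card {J t}) \<le> k"
    proof (rule card_independent_le[OF T(1)])
      show "T \<subseteq> I - {0}" using T(3) FI by blast
      show "independent {J t}" if "t \<in> T" for t using J[OF that] by simp
    qed (use J in auto)
    then show False using T(2) by simp
  qed
  have "\<exists>B. finite B \<and> independent B \<and> B \<subseteq> {J \<in> \<Lambda>. J t = 0} \<and> card B = focal_multiplicity M k N I \<gamma> t" for t
  proof -
    obtain B where B: "B \<subseteq> {J \<in> \<Lambda>. J t = 0}" "independent B" "{J \<in> \<Lambda>. J t = 0} \<subseteq> span B"
      "card B = dim {J \<in> \<Lambda>. J t = 0}"
      by (rule basis_exists)
    show ?thesis
    proof (cases "finite B")
      case True
      then show ?thesis using B(1,2,4) unfolding focal_multiplicity_def by blast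
    next
      \<comment> \<open>An infinite basis has \<open>card\<close> equal to 0, so the multiplicity is
        0 by convention and the empty set serves.\<close>
      case False
      then have "focal_multiplicity M k N I \<gamma> t = 0" using B(4) unfolding focal_multiplicity_def by simp
      then show ?thesis by (intro exI[of _ "{}"]) (simp add: independent_empty)
    qed
  qed
  then have "\<forall>t. \<exists>B. finite B \<and> independent B \<and> B \<subseteq> {J \<in> \<Lambda>. J t = 0} \<and> card B = focal_multiplicity M k N I \<gamma> t" ..
  from choice[OF this] obtain B where B: "\<forall>t. finite (B t) \<and> independent (B t) \<and>
    B t \<subseteq> {J \<in> \<Lambda>. J t = 0} \<and> card (B t) = focal_multiplicity M k N I \<gamma> t" ..
  have "(\<Sum>t\<in>?F. card (B t)) \<le> k" 
  proof (rule card_independent_le[OF fin FI])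
    fix t
    show "finite (B t)" "independent (B t)" "B t \<subseteq> {J \<in> \<Lambda>. J t = 0}" using spec[OF B, of t] by blast+
  qed
  moreover have "card (B t) = focal_multiplicity M k N I \<gamma> t" for t using spec[OF B, of t] by blast
  ultimately show "(\<Sum>t\<in>?F. focal_multiplicity M k N I \<gamma> t) \<le> k" by (simp only:)
qed

end

theorem corollary1p2:
  fixes M :: "('a, 'e::euclidean_space) riem"
    and N :: "'a topology" and k :: nat
    and I :: "real set" and \<gamma> :: "real \<Rightarrow> 'a"
  assumes "riemannian_manifold M"
    and "without_conjugate_points M"
    and "submanifold M k N"
    and "orthogonal_geodesic M k N I \<gamma>"
  shows "finite (focal_points M k N I \<gamma>) \<and>
         (\<Sum>t\<in>focal_points M k N I \<gamma>. focal_multiplicity M k N I \<gamma> t) \<le> k"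
proof -
  have o: "geodesic M I \<gamma>" "\<not> \<gamma> constant_on I" "0 \<in> I" "\<gamma> 0 \<in> topspace N" "velocity M I \<gamma> 0 \<in> normal_space M k N (\<gamma> 0)"
    using assms(4) unfolding orthogonal_geodesic_def by blast+
  have i: "is_interval I" "smooth_curve M I \<gamma>" using o(1) unfolding geodesic_def by blast+
  \<comment> \<open>An interval containing 0 without two distinct points is just {0}, on which every
    curve is constant.\<close>
  have n: "\<exists>p\<in>I. \<exists>q\<in>I. p < q"
  proof (rule ccontr)
    assume n: "\<not> (\<exists>p\<in>I. \<exists>q\<in>I. p < q)"
    have "q = 0" if "q \<in> I" for q using n o(3) that by (metis linorder_neqE_linordered_idom)
    then show False using o(2) unfolding constant_on_def by metis
  qed
  interpret orthogonal_geodesic_no_conj M I \<gamma> k N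
    by unfold_locales (fact assms(1-3) i n o)+
  show ?thesis by (rule focal_count)
qed

end
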